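(* Let $K:\mathbb{R}_+^3\to[0,\infty)$ be measurable with $K(x,y,z)=K(y,x,z)$ for all $x,y,z$ and $K(x,y,z)=0$ whenever $z>x$. Let $\mu,\nu\in[0,2]$ with $\mu+\nu\le 3$ and $\lambda:=\max(\mu,\nu)>1$, let $\alpha\ge 0$ and $\varphi\in Y_{-2\alpha,2\lambda}^+$. Assume: (1) $K(x,y,z)\le \hat x^{-\alpha}\hat y^{-\alpha}\,\tfrac12\bigl(\check x^{\mu}\check y^{\nu}+\check x^{\nu}\check y^{\mu}\bigr)\varphi(z)$; (2) for $x\ge 0$ the second derivative of $K$ in its first variable satisfies $\partial_1^2K(\cdot,y,z)(x)\le \hat y^{-\alpha}\check y^{\lambda}\varphi(z)$; (3) if $\alpha>0$, there is a constant $C_\alpha>0$ with $\widehat{(x-z)}^{-\alpha}K(x,y,z)\le C_\alpha\,\hat x^{-2\alpha}\hat y^{-\alpha}\check x^{\lambda}\check y^{\lambda}\varphi(z)$ for $x\ge z\ge 0$. Let $c_0\in Y_{-\alpha,\lambda}^+$. Then the continuous generalized exchange-driven growth equation (CGEDG) with kernel $K$ has a global weak solution $c$, i.e. a weak solution on $[0,\infty)$ (the case $T=\infty$ of the definition in the context), with initial datum $c_0$ and parameters $(r,\beta)=(\lambda,\alpha)$.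
   Context: Notation: $\mathbb{R}_+=[0,\infty)$, $\hat x=\min(1,x)$, $\check x=\max(1,x)$, $\widehat{(x-z)}=\min(1,x-z)$. For $\beta\ge0$, $r\ge0$, $Y_{-\beta,r}=\{c\in L^1(\mathbb{R}_+):\|c\|_{-\beta,r}:=\int_0^\infty(x^{-\beta}+x^r)|c(x)|\,dx<\infty\}$, and $Y_{-\beta,r}^+$ is its cone of nonnegative elements. $Y_0=L^1(\mathbb{R}_+)$. Weak solution of (CGEDG): let $T\in(0,\infty]$ and $c_0\in Y_{-\beta,r}^+$. A weak solution on $[0,T)$ with initial datum $c_0$ and parameters $(r,\beta)$ is a map $c:[0,T)\to Y_{-\beta,r}^+$, $t\mapsto c_t$, such that, with $\kappa[c_s](x,y,z):=K(x,y,z)c_s(x)c_s(y)$: (a) $c\in C([0,T),Y_0)\cap L^\infty([0,T),Y_{-\beta,r})$; (b) for all $t\in[0,T)$, $\int_0^t\int_0^\infty\int_0^\infty\int_0^\infty\kappa[c_s](x,y,z)\,dy\,dx\,dz\,ds<\infty$; (c) for all $t\in[0,T)$ and all $f\in L^\infty(\mathbb{R}_+)$, $\int_0^\infty f(x)[c_t(x)-c_0(x)]\,dx=\int_0^t\iiint_D(\Delta_zf)(x)\,\kappa[c_s](x,y,z)\,dz\,dx\,dy\,ds$, where $D=\{(x,y,z)\in\mathbb{R}_+^3:x\ge z,\ y\ge z\}$ and $(\Delta_zf)(x)=f(x+z)-2f(x)+f(x-z)$.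
   Formalization: For T=∞ the condition that c lies in L^∞([0,T),Y_{-β,r}) is read as boundedness on every finite interval [0,S); a bound uniform on [0,∞) fails in general, since the λ-moment can grow without bound in time. *)

theory Defs
  imports "HOL-Analysis.Analysis"
begin

text \<open>Functions on \<open>[0,\<infinity>)\<close> are represented by functions on \<^typ>\<open>real\<close>, of which only the
  values at nonnegative arguments matter. Elements of \<open>L\<^sup>1\<close> and \<open>L\<^sup>\<infinity>\<close> are represented by arbitrary
  Lebesgue measurable representatives.\<close>

abbreviation Rplus :: "real set" where
  "Rplus \<equiv> {0..}"

text \<open>As \<open>0 powr a = 0\<close> for every \<open>a\<close>, the weight has the wrong value at \<open>x = 0\<close>; this is a
  null set and does not affect the integrals below.\<close>

definition Y_weight :: "real \<Rightarrow> real \<Rightarrow> real \<Rightarrow> real" where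
  "Y_weight \<beta> r x = x powr (- \<beta>) + x powr r"

definition Y_norm :: "real \<Rightarrow> real \<Rightarrow> (real \<Rightarrow> real) \<Rightarrow> real" where
  "Y_norm \<beta> r c = (LINT x|lebesgue_on Rplus. Y_weight \<beta> r x * \<bar>c x\<bar>)"

definition Y_space :: "real \<Rightarrow> real \<Rightarrow> (real \<Rightarrow> real) set" where
  "Y_space \<beta> r = {c. integrable (lebesgue_on Rplus) c \<and>
      integrable (lebesgue_on Rplus) (\<lambda>x. Y_weight \<beta> r x * \<bar>c x\<bar>)}"

definition Y_plus :: "real \<Rightarrow> real \<Rightarrow> (real \<Rightarrow> real) set" where
  "Y_plus \<beta> r = {c \<in> Y_space \<beta> r. AE x in lebesgue_on Rplus. 0 \<le> c x}"

definition L1_dist :: "(real \<Rightarrow> real) \<Rightarrow> (real \<Rightarrow> real) \<Rightarrow> real" where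
  "L1_dist c d = (LINT x|lebesgue_on Rplus. \<bar>c x - d x\<bar>)"

definition Linfty :: "(real \<Rightarrow> real) set" where
  "Linfty = {f \<in> borel_measurable (lebesgue_on Rplus).
      \<exists>M. AE x in lebesgue_on Rplus. \<bar>f x\<bar> \<le> M}"

definition kap :: "(real \<Rightarrow> real \<Rightarrow> real \<Rightarrow> real) \<Rightarrow> (real \<Rightarrow> real) \<Rightarrow> real \<Rightarrow> real \<Rightarrow> real \<Rightarrow> real" where
  "kap K c x y z = K x y z * c x * c y"

definition Dset :: "(real \<times> real \<times> real) set" where
  "Dset = {(x, y, z). 0 \<le> x \<and> 0 \<le> y \<and> 0 \<le> z \<and> z \<le> x \<and> z \<le> y}"

definition Delta :: "real \<Rightarrow> (real \<Rightarrow> real) \<Rightarrow> real \<Rightarrow> real" where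
  "Delta z f x = f (x + z) - 2 * f x + f (x - z)"

definition times :: "ereal \<Rightarrow> real set" where
  "times T = {t. 0 \<le> t \<and> ereal t < T}"

text \<open>In the boundedness clause, for finite \<open>T\<close> the strongest instance is \<open>S = T\<close>, which says
  \<open>c \<in> L\<^sup>\<infinity>([0,T), Y)\<close>. For \<open>T = \<infinity>\<close> the clause says that \<open>c \<in> L\<^sup>\<infinity>([0,S), Y)\<close> for every finite
  \<open>S\<close>: a bound that is uniform on \<open>[0,\<infinity>)\<close> cannot be meant, because second moments may grow
  linearly in time. No measurability of \<open>c\<close> as a \<open>Y\<close>-valued map has to be required, since it follows
  from the continuity into \<open>L\<^sup>1\<close>. For the same reason the time integrands below are measurable,
  and by the finiteness clause those in the last clause are integrable.\<close>

definition weak_solution ::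
  "(real \<Rightarrow> real \<Rightarrow> real \<Rightarrow> real) \<Rightarrow> real \<Rightarrow> real \<Rightarrow> ereal \<Rightarrow> (real \<Rightarrow> real) \<Rightarrow> (real \<Rightarrow> real \<Rightarrow> real) \<Rightarrow> bool"
where
  "weak_solution K r \<beta> T c\<^sub>0 c \<longleftrightarrow>
    (\<forall>t\<in>times T. c t \<in> Y_plus \<beta> r) \<and>
    (AE x in lebesgue_on Rplus. c 0 x = c\<^sub>0 x) \<and>
    (\<forall>t\<in>times T. ((\<lambda>s. L1_dist (c s) (c t)) \<longlongrightarrow> 0) (at t within times T)) \<and>
    (\<forall>S::real. 0 < S \<and> ereal S \<le> T \<longrightarrow>
      (\<exists>M. AE t in lebesgue_on {0..<S}. Y_norm \<beta> r (c t) \<le> M)) \<and>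
    (\<forall>t\<in>times T.
      (\<integral>\<^sup>+ s. (\<integral>\<^sup>+ (x, y, z). ennreal (kap K (c s) x y z) \<partial>lebesgue_on (Rplus \<times> Rplus \<times> Rplus))
        \<partial>lebesgue_on {0..t}) < \<infinity>) \<and>
    (\<forall>t\<in>times T. \<forall>f\<in>Linfty.
      (LINT x|lebesgue_on Rplus. f x * (c t x - c\<^sub>0 x)) =
      (LINT s|lebesgue_on {0..t}. LINT (x, y, z)|lebesgue_on Dset. Delta z f x * kap K (c s) x y z))"

definition hat :: "real \<Rightarrow> real" where
  "hat x = min 1 x"

definition chk :: "real \<Rightarrow> real" where
  "chk x = max 1 x"

text \<open>Classical second derivative \<open>D\<close> of \<open>f\<close> at a point \<open>x\<close> of \<open>[0,\<infinity>)\<close>, one-sided at \<open>0\<close>.\<close>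

definition has_second_derivative :: "(real \<Rightarrow> real) \<Rightarrow> real \<Rightarrow> real \<Rightarrow> bool" where
  "has_second_derivative f D x \<longleftrightarrow>
    (\<exists>f'. (\<forall>u\<in>Rplus. (f has_real_derivative f' u) (at u within Rplus)) \<and>
      (f' has_real_derivative D) (at x within Rplus))"

text \<open>In the following three conditions the points at which a right-hand side contains \<open>0\<close> to the
  power \<open>- \<alpha>\<close> are excluded, because Isabelle's \<open>0 powr (- \<alpha>)\<close> is \<open>0\<close>. For \<open>\<alpha> > 0\<close> that
  right-hand side is infinite and nothing is claimed there; for \<open>\<alpha> = 0\<close> the bounds at the excluded
  points follow by letting \<open>x\<close> or \<open>y\<close> tend to \<open>0\<close>, as \<open>K\<close> is continuous in \<open>x\<close> and symmetric.\<close>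

definition kernel_growth ::
  "(real \<Rightarrow> real \<Rightarrow> real \<Rightarrow> real) \<Rightarrow> real \<Rightarrow> real \<Rightarrow> real \<Rightarrow> (real \<Rightarrow> real) \<Rightarrow> bool"
where
  "kernel_growth K \<mu> \<nu> \<alpha> \<phi> \<longleftrightarrow>
    (\<forall>x>0. \<forall>y>0. \<forall>z\<ge>0. K x y z \<le>
      hat x powr (- \<alpha>) * hat y powr (- \<alpha>) *
      (1/2 * (chk x powr \<mu> * chk y powr \<nu> + chk x powr \<nu> * chk y powr \<mu>)) * \<phi> z)"

definition kernel_second_derivative ::
  "(real \<Rightarrow> real \<Rightarrow> real \<Rightarrow> real) \<Rightarrow> real \<Rightarrow> real \<Rightarrow> (real \<Rightarrow> real) \<Rightarrow> bool"
where
  "kernel_second_derivative K \<alpha> \<Lambda> \<phi> \<longleftrightarrow>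
    (\<forall>x\<ge>0. \<forall>y\<ge>0. \<forall>z\<ge>0. \<exists>D. has_second_derivative (\<lambda>u. K u y z) D x \<and>
      (y > 0 \<longrightarrow> D \<le> hat y powr (- \<alpha>) * chk y powr \<Lambda> * \<phi> z))"

text \<open>At \<open>x = z > 0\<close> the left-hand side below contains an infinite factor, but \<open>K z y z = 0\<close>
  by continuity in the first variable, so the restriction to \<open>z < x\<close> loses nothing.\<close>

definition kernel_singular ::
  "(real \<Rightarrow> real \<Rightarrow> real \<Rightarrow> real) \<Rightarrow> real \<Rightarrow> real \<Rightarrow> real \<Rightarrow> (real \<Rightarrow> real) \<Rightarrow> bool"
where
  "kernel_singular K \<alpha> \<Lambda> C \<phi> \<longleftrightarrow>
    (\<forall>x y z. 0 \<le> z \<and> z < x \<and> 0 < y \<longrightarrow>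
      hat (x - z) powr (- \<alpha>) * K x y z \<le>
      C * hat x powr (- 2 * \<alpha>) * hat y powr (- \<alpha>) * chk x powr \<Lambda> * chk y powr \<Lambda> * \<phi> z)"

end

theory Submission
  imports Defs "HOL-Library.Diagonal_Subsequence"
begin

text \<open>Global solutions are limits, strong in \<open>L\<^sup>1\<close>, of explicit Euler schemes for truncated kernels.
  A nonnegative function of \<open>x\<close> that vanishes on \<open>[0, z)\<close> and whose second derivative is at most \<open>B\<close>
  has a first derivative of modulus at most \<open>2 B x\<close>; thus \<open>K\<close> is Lipschitz in its first argument.
  For a fixed second factor the scheme is linear, positive and an \<open>L\<^sup>1\<close> contraction. Comparing a
  solution with its translate, this and the Lipschitz bound give
  \<open>\<parallel>c\<^sub>t(\<cdot> + h) - c\<^sub>t\<parallel> \<le> \<parallel>c\<^sub>0(\<cdot> + h) - c\<^sub>0\<parallel> + C h\<close>, uniformly in the truncation, hence compactness of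
  Kolmogorov--Riesz type at every rational time. Mass and first moment do not increase, and since
  \<open>\<mu> + \<nu> \<le> 3\<close> the moment of order \<open>\<Lambda>\<close> obeys a linear Gronwall inequality, as does then the weight
  that is singular at \<open>0\<close>. Tails of the moment of order \<open>\<Lambda>\<close> are controlled by splitting the initial
  datum into a compactly supported part, whose third moment stays finite, and a small part.\<close>

section \<open>Second differences\<close>

text \<open>Two obstacles shape the argument. The rate may grow like
  \<open>br x powr l * br y powr l\<close>, while the moment of order \<open>l\<close> is all that
  the datum offers. A mere bound on this moment does not let the rate pass to the limit; its tails
  must be uniformly small, and this is what the part of the datum with a third moment is for.
  Secondly, the Lipschitz constant of a truncated scheme as a nonlinear map depends on the
  truncation, so comparing a solution with its translate through that constant would be useless.
  With frozen coefficients the step is a contraction whatever the truncation, and only the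
  translation of the kernel leaves a remainder, measured by the first moment in \<open>x\<close> and
  by the singular weight and the moment of order \<open>l\<close> in \<open>y\<close>. The
  inequality for the moment of order \<open>l\<close> is linear because a second difference gains
  the factor \<open>z\<^sup>2 * br x powr (l - 2)\<close>. The powers of \<open>x\<close> and
  \<open>y\<close> that remain have exponents at most \<open>l\<close> and total degree at most
  \<open>l + 1\<close>. They are dominated by
  \<open>br x powr l * br y + br x * br y powr l\<close>, where one factor always belongs to the
  nonincreasing first moment.\<close>

abbreviation L :: "real measure" where "L \<equiv> lborel"
abbreviation L3 :: "(real \<times> real \<times> real) measure" where "L3 \<equiv> lborel \<Otimes>\<^sub>M (lborel \<Otimes>\<^sub>M lborel)"
abbreviation L2 :: "(real \<times> real) measure" where "L2 \<equiv> lborel \<Otimes>\<^sub>M lborel"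

abbreviation dist1 :: "(real \<Rightarrow> real) \<Rightarrow> (real \<Rightarrow> real) \<Rightarrow> real" where
  "dist1 u v \<equiv> (LINT x|L. \<bar>u x - v x\<bar>)"

abbreviation osc :: "(real \<Rightarrow> real) \<Rightarrow> real \<Rightarrow> real" where
  "osc u h \<equiv> (LINT x|L. \<bar>u (x + h) - u x\<bar>)"

interpretation lborel3: pair_sigma_finite L L2
  by (intro pair_sigma_finite.intro lborel.sigma_finite_measure_axioms lborel_pair.sigma_finite_measure_axioms)

lemma integrable_shift_real: "integrable L f \<Longrightarrow> integrable L (\<lambda>x. f (x + h) :: real)"
  using lborel_integrable_real_affine[of f 1 h] by (simp add: add.commute)

lemma integral_shift_real: "(LINT x|L. f (x + h)) = (LINT x|L. f x :: real)"
  using lborel_integral_real_affine[of 1 f h] by (simp add: add.commute)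

lemmas L1_intros = Bochner_Integration.integrable_add integrable_abs Bochner_Integration.integrable_diff

lemma integrable_indicator_mult:
  fixes f :: "real \<Rightarrow> real"
  shows "A \<in> sets borel \<Longrightarrow> integrable L f \<Longrightarrow> integrable L (\<lambda>x. indicator A x * f x)"
  using integrable_mult_indicator[of A L f] by simp

text \<open>For fixed \<open>z\<close> this is a translation in \<open>x\<close>, so Tonelli reduces
  the claim to translation invariance. The shears with \<open>e = 1\<close> and
  \<open>e = -1\<close> carry \<open>P (x - z) z\<close> and \<open>P (x + z) z\<close> back to
  \<open>P x z\<close>.\<close>

lemma distr_shear: "distr L2 L2 (\<lambda>(x, z). (x + e * z, z)) = L2"
proof (rule measure_eqI)
  fix A assume "A \<in> sets (distr L2 L2 (\<lambda>(x, z). (x + e * z, z)))"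
  then have A [measurable]: "A \<in> sets L2" by simp
  have "emeasure (distr L2 L2 (\<lambda>(x, z). (x + e * z, z))) A
      = (\<integral>\<^sup>+ p. indicator A p \<partial>distr L2 L2 (\<lambda>(x, z). (x + e * z, z)))"
    using A by (subst nn_integral_indicator) auto
  also have "\<dots> = (\<integral>\<^sup>+ p. indicator A ((\<lambda>(x, z). (x + e * z, z)) p) \<partial>L2)"
    by (subst nn_integral_distr) auto
  also have "\<dots> = (\<integral>\<^sup>+ z. \<integral>\<^sup>+ x. indicator A (x + e * z, z) \<partial>L \<partial>L)"
    by (subst lborel_pair.nn_integral_snd[symmetric]) (auto simp: case_prod_unfold)
  also have "\<dots> = (\<integral>\<^sup>+ z. \<integral>\<^sup>+ x. indicator A (x, z) \<partial>L \<partial>L)"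
  proof (rule nn_integral_cong)
    fix z
    show "(\<integral>\<^sup>+ x. indicator A (x + e * z, z) \<partial>L) = (\<integral>\<^sup>+ x. indicator A (x, z) \<partial>L)"
      by (subst nn_integral_real_affine[where c=1 and t="e*z" and f="\<lambda>x. indicator A (x,z)"])
        (auto simp: add.commute)
  qed
  also have "\<dots> = (\<integral>\<^sup>+ p. indicator A p \<partial>L2)"
    by (subst lborel_pair.nn_integral_snd) (auto)
  finally show "emeasure (distr L2 L2 (\<lambda>(x, z). (x + e * z, z))) A = emeasure L2 A"
    using A by (subst (asm) nn_integral_indicator) auto
qed simp

lemma
  fixes P :: "real \<Rightarrow> real \<Rightarrow> real"
  assumes [measurable]: "case_prod P \<in> borel_measurable L2"
  shows integrable_shear: "integrable L2 (\<lambda>(x, z). P (x + e * z) z) \<longleftrightarrow> integrable L2 (case_prod P)"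
    and integral_shear: "(LINT (x, z)|L2. P (x + e * z) z) = (LINT (x, z)|L2. P x z)"
proof -
  have T: "(\<lambda>(x, z). (x + e * z, z)) \<in> measurable L2 L2" by measurable
  have "integrable (distr L2 L2 (\<lambda>(x, z). (x + e * z, z))) (case_prod P)
     \<longleftrightarrow> integrable L2 (\<lambda>p. case_prod P ((\<lambda>(x, z). (x + e * z, z)) p))"
    by (rule integrable_distr_eq[OF T]) simp
  then show "integrable L2 (\<lambda>(x, z). P (x + e * z) z) \<longleftrightarrow> integrable L2 (case_prod P)"
    unfolding distr_shear by (simp add: case_prod_unfold)
  have "integral\<^sup>L (distr L2 L2 (\<lambda>(x, z). (x + e * z, z))) (case_prod P)
     = (LINT p|L2. case_prod P ((\<lambda>(x, z). (x + e * z, z)) p))"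
    by (rule integral_distr[OF T]) simp
  then show "(LINT (x, z)|L2. P (x + e * z) z) = (LINT (x, z)|L2. P x z)"
    unfolding distr_shear by (simp add: case_prod_unfold)
qed

text \<open>Where the section is not integrable in \<open>z\<close> (a null set of \<open>x\<close> if \<open>P\<close> is integrable), the Bochner
  integral gives \<open>0\<close>; therefore additivity and the triangle inequality below hold only almost everywhere.\<close>

definition dsec :: "(real \<Rightarrow> real \<Rightarrow> real) \<Rightarrow> real \<Rightarrow> real" where
  "dsec P x = (LINT z|L. P (x - z) z + P (x + z) z - 2 * P x z)"

lemma dsec_measurable [measurable]:
  assumes [measurable]: "case_prod P \<in> borel_measurable L2"
  shows "dsec P \<in> borel_measurable L"
  unfolding dsec_def[abs_def] by measurable

lemma measurable_shift:
  assumes [measurable]: "case_prod P \<in> borel_measurable L2"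
  shows "(\<lambda>(x, z). P (x - z) z) \<in> borel_measurable L2"
    and "(\<lambda>(x, z). P (x + z) z) \<in> borel_measurable L2"
proof -
  have T: "(\<lambda>(x, z). (x + e * z, z)) \<in> measurable L2 L2" for e :: real by measurable
  show "(\<lambda>(x, z). P (x - z) z) \<in> borel_measurable L2"
    using measurable_compose[OF T[of "-1"] assms] by (simp add: case_prod_unfold)
  show "(\<lambda>(x, z). P (x + z) z) \<in> borel_measurable L2"
    using measurable_compose[OF T[of "1"] assms] by (simp add: case_prod_unfold)
qed

text \<open>Discrete integration by parts: each term is sheared separately, so the integrability
  hypotheses are those of the three terms of \<open>Delta z f x * P x z\<close>. Since
  \<open>f\<close> may be unbounded, moments are covered as well as bounded test functions.\<close>

lemma dsec_weak:
  fixes f :: "real \<Rightarrow> real"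
  assumes [measurable]: "case_prod P \<in> borel_measurable L2" "f \<in> borel_measurable L"
    and "integrable L2 (\<lambda>(x, z). f x * P x z)"
    and "integrable L2 (\<lambda>(x, z). f (x + z) * P x z)"
    and "integrable L2 (\<lambda>(x, z). f (x - z) * P x z)"
  shows "integrable L (\<lambda>x. f x * dsec P x)"
    and "(LINT x|L. f x * dsec P x) = (LINT (x, z)|L2. Delta z f x * P x z)"
    and "integrable L2 (\<lambda>(x, z). Delta z f x * P x z)"
proof -
  note [measurable] = measurable_shift[OF assms(1)]
  let ?A = "\<lambda>x z. f x * P (x - z) z" and ?B = "\<lambda>x z. f x * P (x + z) z"
  have mA [measurable]: "case_prod ?A \<in> borel_measurable L2" by measurable
  have mB [measurable]: "case_prod ?B \<in> borel_measurable L2" by measurable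
  have iA: "integrable L2 (case_prod ?A)" and
      eA: "(LINT (x, z)|L2. ?A x z) = (LINT (x, z)|L2. f (x + z) * P x z)"
    using integrable_shear[OF mA, of 1] integral_shear[OF mA, of 1] assms(4) by simp_all
  have iB: "integrable L2 (case_prod ?B)" and
      eB: "(LINT (x, z)|L2. ?B x z) = (LINT (x, z)|L2. f (x - z) * P x z)"
    using integrable_shear[OF mB, of "-1"] integral_shear[OF mB, of "-1"] assms(5) by simp_all
  let ?G = "\<lambda>(x, z). f x * (P (x - z) z + P (x + z) z - 2 * P x z)"
  have G: "?G = (\<lambda>p. case_prod ?A p + case_prod ?B p - 2 * (\<lambda>(x, z). f x * P x z) p)"
    by (auto simp: algebra_simps)
  have iG: "integrable L2 ?G"
    unfolding G using iA iB assms(3) by (intro Bochner_Integration.integrable_diff Bochner_Integration.integrable_add integrable_mult_right)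
  have *: "(\<lambda>x. f x * dsec P x) = (\<lambda>x. LINT z|L. ?G (x, z))"
    by (simp add: dsec_def)
  show "integrable L (\<lambda>x. f x * dsec P x)"
    unfolding * by (rule lborel_pair.integrable_fst'[OF iG])
  have D: "(\<lambda>(x, z). Delta z f x * P x z) = (\<lambda>p. (\<lambda>(x, z). f (x + z) * P x z) p + (\<lambda>(x, z). f (x - z) * P x z) p - 2 * (\<lambda>(x, z). f x * P x z) p)"
    by (auto simp: Delta_def algebra_simps)
  show "integrable L2 (\<lambda>(x, z). Delta z f x * P x z)"
    unfolding D using assms by (intro Bochner_Integration.integrable_diff Bochner_Integration.integrable_add integrable_mult_right)
  have "(LINT x|L. f x * dsec P x) = integral\<^sup>L L2 ?G"
    unfolding * by (rule lborel_pair.integral_fst'[OF iG])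
  also have "\<dots> = (LINT (x, z)|L2. ?A x z) + (LINT (x, z)|L2. ?B x z) - 2 * (LINT (x, z)|L2. f x * P x z)"
    unfolding G using iA iB assms(3) by (simp add: Bochner_Integration.integral_diff Bochner_Integration.integral_add)
  also have "\<dots> = (LINT (x, z)|L2. Delta z f x * P x z)"
    unfolding eA eB D using assms by (simp add: Bochner_Integration.integral_diff Bochner_Integration.integral_add)
  finally show "(LINT x|L. f x * dsec P x) = (LINT (x, z)|L2. Delta z f x * P x z)" .
qed

lemma
  fixes P :: "real \<Rightarrow> real \<Rightarrow> real"
  assumes "integrable L2 (case_prod P)"
  shows AE_integrable_shift: "AE x in L. integrable L (\<lambda>z. P (x - z) z) \<and> integrable L (\<lambda>z. P (x + z) z) \<and> integrable L (P x)"
    and integrable_shift: "integrable L2 (\<lambda>(x, z). P (x - z) z)" "integrable L2 (\<lambda>(x, z). P (x + z) z)"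
proof -
  have [measurable]: "case_prod P \<in> borel_measurable L2" using assms by auto
  show 1: "integrable L2 (\<lambda>(x, z). P (x - z) z)" and 2: "integrable L2 (\<lambda>(x, z). P (x + z) z)"
    using integrable_shear[of P, of "-1"] integrable_shear[of P, of 1] assms by simp_all
  show "AE x in L. integrable L (\<lambda>z. P (x - z) z) \<and> integrable L (\<lambda>z. P (x + z) z) \<and> integrable L (P x)"
    using lborel_pair.AE_integrable_fst'[OF 1] lborel_pair.AE_integrable_fst'[OF 2]
      lborel_pair.AE_integrable_fst'[OF assms] by eventually_elim simp
qed

lemma dsec_integrable:
  assumes "integrable L2 (case_prod P)"
  shows "integrable L (dsec P)"
  using dsec_weak(1)[of P "\<lambda>_. 1"] assms by auto

lemma dsec_add:
  assumes "integrable L2 (case_prod P)" "integrable L2 (case_prod Q)"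
  shows "AE x in L. dsec (\<lambda>x z. P x z + Q x z) x = dsec P x + dsec Q x"
  using AE_integrable_shift[OF assms(1)] AE_integrable_shift[OF assms(2)]
proof eventually_elim
  case (elim x)
  then have "dsec P x + dsec Q x = (LINT z|L. (P (x - z) z + P (x + z) z - 2 * P x z) + (Q (x - z) z + Q (x + z) z - 2 * Q x z))"
    unfolding dsec_def by (intro Bochner_Integration.integral_add[symmetric]) auto
  then show ?case by (simp add: dsec_def algebra_simps)
qed

text \<open>\<open>dsec\<close> reads \<open>P\<close> along the oblique lines
  \<open>(x - z, z)\<close> and \<open>(x + z, z)\<close>. Equality for almost every
  \<open>x\<close> therefore becomes equality almost everywhere in the plane, which shears preserve,
  and Fubini returns to almost every line.\<close>

lemma dsec_cong_AE:
  assumes "integrable L2 (case_prod P)" "integrable L2 (case_prod Q)"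
    and eq: "AE x in L. \<forall>z. P x z = Q x z"
  shows "AE x in L. dsec P x = dsec Q x"
proof -
  let ?R = "\<lambda>x z. P x z - Q x z"
  have [measurable]: "case_prod P \<in> borel_measurable L2" "case_prod Q \<in> borel_measurable L2"
    using assms by auto
  have iR: "integrable L2 (case_prod ?R)"
    using assms by (auto simp: case_prod_unfold)
  have "AE x in L. (\<lambda>z. norm (?R x z)) = (\<lambda>_. 0)"
    using eq by eventually_elim auto
  then have "(LINT x|L. LINT z|L. norm (?R x z)) = (LINT x|L. 0)"
    by (intro integral_cong_AE) (auto elim!: eventually_mono)
  then have "(LINT (x, z)|L2. norm (?R x z)) = 0"
    using lborel_pair.integral_fst'[OF integrable_norm[OF iR]] by (simp add: case_prod_unfold)
  then have "AE p in L2. norm (case_prod ?R p) = 0"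
    using integral_nonneg_eq_0_iff_AE[OF integrable_norm[OF iR]] by (auto simp: case_prod_unfold)
  then have AEp: "AE p in L2. case_prod P p = case_prod Q p"
    by eventually_elim (auto simp: case_prod_unfold)
  have "AE x in L. AE z in L. ?R (x + e * z) z = 0" for e
  proof -
    have T: "(\<lambda>(x, z). (x + e * z, z)) \<in> measurable L2 L2" by measurable
    have "AE p in distr L2 L2 (\<lambda>(x, z). (x + e * z, z)). case_prod P p = case_prod Q p"
      unfolding distr_shear by (rule AEp)
    then have "AE p in L2. case_prod ?R ((\<lambda>(x, z). (x + e * z, z)) p) = 0"
      by (rule AE_distrD[OF T, THEN eventually_mono]) auto
    from lborel_pair.AE_pair[OF this] show ?thesis by simp
  qed
  from this[of 1] this[of "-1"] this[of 0]
  show ?thesis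
  proof eventually_elim
    case (elim x)
    have m: "(\<lambda>z. (x + e * z, z)) \<in> measurable L L2" for e by measurable
    have [measurable]: "(\<lambda>z. P (x - z) z) \<in> borel_measurable L" "(\<lambda>z. P (x + z) z) \<in> borel_measurable L" "(\<lambda>z. P x z) \<in> borel_measurable L"
      "(\<lambda>z. Q (x - z) z) \<in> borel_measurable L" "(\<lambda>z. Q (x + z) z) \<in> borel_measurable L" "(\<lambda>z. Q x z) \<in> borel_measurable L"
      using measurable_compose[OF m[of "-1"], of "case_prod P"] measurable_compose[OF m[of 1], of "case_prod P"] measurable_compose[OF m[of 0], of "case_prod P"]
        measurable_compose[OF m[of "-1"], of "case_prod Q"] measurable_compose[OF m[of 1], of "case_prod Q"] measurable_compose[OF m[of 0], of "case_prod Q"] by simp_all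
    show ?case unfolding dsec_def
      using elim by (intro integral_cong_AE) (auto elim!: eventually_elim2)
  qed
qed

text \<open>Shears preserve the L1 norm, and the coefficients 1, 1, 2 add up to 4.\<close>

lemma dsec_norm_le:
  assumes "integrable L2 (case_prod P)"
  shows "(LINT x|L. \<bar>dsec P x\<bar>) \<le> 4 * (LINT (x, z)|L2. \<bar>P x z\<bar>)"
proof -
  have [measurable]: "case_prod P \<in> borel_measurable L2" using assms by auto
  let ?A = "\<lambda>x z. \<bar>P x z\<bar>"
  have iA: "integrable L2 (case_prod ?A)" using integrable_norm[OF assms] by (simp add: case_prod_unfold)
  then have mA: "case_prod ?A \<in> borel_measurable L2" by auto
  note s = integrable_shift[OF iA]
  let ?G = "\<lambda>p. (\<lambda>(x, z). ?A (x - z) z) p + (\<lambda>(x, z). ?A (x + z) z) p + 2 * case_prod ?A p"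
  have iG: "integrable L2 ?G" using s iA by auto
  have "(LINT x|L. \<bar>dsec P x\<bar>) \<le> (LINT x|L. LINT z|L. ?G (x, z))"
  proof (rule integral_mono_AE)
    show "integrable L (\<lambda>x. LINT z|L. ?G (x, z))" by (rule lborel_pair.integrable_fst'[OF iG])
    show "integrable L (\<lambda>x. \<bar>dsec P x\<bar>)" using dsec_integrable[OF assms] by simp
    show "AE x in L. \<bar>dsec P x\<bar> \<le> (LINT z|L. ?G (x, z))"
      using AE_integrable_shift[OF assms]
    proof eventually_elim
      case (elim x)
      have "norm (dsec P x) \<le> (LINT z|L. norm (P (x - z) z + P (x + z) z - 2 * P x z))"
        unfolding dsec_def by (rule integral_norm_bound)
      also have "\<dots> \<le> (LINT z|L. ?G (x, z))"
        using elim by (intro integral_mono) (auto)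
      finally show ?case by simp
    qed
  qed
  also have "\<dots> = integral\<^sup>L L2 ?G" by (rule lborel_pair.integral_fst'[OF iG])
  also have "\<dots> = (LINT (x, z)|L2. ?A (x - z) z) + (LINT (x, z)|L2. ?A (x + z) z) + 2 * (LINT (x, z)|L2. ?A x z)"
    using s iA by simp
  also have "\<dots> = 4 * (LINT (x, z)|L2. \<bar>P x z\<bar>)"
    using integral_shear[OF mA, of "-1"] integral_shear[OF mA, of 1] by simp
  finally show ?thesis .
qed

section \<open>Compactness in \<open>L\<^sup>1\<close>\<close>

lemma Fatou_bound:
  fixes f :: "nat \<Rightarrow> 'a \<Rightarrow> real"
  assumes f: "\<And>n. integrable M (f n)" "\<And>n. AE x in M. 0 \<le> f n x"
    and [measurable]: "g \<in> borel_measurable M"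
    and lim: "AE x in M. (\<lambda>n. f n x) \<longlonglongrightarrow> g x"
    and bound: "\<And>n. n \<ge> N \<Longrightarrow> (LINT x|M. f n x) \<le> C"
  shows "integrable M g" and "(LINT x|M. g x) \<le> C"
proof -
  have [measurable]: "f n \<in> borel_measurable M" for n using f(1) by auto
  have "0 \<le> (LINT x|M. f N x)" using f(2) by (rule integral_nonneg_AE)
  with bound[of N] have C: "0 \<le> C" by simp
  have "AE x in M. \<forall>n. 0 \<le> f n x" using f(2) by (simp add: AE_all_countable)
  with lim have g0: "AE x in M. 0 \<le> g x"
    by eventually_elim (auto intro: LIMSEQ_le_const)
  have "(\<integral>\<^sup>+x. ennreal (g x) \<partial>M) = (\<integral>\<^sup>+x. liminf (\<lambda>n. ennreal (f n x)) \<partial>M)"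
  proof (rule nn_integral_cong_AE)
    show "AE x in M. ennreal (g x) = liminf (\<lambda>n. ennreal (f n x))"
      using lim by eventually_elim (auto intro!: lim_imp_Liminf[symmetric] tendsto_ennrealI)
  qed
  also have "\<dots> \<le> liminf (\<lambda>n. \<integral>\<^sup>+x. ennreal (f n x) \<partial>M)"
    by (rule nn_integral_liminf) simp
  also have "\<dots> \<le> ennreal C"
  proof -
    have "eventually (\<lambda>n. (\<integral>\<^sup>+x. ennreal (f n x) \<partial>M) \<le> ennreal C) sequentially"
      using eventually_ge_at_top[of N]
    proof eventually_elim
      case (elim n)
      then show ?case using bound[of n] f by (simp add: nn_integral_eq_integral ennreal_leI)
    qed
    then have "limsup (\<lambda>n. \<integral>\<^sup>+x. ennreal (f n x) \<partial>M) \<le> ennreal C"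
      by (rule Limsup_bounded)
    then show ?thesis
      using Liminf_le_Limsup[of sequentially "\<lambda>n. \<integral>\<^sup>+x. ennreal (f n x) \<partial>M"] by (auto intro: order_trans)
  qed
  finally have le: "(\<integral>\<^sup>+x. ennreal (g x) \<partial>M) \<le> ennreal C" .
  also have "\<dots> < \<infinity>" by simp
  finally show ig: "integrable M g"
    using g0 by (intro integrableI_nonneg) auto
  show "(LINT x|M. g x) \<le> C"
    using le C by (simp add: nn_integral_eq_integral[OF ig g0])
qed

text \<open>An almost everywhere convergent subsequence supplies the candidate. Fatou's lemma along
  it turns the Cauchy estimate into convergence of the whole sequence.\<close>

lemma L1_complete:
  fixes u :: "nat \<Rightarrow> 'a \<Rightarrow> real"
  assumes int: "\<And>n. integrable M (u n)" and nonneg: "\<And>n x. x \<in> space M \<Longrightarrow> 0 \<le> u n x"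
    and cauchy: "\<And>e. e > 0 \<Longrightarrow> \<exists>N. \<forall>i\<ge>N. \<forall>j\<ge>N. (LINT x|M. \<bar>u i x - u j x\<bar>) < e"
  obtains v where "integrable M v" "\<And>x. 0 \<le> v x" "(\<lambda>n. LINT x|M. \<bar>u n x - v x\<bar>) \<longlonglongrightarrow> 0"
proof -
  have [measurable]: "u n \<in> borel_measurable M" for n using int by auto
  obtain r where r: "strict_mono r" "AE x in M. Cauchy (\<lambda>i. u (r i) x)"
    using cauchy_L1_AE_cauchy_subseq[of M u] int cauchy by auto
  define w where "w x = lim (\<lambda>i. u (r i) x)" for x
  have [measurable]: "w \<in> borel_measurable M"
    unfolding w_def by (rule borel_measurable_lim_metric) simp
  \<comment> \<open>The negative part is cut off so that \<open>v\<close> is nonnegative at every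
    point, as \<open>state\<close> will demand; almost everywhere \<open>v\<close> and
    \<open>w\<close> agree.\<close>
  define v where "v x = max 0 (w x)" for x
  have [measurable]: "v \<in> borel_measurable M" unfolding v_def by measurable
  have lim: "AE x in M. (\<lambda>i. u (r i) x) \<longlonglongrightarrow> v x"
    using r(2) AE_space
  proof eventually_elim
    case (elim x)
    then have *: "(\<lambda>i. u (r i) x) \<longlonglongrightarrow> w x" by (simp add: w_def Cauchy_convergent_iff convergent_LIMSEQ_iff)
    then have "0 \<le> w x" using nonneg[OF elim(2)] by (auto intro: LIMSEQ_le_const)
    with * show ?case by (simp add: v_def)
  qed
  have fat: "integrable M (\<lambda>x. \<bar>u n x - v x\<bar>) \<and> (LINT x|M. \<bar>u n x - v x\<bar>) \<le> e"
    if "\<And>i. i \<ge> N \<Longrightarrow> (LINT x|M. \<bar>u n x - u (r i) x\<bar>) \<le> e" for n N e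
  proof -
    have i: "integrable M (\<lambda>x. \<bar>u n x - u (r i) x\<bar>)" for i using int by auto
    have l: "AE x in M. (\<lambda>i. \<bar>u n x - u (r i) x\<bar>) \<longlonglongrightarrow> \<bar>u n x - v x\<bar>"
      using lim by eventually_elim (auto intro!: tendsto_intros)
    from Fatou_bound[of M "\<lambda>i x. \<bar>u n x - u (r i) x\<bar>" "\<lambda>x. \<bar>u n x - v x\<bar>", OF i _ _ l that] show ?thesis by auto
  qed
  have "integrable M v"
  proof -
    obtain N where N: "\<forall>i\<ge>N. \<forall>j\<ge>N. (LINT x|M. \<bar>u i x - u j x\<bar>) < 1" using cauchy[of 1] by auto
    have "(LINT x|M. \<bar>u N x - u (r i) x\<bar>) \<le> 1" if "i \<ge> N" for i
      using N that seq_suble[OF r(1), of i] by (force intro: less_imp_le)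
    from fat[of N N 1, OF this] have "integrable M (\<lambda>x. \<bar>u N x - v x\<bar>)" by auto
    then have "integrable M (\<lambda>x. u N x - v x)" by (subst (asm) integrable_abs_iff) auto
    from Bochner_Integration.integrable_diff[OF int[of N] this] show ?thesis by simp
  qed
  moreover have "(\<lambda>n. LINT x|M. \<bar>u n x - v x\<bar>) \<longlonglongrightarrow> 0"
  proof (rule LIMSEQ_I)
    fix e :: real assume "0 < e"
    then obtain N where N: "\<forall>i\<ge>N. \<forall>j\<ge>N. (LINT x|M. \<bar>u i x - u j x\<bar>) < e/2" using cauchy[of "e/2"] by auto
    have "norm ((LINT x|M. \<bar>u n x - v x\<bar>) - 0) < e" if n: "n \<ge> N" for n
    proof -
      have "(LINT x|M. \<bar>u n x - u (r i) x\<bar>) \<le> e/2" if "i \<ge> N" for i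
        using N n that seq_suble[OF r(1), of i] by (force intro: less_imp_le)
      from fat[of N n "e/2", OF this] show ?thesis using \<open>0 < e\<close> by auto
    qed
    then show "\<exists>N. \<forall>n\<ge>N. norm ((LINT x|M. \<bar>u n x - v x\<bar>) - 0) < e" by blast
  qed
  ultimately show thesis using that[of v] by (simp add: v_def)
qed

text \<open>Lower semicontinuity of moments. As \<open>p\<close> may be unbounded, L1 convergence
  alone does not control the weighted integrals; Fatou's lemma along an almost everywhere convergent
  subsequence does, from one side.\<close>

lemma L1_limit_weight:
  fixes u :: "nat \<Rightarrow> 'a \<Rightarrow> real"
  assumes int: "\<And>n. integrable M (u n)" "integrable M v"
    and lim: "(\<lambda>n. LINT x|M. \<bar>u n x - v x\<bar>) \<longlonglongrightarrow> 0"
    and p [measurable]: "p \<in> borel_measurable M"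
    and pu: "\<And>n. integrable M (\<lambda>x. p x * u n x)" "\<And>n. AE x in M. 0 \<le> p x * u n x"
    and bound: "\<And>n. n \<ge> N \<Longrightarrow> (LINT x|M. p x * u n x) \<le> C"
  shows "integrable M (\<lambda>x. p x * v x)" and "(LINT x|M. p x * v x) \<le> C"
proof -
  have [measurable]: "v \<in> borel_measurable M" using int by auto
  obtain r where r: "strict_mono r" "AE x in M. (\<lambda>i. u (r i) x - v x) \<longlonglongrightarrow> 0"
    using tendsto_L1_AE_subseq[of M "\<lambda>n x. u n x - v x"] int lim by auto
  have l: "AE x in M. (\<lambda>i. p x * u (r i) x) \<longlonglongrightarrow> p x * v x"
    using r(2) by eventually_elim (auto simp: LIM_zero_iff intro!: tendsto_intros)
  have b: "(LINT x|M. p x * u (r i) x) \<le> C" if "i \<ge> N" for i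
    using bound[of "r i"] that seq_suble[OF r(1), of i] by auto
  from Fatou_bound[of M "\<lambda>i x. p x * u (r i) x" "\<lambda>x. p x * v x", OF pu(1) pu(2) _ l b]
  show "integrable M (\<lambda>x. p x * v x)" "(LINT x|M. p x * v x) \<le> C" by auto
qed

lemma integrable_bounded_mult:
  fixes w :: "'a \<Rightarrow> real"
  assumes [measurable]: "f \<in> borel_measurable M" and B: "\<And>x. \<bar>f x\<bar> \<le> B" and w: "integrable M w"
  shows "integrable M (\<lambda>x. f x * w x)"
proof (rule Bochner_Integration.integrable_bound)
  show "integrable M (\<lambda>x. B * w x)" using w by simp
  have "\<bar>f x\<bar> * \<bar>w x\<bar> \<le> \<bar>B\<bar> * \<bar>w x\<bar>" for x
    using B[of x] by (intro mult_right_mono) auto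
  then show "AE x in M. norm (f x * w x) \<le> norm (B * w x)" by (simp add: abs_mult)
qed (use w in auto)

lemma L1_limit_integral:
  fixes u :: "nat \<Rightarrow> 'a \<Rightarrow> real"
  assumes int: "\<And>n. integrable M (u n)" "integrable M v"
    and lim: "(\<lambda>n. LINT x|M. \<bar>u n x - v x\<bar>) \<longlonglongrightarrow> 0"
    and f [measurable]: "f \<in> borel_measurable M" and B: "\<And>x. \<bar>f x\<bar> \<le> B"
  shows "(\<lambda>n. LINT x|M. f x * u n x) \<longlonglongrightarrow> (LINT x|M. f x * v x)"
proof -
  have fi: "integrable M (\<lambda>x. f x * w x)" if "integrable M w" for w
    using that by (rule integrable_bounded_mult[OF f B])
  have "\<bar>(LINT x|M. f x * u n x) - (LINT x|M. f x * v x)\<bar> \<le> B * (LINT x|M. \<bar>u n x - v x\<bar>)" for n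
  proof -
    have "\<bar>(LINT x|M. f x * u n x) - (LINT x|M. f x * v x)\<bar> = \<bar>LINT x|M. f x * (u n x - v x)\<bar>"
      using fi int by (simp add: right_diff_distrib)
    also have "\<dots> \<le> (LINT x|M. \<bar>f x * (u n x - v x)\<bar>)" by (rule integral_abs_bound)
    also have "\<dots> \<le> (LINT x|M. B * \<bar>u n x - v x\<bar>)"
    proof (rule integral_mono)
      show "integrable M (\<lambda>x. \<bar>f x * (u n x - v x)\<bar>)" using fi[of "\<lambda>x. u n x - v x"] int by simp
      show "integrable M (\<lambda>x. B * \<bar>u n x - v x\<bar>)" using int by simp
    qed (simp add: abs_mult B mult_right_mono)
    finally show ?thesis by simp
  qed
  then have "(\<lambda>n. (LINT x|M. f x * u n x) - (LINT x|M. f x * v x)) \<longlonglongrightarrow> 0"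
    by (intro Lim_null_comparison[OF always_eventually tendsto_mult_right_zero[OF lim, of B]] allI) simp
  then show ?thesis by (simp add: LIM_zero_iff)
qed

text \<open>On a cell of length \<open>h\<close>, \<open>\<bar>v x\<bar>\<close> is at most the modulus of the mean of \<open>v\<close> plus the mean of
  \<open>\<bar>v x - v y\<bar>\<close> over \<open>y\<close>, and the latter is controlled by translations of length less than \<open>h\<close>.\<close>

lemma cell_estimate:
  fixes v :: "real \<Rightarrow> real"
  assumes v: "integrable L v" and h: "h > 0"
    and trans: "\<And>s. 0 < s \<Longrightarrow> s \<le> h \<Longrightarrow> (osc v s) \<le> w"
  shows "(LINT x|L. indicator {a..<a + real N * h} x * \<bar>v x\<bar>)
    \<le> (\<Sum>j<N. \<bar>LINT x|L. indicator {a + real j * h..<a + real (Suc j) * h} x * v x\<bar>) + 2 * w"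
proof -
  have [measurable]: "v \<in> borel_measurable L" using v by auto
  let ?I = "\<lambda>j. {a + real j * h..<a + real (Suc j) * h}"
  \<comment> \<open>Points of one cell differ by less than \<open>h\<close>, so the shifts
    \<open>s\<close> between \<open>-h\<close> and \<open>h\<close> suffice. Integration over them
    gives at most \<open>2 * h * w\<close>, and division by the cell length leaves
    \<open>2 * w\<close>.\<close>
  define H where "H = (\<lambda>(x, s). indicator {-h<..<h} s * \<bar>v (x + s) - v x\<bar> :: real)"
  define G where "G x = (LINT s|L. H (x, s))" for x
  have mH [measurable]: "H \<in> borel_measurable L2" unfolding H_def by measurable
  have sh: "integrable L (\<lambda>x. v (x + s))" for s
    using lborel_integrable_real_affine[OF v, of 1 s] by (simp add: add.commute)
  have tr: "(osc v s) \<le> w" if s: "s \<in> {-h<..<h}" for s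
  proof -
    consider "s > 0" | "s = 0" | "s < 0" by linarith
    then show ?thesis
    proof cases
      case 1 then show ?thesis using trans[of s] s by auto
    next
      case 2
      have "0 \<le> (osc v h)" by simp
      also have "\<dots> \<le> w" using trans[of h] h by auto
      finally show ?thesis using 2 by simp
    next
      case 3
      have "(osc v s) = (LINT x|L. \<bar>v (x + s + - s) - v (x + - s)\<bar>)"
        using lborel_integral_real_affine[of 1 "\<lambda>x. \<bar>v (x + s) - v x\<bar>" "- s"] by (simp add: add.commute)
      also have "\<dots> = (LINT x|L. \<bar>v (x + - s) - v x\<bar>)" by (simp add: abs_minus_commute)
      also have "\<dots> \<le> w" using trans[of "- s"] s 3 by auto
      finally show ?thesis .
    qed
  qed
  have w0: "0 \<le> w"
  proof -
    have "0 \<le> (osc v h)" by simp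
    also have "\<dots> \<le> w" using trans[of h] h by auto
    finally show ?thesis .
  qed
  have nnH: "(\<integral>\<^sup>+p. ennreal (H p) \<partial>L2) \<le> ennreal (2 * h * w)"
  proof -
    have "(\<integral>\<^sup>+p. ennreal (H p) \<partial>L2) = (\<integral>\<^sup>+s. \<integral>\<^sup>+x. ennreal (H (x, s)) \<partial>L \<partial>L)"
      by (subst lborel_pair.nn_integral_snd) auto
    also have "\<dots> \<le> (\<integral>\<^sup>+s. ennreal w * indicator {-h<..<h} s \<partial>L)"
    proof (rule nn_integral_mono)
      fix s
      show "(\<integral>\<^sup>+x. ennreal (H (x, s)) \<partial>L) \<le> ennreal w * indicator {-h<..<h} s"
      proof (cases "s \<in> {-h<..<h}")
        case True
        then have "(\<integral>\<^sup>+x. ennreal (H (x, s)) \<partial>L) = (\<integral>\<^sup>+x. ennreal \<bar>v (x + s) - v x\<bar> \<partial>L)"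
          by (simp add: H_def)
        also have "\<dots> = ennreal (osc v s)"
          using sh[of s] v by (intro nn_integral_eq_integral) auto
        also have "\<dots> \<le> ennreal w" using tr[OF True] by (rule ennreal_leI)
        finally show ?thesis using True by simp
      qed (simp add: H_def)
    qed
    also have "\<dots> = ennreal w * emeasure L {-h<..<h}" by (simp add: nn_integral_cmult_indicator)
    also have "\<dots> = ennreal (2 * h * w)" using h w0 by (simp add: ennreal_mult'[symmetric] mult.commute)
    finally show ?thesis .
  qed
  have H0: "0 \<le> H p" for p by (auto simp: H_def split: prod.split)
  have iH: "integrable L2 H"
    using nnH H0 by (intro integrableI_nonneg) (auto intro: le_less_trans)
  have intH: "integral\<^sup>L L2 H \<le> 2 * h * w"
    using nnH H0 h w0 by (simp add: nn_integral_eq_integral[OF iH])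
  have iG: "integrable L G" unfolding G_def by (rule lborel_pair.integrable_fst'[OF iH])
  have eG: "(LINT x|L. G x) = integral\<^sup>L L2 H" unfolding G_def by (rule lborel_pair.integral_fst'[OF iH])
  have G0: "0 \<le> G x" for x unfolding G_def using H0 by simp
  note ind = integrable_indicator_mult
  have cell: "h * (LINT x|L. indicator (?I j) x * \<bar>v x\<bar>)
      \<le> h * \<bar>LINT x|L. indicator (?I j) x * v x\<bar> + (LINT x|L. indicator (?I j) x * G x)" for j
  proof -
    let ?m = "LINT y|L. indicator (?I j) y * v y"
    have mI: "measure L (?I j) = h" using h by (simp add: algebra_simps)
    have iI: "integrable L (indicator (?I j) :: real \<Rightarrow> real)"
      using h by (intro integrable_real_indicator) (auto simp: algebra_simps emeasure_lborel_Ico)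
    have lI: "(LINT x|L. indicator (?I j) x) = h" using mI by simp
    have "AE x in L. h * (indicator (?I j) x * \<bar>v x\<bar>) \<le> indicator (?I j) x * \<bar>?m\<bar> + indicator (?I j) x * G x"
      using lborel_pair.AE_integrable_fst'[OF iH]
    proof eventually_elim
      case (elim x)
      show ?case
      proof (cases "x \<in> ?I j")
        case True
        have "h * v x - ?m = (LINT y|L. indicator (?I j) y * v x) - ?m" using lI by simp
        also have "\<dots> = (LINT y|L. indicator (?I j) y * (v x - v y))"
          using ind[of "?I j" v] v iI by (simp add: right_diff_distrib)
        finally have "\<bar>h * v x - ?m\<bar> \<le> (LINT y|L. \<bar>indicator (?I j) y * (v x - v y)\<bar>)"
          using integral_abs_bound by metis
        also have "\<dots> \<le> (LINT y|L. H (x, - x + 1 * y))"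
        proof (rule integral_mono)
          show "integrable L (\<lambda>y. \<bar>indicator (?I j) y * (v x - v y)\<bar>)"
            using ind[of "?I j" v] v iI by (simp add: right_diff_distrib)
          show "integrable L (\<lambda>y. H (x, - x + 1 * y))"
            using lborel_integrable_real_affine[OF elim, of 1 "- x"] by simp
          fix y
          show "\<bar>indicator (?I j) y * (v x - v y)\<bar> \<le> H (x, - x + 1 * y)"
            using True by (auto simp: H_def indicator_def algebra_simps abs_mult)
        qed
        also have "\<dots> = G x"
          unfolding G_def using lborel_integral_real_affine[of 1 "\<lambda>s. H (x, s)" "- x"] by simp
        finally have "\<bar>h * v x - ?m\<bar> \<le> G x" .
        then have "\<bar>h * v x\<bar> \<le> \<bar>?m\<bar> + G x" by linarith
        then show ?thesis using True h by (simp add: abs_mult)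
      qed simp
    qed
    then have "(LINT x|L. h * (indicator (?I j) x * \<bar>v x\<bar>)) \<le> (LINT x|L. indicator (?I j) x * \<bar>?m\<bar> + indicator (?I j) x * G x)"
      using ind[of "?I j" "\<lambda>x. \<bar>v x\<bar>"] v iI ind[of "?I j" G] iG
      by (intro integral_mono_AE) auto
    also have "\<dots> = h * \<bar>?m\<bar> + (LINT x|L. indicator (?I j) x * G x)"
      using iI ind[of "?I j" G] iG lI by simp
    finally show ?thesis by simp
  qed
  have split: "(\<Sum>j<N. indicator (?I j) x) = (indicator {a..<a + real N * h} x :: real)" for x
  proof (induction N)
    case (Suc N)
    have "a + real N * h \<le> a + real (Suc N) * h" "0 \<le> real N * h" using h by (auto simp: algebra_simps)
    then show ?case using Suc by (auto simp: indicator_def)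
  qed simp
  have S: "(LINT x|L. indicator {a..<a + real N * h} x * f x) = (\<Sum>j<N. LINT x|L. indicator (?I j) x * f x)"
    if "integrable L f" for f :: "real \<Rightarrow> real"
    unfolding split[symmetric] sum_distrib_right using ind[OF _ that] by (subst Bochner_Integration.integral_sum) auto
  have "h * (LINT x|L. indicator {a..<a + real N * h} x * \<bar>v x\<bar>) = (\<Sum>j<N. h * (LINT x|L. indicator (?I j) x * \<bar>v x\<bar>))"
    using S[of "\<lambda>x. \<bar>v x\<bar>"] v by (simp add: sum_distrib_left)
  also have "\<dots> \<le> (\<Sum>j<N. h * \<bar>LINT x|L. indicator (?I j) x * v x\<bar> + (LINT x|L. indicator (?I j) x * G x))"
    by (rule sum_mono) (rule cell)
  also have "\<dots> = h * (\<Sum>j<N. \<bar>LINT x|L. indicator (?I j) x * v x\<bar>) + (LINT x|L. indicator {a..<a + real N * h} x * G x)"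
    using S[OF iG] by (simp add: sum.distrib sum_distrib_left)
  also have "(LINT x|L. indicator {a..<a + real N * h} x * G x) \<le> (LINT x|L. G x)"
    using iG G0 by (intro integral_mono ind) (auto simp: indicator_def)
  also have "\<dots> \<le> h * (2 * w)" using eG intH by (simp add: algebra_simps)
  finally have "h * (LINT x|L. indicator {a..<a + real N * h} x * \<bar>v x\<bar>)
    \<le> h * ((\<Sum>j<N. \<bar>LINT x|L. indicator (?I j) x * v x\<bar>) + 2 * w)" by (simp add: algebra_simps)
  then show ?thesis using h by simp
qed

text \<open>Once tails and oscillation are small, finitely many cell integrals determine the L1
  distance up to a small error. Rational endpoints make the required convergences countable, which
  is what a diagonal argument can deliver.\<close>

lemma Kolmogorov_Riesz_Cauchy:
  fixes u :: "nat \<Rightarrow> real \<Rightarrow> real"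
  assumes int: "\<And>n. integrable L (u n)"
    and tight: "\<And>e. e > 0 \<Longrightarrow> \<exists>R. \<forall>n. (LINT x|L. indicator {x. \<bar>x\<bar> \<ge> R} x * \<bar>u n x\<bar>) \<le> e"
    and trans: "\<And>e. e > 0 \<Longrightarrow> \<exists>h>0. \<forall>n s. 0 < s \<longrightarrow> s \<le> h \<longrightarrow> (osc (u n) s) \<le> e"
    and cells: "\<And>a b. a \<in> \<rat> \<Longrightarrow> b \<in> \<rat> \<Longrightarrow> convergent (\<lambda>n. LINT x|L. indicator {a..<b} x * u n x)"
    and e: "(e::real) > 0"
  shows "\<exists>N. \<forall>i\<ge>N. \<forall>j\<ge>N. (dist1 (u i) (u j)) < e"
proof -
  have [measurable]: "u n \<in> borel_measurable L" for n using int by auto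
  \<comment> \<open>Budget: two tails of \<open>e/12\<close>, oscillation \<open>e/24 + e/24\<close>
    of the difference, doubled by \<open>cell_estimate\<close>, and \<open>e/4\<close> for all cells
    together. The sum is \<open>7 * e / 12\<close>.\<close>
  obtain R0 where R0: "\<And>n. (LINT x|L. indicator {x. \<bar>x\<bar> \<ge> R0} x * \<bar>u n x\<bar>) \<le> e/12"
    using tight[of "e/12"] e by auto
  obtain h0 where h0: "h0 > 0" "\<And>n s. 0 < s \<Longrightarrow> s \<le> h0 \<Longrightarrow> (osc (u n) s) \<le> e/24"
    using trans[of "e/24"] e by auto
  obtain k :: nat where k: "k > 0" "1 / real k \<le> h0"
    using real_arch_inverse[of h0] h0(1) by (auto simp: inverse_eq_divide intro: less_imp_le)
  define h where "h = 1 / real k"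
  have h: "h > 0" "h \<le> h0" "h \<in> \<rat>" using k by (auto simp: h_def)
  define R where "R = nat \<lceil>max R0 0\<rceil>"
  have R: "R0 \<le> real R" unfolding R_def by linarith
  \<comment> \<open>With \<open>h = 1 / real k\<close> and integral \<open>R\<close>, the
    \<open>M\<close> cells tile the interval from \<open>-R\<close> to \<open>R\<close> exactly and
    have rational endpoints.\<close>
  define M where "M = 2 * R * k"
  have Mh: "- real R + real M * h = real R" using k by (simp add: M_def h_def field_simps)
  define a where "a j = - real R + real j * h" for j :: nat
  let ?I = "\<lambda>j. {- real R + real j * h..<- real R + real (Suc j) * h}"
  note ind = integrable_indicator_mult
  define q where "q m n = (LINT x|L. indicator (?I m) x * u n x)" for m n
  have "\<forall>m. \<exists>N. \<forall>i\<ge>N. \<forall>j\<ge>N. norm (q m i - q m j) < e / (4 * (real M + 1))"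
  proof
    fix m
    have "Cauchy (q m)"
      unfolding q_def using h by (intro convergent_Cauchy cells) auto
    moreover have "0 < e / (4 * (real M + 1))" using e by simp
    ultimately show "\<exists>N. \<forall>i\<ge>N. \<forall>j\<ge>N. norm (q m i - q m j) < e / (4 * (real M + 1))"
      by (rule CauchyD)
  qed
  from choice[OF this] obtain N where N: "\<And>m i j. i \<ge> N m \<Longrightarrow> j \<ge> N m \<Longrightarrow> norm (q m i - q m j) < e / (4 * (real M + 1))"
    by blast
  have "(dist1 (u i) (u j)) < e" if ij: "i \<ge> (\<Sum>m<M. N m)" "j \<ge> (\<Sum>m<M. N m)" for i j
  proof -
    define v where "v x = u i x - u j x" for x
    have iv: "integrable L v" unfolding v_def using int by auto
    have [measurable]: "v \<in> borel_measurable L" using iv by auto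
    have sh: "integrable L (\<lambda>x. u n (x + s))" for s n
      using lborel_integrable_real_affine[OF int, of 1 n s] by (simp add: add.commute)
    have tv: "(osc v s) \<le> e/12" if s: "0 < s" "s \<le> h" for s
    proof -
      have "(osc v s) \<le> (LINT x|L. \<bar>u i (x + s) - u i x\<bar> + \<bar>u j (x + s) - u j x\<bar>)"
        unfolding v_def using int sh by (intro integral_mono) auto
      also have "\<dots> \<le> e/24 + e/24"
        using h0(2)[of s i] h0(2)[of s j] s h int sh by (subst Bochner_Integration.integral_add) auto
      finally show ?thesis by simp
    qed
    have "(LINT x|L. \<bar>v x\<bar>) \<le> (LINT x|L. indicator {- real R..<- real R + real M * h} x * \<bar>v x\<bar>
        + (indicator {x. \<bar>x\<bar> \<ge> R0} x * \<bar>u i x\<bar> + indicator {x. \<bar>x\<bar> \<ge> R0} x * \<bar>u j x\<bar>))"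
    proof (rule integral_mono)
      show "\<bar>v x\<bar> \<le> indicator {- real R..<- real R + real M * h} x * \<bar>v x\<bar>
        + (indicator {x. \<bar>x\<bar> \<ge> R0} x * \<bar>u i x\<bar> + indicator {x. \<bar>x\<bar> \<ge> R0} x * \<bar>u j x\<bar>)" for x
        unfolding Mh v_def using R by (auto simp: indicator_def abs_if)
    qed (use iv int in \<open>auto intro!: ind Bochner_Integration.integrable_add\<close>)
    also have "\<dots> = (LINT x|L. indicator {- real R..<- real R + real M * h} x * \<bar>v x\<bar>)
        + ((LINT x|L. indicator {x. \<bar>x\<bar> \<ge> R0} x * \<bar>u i x\<bar>) + (LINT x|L. indicator {x. \<bar>x\<bar> \<ge> R0} x * \<bar>u j x\<bar>))"
    proof -
      have 1: "integrable L (\<lambda>x. indicator {- real R..<- real R + real M * h} x * \<bar>v x\<bar>)" using iv by (auto intro!: ind)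
      have 2: "integrable L (\<lambda>x. indicator {x. \<bar>x\<bar> \<ge> R0} x * \<bar>u n x\<bar>)" for n using int by (auto intro!: ind)
      show ?thesis using 1 2 by simp
    qed
    also have "\<dots> \<le> ((\<Sum>m<M. \<bar>LINT x|L. indicator (?I m) x * v x\<bar>) + 2 * (e/12)) + (e/12 + e/12)"
      using cell_estimate[OF iv h(1) tv, where a="- real R" and N=M] R0[of i] R0[of j] by (intro add_mono) auto
    also have "(\<Sum>m<M. \<bar>LINT x|L. indicator (?I m) x * v x\<bar>) \<le> (\<Sum>m<M. e / (4 * (real M + 1)))"
    proof (rule sum_mono)
      fix m assume "m \<in> {..<M}"
      then have "N m \<le> (\<Sum>m<M. N m)" by (intro member_le_sum) auto
      then have "\<bar>q m i - q m j\<bar> \<le> e / (4 * (real M + 1))"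
        using N[of m i j] ij by (intro less_imp_le) auto
      moreover have "(LINT x|L. indicator (?I m) x * v x) = q m i - q m j"
        unfolding v_def q_def right_diff_distrib using int by (intro Bochner_Integration.integral_diff ind) auto
      ultimately show "\<bar>LINT x|L. indicator (?I m) x * v x\<bar> \<le> e / (4 * (real M + 1))" by simp
    qed
    also have "\<dots> = real M * e / (4 * (real M + 1))" by simp
    also have "\<dots> \<le> e / 4" using e by (simp add: field_simps)
    finally show ?thesis using e unfolding v_def by linarith
  qed
  then show ?thesis by blast
qed

lemma diagonal_convergent:
  fixes g :: "nat \<Rightarrow> 'i::countable \<Rightarrow> real"
  assumes "\<And>n i. \<bar>g n i\<bar> \<le> B"
  obtains r where "strict_mono (r :: nat \<Rightarrow> nat)" "\<And>i. convergent (\<lambda>n. g (r n) i)"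
proof -
  interpret subseqs "\<lambda>m s. convergent (\<lambda>n. g (s n) (from_nat m))"
  proof
    fix m and s :: "nat \<Rightarrow> nat"
    have "bounded (range (\<lambda>n. g (s n) (from_nat m)))"
      using assms by (auto simp: bounded_iff)
    from bounded_imp_convergent_subsequence[OF this]
    show "\<exists>r'. strict_mono r' \<and> convergent (\<lambda>n. g ((s \<circ> r') n) (from_nat m))"
      by (auto simp: convergent_def o_def)
  qed
  \<comment> \<open>The diagonal sequence satisfies the \<open>m\<close>-th requirement only from
    index \<open>Suc m\<close> on; the initial terms do not affect convergence.\<close>
  have "convergent (\<lambda>n. g (diagseq n) i)" for i
  proof -
    have "convergent (\<lambda>n. g ((diagseq \<circ> ((+) (Suc (to_nat i)))) n) (from_nat (to_nat i)))"
    proof (rule diagseq_holds)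
      fix r s :: "nat \<Rightarrow> nat" and m
      assume "strict_mono r" "convergent (\<lambda>n. g (s n) (from_nat m))"
      then show "convergent (\<lambda>n. g ((s \<circ> r) n) (from_nat m))"
        using convergent_subseq_convergent[of "\<lambda>n. g (s n) (from_nat m)" r] by (simp add: o_def)
    qed
    then show ?thesis
      using convergent_ignore_initial_segment[of "\<lambda>n. g (diagseq n) i" "Suc (to_nat i)"]
      by (simp add: o_def add.commute)
  qed
  then show thesis using that[OF subseq_diagseq] by blast
qed

section \<open>Kernels\<close>

text \<open>Comparable to \<open>chk\<close> on nonnegative arguments, but affine there: its second
  differences vanish and those of its cube are explicit polynomials.\<close>

definition br :: "real \<Rightarrow> real" where "br x = 1 + \<bar>x\<bar>"

lemma br_ge_1: "1 \<le> br x" by (simp add: br_def)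
lemma br_pos [simp]: "0 < br x" by (simp add: br_def add_pos_nonneg)
lemma br_nonneg [simp]: "0 \<le> br x" by (simp add: less_imp_le)
lemma br_le_powr: "1 \<le> q \<Longrightarrow> br x \<le> br x powr q"
  using powr_mono[of 1 q "br x"] br_ge_1[of x] by simp

lemma br_measurable [measurable]: "br \<in> borel_measurable borel" unfolding br_def[abs_def] by measurable
lemma hat_measurable [measurable]: "hat \<in> borel_measurable borel" unfolding hat_def[abs_def] by measurable

text \<open>Bernoulli's inequality, read off from convexity of \<open>exp\<close> between 0 and
  \<open>ln a\<close>.\<close>

lemma powr_le_tangent:
  fixes a s :: real
  assumes "0 < a" "0 \<le> s" "s \<le> 1"
  shows "a powr s \<le> 1 + s * (a - 1)"
proof -
  have "exp ((1 - s) *\<^sub>R 0 + s *\<^sub>R ln a) \<le> (1 - s) * exp 0 + s * exp (ln a)"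
    using assms by (intro convex_onD[OF exp_convex]) auto
  then show ?thesis using assms by (simp add: powr_def algebra_simps)
qed

text \<open>With \<open>t = z / (1 + x)\<close> one writes \<open>(1 \<plusminus> t)\<^sup>q = ((1 \<plusminus> t)\<^sup>2)\<^bsup>q/2\<^esup>\<close> and uses that the exponent \<open>q/2\<close>
  is at most \<open>1\<close>; the terms linear in \<open>t\<close> cancel.\<close>

lemma Delta_br_powr:
  assumes z: "0 < z" "z \<le> x" and q: "0 \<le> q" "q \<le> 2"
  shows "Delta z (\<lambda>x. br x powr q) x \<le> q * z\<^sup>2 * br x powr (q - 2)"
proof -
  define t where "t = z / br x"
  have x: "0 < x" using z by simp
  have t: "0 < t" "t < 1" using z x by (auto simp: t_def br_def)
  have zt: "z = t * br x" using br_pos[of x] by (simp add: t_def del: br_pos)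
  have e1: "br (x + z) = br x * (1 + t)" and e2: "br (x - z) = br x * (1 - t)"
    using zt z x by (simp_all add: br_def algebra_simps)
  have P: "b powr q \<le> 1 + q/2 * (b\<^sup>2 - 1)" if "b > 0" for b :: real
  proof -
    have "b powr q = (b\<^sup>2) powr (q/2)"
      using that by (simp flip: powr_numeral add: powr_powr)
    also have "\<dots> \<le> 1 + q/2 * (b\<^sup>2 - 1)" using that q by (intro powr_le_tangent) auto
    finally show ?thesis .
  qed
  have "Delta z (\<lambda>x. br x powr q) x = br x powr q * ((1 + t) powr q + (1 - t) powr q - 2)"
  proof -
    have "(br x * (1 + t)) powr q = br x powr q * (1 + t) powr q" "(br x * (1 - t)) powr q = br x powr q * (1 - t) powr q"
      using t by (simp_all add: powr_mult)
    then show ?thesis by (simp add: Delta_def e1 e2 right_diff_distrib distrib_left)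
  qed
  also have "\<dots> \<le> br x powr q * (q * t\<^sup>2)"
    using P[of "1 + t"] P[of "1 - t"] t
    by (intro mult_left_mono) (auto simp: power2_eq_square algebra_simps)
  also have "\<dots> = q * z\<^sup>2 * br x powr (q - 2)"
    using br_pos[of x] by (simp add: zt powr_diff power_mult_distrib del: br_pos)
  finally show ?thesis .
qed

lemma product_bound:
  fixes F :: "real \<times> real \<Rightarrow> real"
  assumes F [measurable]: "F \<in> borel_measurable L2"
    and g: "integrable L g" and s: "integrable L s"
    and le: "AE (x, z) in L2. \<bar>F (x, z)\<bar> \<le> g x * s z"
  shows "integrable L2 F" and "(LINT p|L2. \<bar>F p\<bar>) \<le> (LINT x|L. g x) * (LINT z|L. s z)"
proof -
  have i: "integrable L2 (\<lambda>(x, z). g x * s z)"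
  proof (rule lborel_pair.Fubini_integrable)
    show "(\<lambda>(x, z). g x * s z) \<in> borel_measurable L2" using g s by measurable
    show "integrable L (\<lambda>x. LINT z|L. norm (case (x, z) of (x, z) \<Rightarrow> g x * s z))"
      using g s by (simp add: abs_mult)
    show "AE x in L. integrable L (\<lambda>z. case (x, z) of (x, z) \<Rightarrow> g x * s z)"
      using s by simp
  qed
  have e: "(LINT p|L2. (\<lambda>(x, z). g x * s z) p) = (LINT x|L. g x) * (LINT z|L. s z)"
    using lborel_pair.integral_fst'[OF i] by (simp add: g s)
  show iF: "integrable L2 F"
    using i F by (rule Bochner_Integration.integrable_bound) (use le in \<open>auto elim!: eventually_mono\<close>)
  have "(LINT p|L2. \<bar>F p\<bar>) \<le> (LINT p|L2. (\<lambda>(x, z). g x * s z) p)"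
    using iF i le by (intro integral_mono_AE) (auto elim!: eventually_mono)
  then show "(LINT p|L2. \<bar>F p\<bar>) \<le> (LINT x|L. g x) * (LINT z|L. s z)" by (simp only: e)
qed

text \<open>Rate of jumps of size \<open>z\<close> at \<open>x\<close>, with the partner
  \<open>y\<close> averaged out. Fixing \<open>c\<close> here turns the quadratic equation into a
  linear one.\<close>

definition gain :: "(real \<Rightarrow> real \<Rightarrow> real \<Rightarrow> real) \<Rightarrow> (real \<Rightarrow> real) \<Rightarrow> real \<Rightarrow> real \<Rightarrow> real" where
  "gain k c x z = (LINT y|L. k x y z * c y)"

definition flux :: "(real \<Rightarrow> real \<Rightarrow> real \<Rightarrow> real) \<Rightarrow> (real \<Rightarrow> real) \<Rightarrow> (real \<Rightarrow> real) \<Rightarrow> real \<Rightarrow> real \<Rightarrow> real" where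
  "flux k b u x z = gain k b x z * u x"

definition step :: "(real \<Rightarrow> real \<Rightarrow> real \<Rightarrow> real) \<Rightarrow> real \<Rightarrow> (real \<Rightarrow> real) \<Rightarrow> (real \<Rightarrow> real) \<Rightarrow> real \<Rightarrow> real" where
  "step k \<tau> b u x = u x + \<tau> * dsec (flux k b u) x"

primrec euler :: "(real \<Rightarrow> real \<Rightarrow> real \<Rightarrow> real) \<Rightarrow> real \<Rightarrow> (real \<Rightarrow> real) \<Rightarrow> nat \<Rightarrow> real \<Rightarrow> real" where
  "euler k \<tau> c 0 = c"
| "euler k \<tau> c (Suc j) = step k \<tau> (euler k \<tau> c j) (euler k \<tau> c j)"

definition mom :: "(real \<Rightarrow> real) \<Rightarrow> (real \<Rightarrow> real) \<Rightarrow> real" where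
  "mom p c = (LINT x|L. p x * c x)"

abbreviation tail_mom :: "real \<Rightarrow> real \<Rightarrow> (real \<Rightarrow> real) \<Rightarrow> real" where
  "tail_mom l R c \<equiv> (LINT x|L. indicator {x. R \<le> br x} x * (br x powr l * c x))"

text \<open>Stands for the cone \<open>Y_plus\<close>, by representatives that are Borel and
  nonnegative at every point, so that pointwise inequalities can be multiplied by them without
  exceptional sets.\<close>

definition state :: "real \<Rightarrow> real \<Rightarrow> (real \<Rightarrow> real) \<Rightarrow> bool" where
  "state l \<alpha> c \<longleftrightarrow> c \<in> borel_measurable L \<and> (\<forall>x. 0 \<le> c x) \<and>
     integrable L (\<lambda>x. br x powr l * c x) \<and> integrable L (\<lambda>x. hat x powr (- \<alpha>) * c x)"

lemma integrable_lower_weight: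
  assumes "integrable L (\<lambda>x. p x * c x)" "c \<in> borel_measurable L" "q \<in> borel_measurable L" "\<And>x. \<bar>q x\<bar> \<le> p x"
  shows "integrable L (\<lambda>x. q x * c x :: real)"
proof (rule Bochner_Integration.integrable_bound[OF assms(1)])
  show "(\<lambda>x. q x * c x) \<in> borel_measurable L" using assms by measurable
  show "AE x in L. norm (q x * c x) \<le> norm (p x * c x)"
    by (rule AE_I2) (auto simp: abs_mult intro!: mult_right_mono order_trans[OF assms(4)])
qed

text \<open>The Lipschitz condition is only required almost everywhere because the kernel will be a Borel
  version of the given Lebesgue measurable one.\<close>

locale kernel =
  fixes k :: "real \<Rightarrow> real \<Rightarrow> real \<Rightarrow> real" and \<psi> :: "real \<Rightarrow> real" and l \<alpha> :: real
  assumes k_meas: "(\<lambda>(x, y, z). k x y z) \<in> borel_measurable L3"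
    and k_nonneg: "0 \<le> k x y z"
    and k_supp: "\<not> (0 < z \<and> z \<le> x \<and> z \<le> y) \<Longrightarrow> k x y z = 0"
    and psi_int: "integrable L \<psi>" and psi_nonneg: "0 \<le> \<psi> z"
    and l: "1 < l" "l \<le> 2" and alpha: "0 \<le> \<alpha>"
    and k_bal: "z\<^sup>2 * k x y z * br x powr (l - 2) \<le> \<psi> z * (br x powr l * br y + br x * br y powr l)"
    and k_growth: "(1 + z\<^sup>2) * k x y z \<le> \<psi> z * br x powr l * br y powr l"
    and k_sing: "hat (x - z) powr (- \<alpha>) * k x y z \<le> \<psi> z * br x powr l * (hat y powr (- \<alpha>) + br y powr l)"
    and k_lip: "0 \<le> h \<Longrightarrow> h \<le> 1 \<Longrightarrow> AE (x, y, z) in L3. \<bar>k (x + h) y z - k x y z\<bar>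
       \<le> h * \<psi> z * br (x + h) * (hat y powr (- \<alpha>) + br y powr l)"
begin

abbreviation "M1 \<equiv> mom br"
abbreviation "Ml \<equiv> mom (\<lambda>x. br x powr l)"
abbreviation "Ms \<equiv> mom (\<lambda>x. hat x powr (- \<alpha>))"
abbreviation "Mw c \<equiv> Ms c + Ml c"
abbreviation "S \<equiv> (LINT z|L. \<psi> z)"

lemma psi_meas [measurable]: "\<psi> \<in> borel_measurable L" using psi_int by auto

lemma S_nonneg [simp]: "0 \<le> S" using psi_nonneg by simp

lemma stateD:
  assumes "state l \<alpha> c"
  shows "c \<in> borel_measurable L" "0 \<le> c x" "integrable L c" "integrable L (\<lambda>x. br x * c x)"
    "integrable L (\<lambda>x. br x powr l * c x)" "integrable L (\<lambda>x. hat x powr (- \<alpha>) * c x)"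
    "integrable L (\<lambda>x. (hat x powr (- \<alpha>) + br x powr l) * c x)"
proof -
  show *: "c \<in> borel_measurable L" "0 \<le> c x" "integrable L (\<lambda>x. br x powr l * c x)" "integrable L (\<lambda>x. hat x powr (- \<alpha>) * c x)"
    using assms by (auto simp: state_def)
  have "integrable L (\<lambda>x. 1 * c x)"
    using br_ge_1 l by (intro integrable_lower_weight[OF *(3)] *) (auto intro!: ge_one_powr_ge_zero)
  then show "integrable L c" by simp
  show "integrable L (\<lambda>x. br x * c x)"
  proof (intro integrable_lower_weight[OF *(3)] *)
    show "\<bar>br x\<bar> \<le> br x powr l" for x
      using l br_le_powr[of l x] by simp
  qed simp
  show "integrable L (\<lambda>x. (hat x powr (- \<alpha>) + br x powr l) * c x)"
    using * by (simp add: distrib_right)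
qed

lemma mom_nonneg: "(\<And>x. 0 \<le> p x) \<Longrightarrow> (\<And>x. 0 \<le> c x) \<Longrightarrow> 0 \<le> mom p c"
  unfolding mom_def by (intro Bochner_Integration.integral_nonneg) simp

lemma M1_le_Ml: assumes "state l \<alpha> c" shows "M1 c \<le> Ml c"
  unfolding mom_def
proof (intro integral_mono mult_right_mono)
  show "br x \<le> br x powr l" for x
    using l br_le_powr[of l x] by simp
qed (use stateD[OF assms] in auto)

lemma k_meas_y: "(\<lambda>y. k x y z) \<in> borel_measurable L"
proof -
  have "(\<lambda>y. (x, y, z)) \<in> measurable L L3" by measurable
  from measurable_compose[OF this k_meas] show ?thesis by simp
qed

lemma gain_meas [measurable]:
  assumes [measurable]: "c \<in> borel_measurable L"
  shows "(\<lambda>(x, z). gain k c x z) \<in> borel_measurable L2"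
proof -
  have 1: "(\<lambda>(p, y). (fst p, y, snd p)) \<in> measurable (L2 \<Otimes>\<^sub>M L) L3" by measurable
  have "(\<lambda>q. (\<lambda>(x, y, z). k x y z) ((\<lambda>(p, y). (fst p, y, snd p)) q)) \<in> borel_measurable (L2 \<Otimes>\<^sub>M L)"
    by (rule measurable_compose[OF 1 k_meas])
  then have [measurable]: "(\<lambda>(p, y). k (fst p) y (snd p)) \<in> borel_measurable (L2 \<Otimes>\<^sub>M L)"
    by (simp add: case_prod_unfold)
  have "(\<lambda>p. LINT y|L. k (fst p) y (snd p) * c y) \<in> borel_measurable L2"
    by (rule lborel.borel_measurable_lebesgue_integral) measurable
  then show ?thesis by (simp add: gain_def case_prod_unfold)
qed

lemma k_le: "k x y z \<le> \<psi> z * br x powr l * br y powr l"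
proof -
  have "k x y z \<le> (1 + z\<^sup>2) * k x y z" using k_nonneg by (simp add: distrib_right)
  with k_growth show ?thesis by (rule order_trans[rotated])
qed

lemma gain_integrable:
  assumes c: "state l \<alpha> c"
  shows "integrable L (\<lambda>y. k x y z * c y)"
proof (rule Bochner_Integration.integrable_bound)
  note [measurable] = stateD(1)[OF c] k_meas_y
  show "integrable L (\<lambda>y. (\<psi> z * br x powr l) * (br y powr l * c y))"
    using stateD(5)[OF c] by simp
  show "(\<lambda>y. k x y z * c y) \<in> borel_measurable L" by measurable
  show "AE y in L. norm (k x y z * c y) \<le> norm ((\<psi> z * br x powr l) * (br y powr l * c y))"
    using k_nonneg stateD(2)[OF c] psi_nonneg k_le
    by (intro AE_I2) (auto simp: abs_mult mult.assoc[symmetric] intro!: mult_right_mono)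
qed

lemma gain_nonneg: assumes "state l \<alpha> c" shows "0 \<le> gain k c x z"
  unfolding gain_def using k_nonneg stateD(2)[OF assms] by (intro Bochner_Integration.integral_nonneg) simp

lemma gain_supp: "\<not> (0 < z \<and> z \<le> x) \<Longrightarrow> gain k c x z = 0"
  unfolding gain_def using k_supp by (auto simp: k_supp)

lemma gain_le:
  assumes c: "state l \<alpha> c" and p: "integrable L (\<lambda>y. p y * c y)" and le: "\<And>y. a * k x y z \<le> C * p y"
  shows "a * gain k c x z \<le> C * mom p c"
proof -
  have "a * gain k c x z = (LINT y|L. a * k x y z * c y)" by (simp add: gain_def mult.assoc)
  also have "\<dots> \<le> (LINT y|L. C * (p y * c y))"
  proof (intro integral_mono)
    show "integrable L (\<lambda>y. a * k x y z * c y)" using gain_integrable[OF c, of x z] by (simp add: mult.assoc)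
    show "integrable L (\<lambda>y. C * (p y * c y))" using p by simp
    show "a * k x y z * c y \<le> C * (p y * c y)" for y
      using mult_right_mono[OF le stateD(2)[OF c]] by (simp add: mult.assoc)
  qed
  finally show ?thesis by (simp add: mom_def)
qed

lemma gain_growth:
  assumes c: "state l \<alpha> c"
  shows "(1 + z\<^sup>2) * gain k c x z \<le> \<psi> z * br x powr l * Ml c"
  using k_growth by (intro gain_le c stateD(5)[OF c])

lemma gain_sing:
  assumes c: "state l \<alpha> c"
  shows "hat (x - z) powr (- \<alpha>) * gain k c x z \<le> \<psi> z * br x powr l * Mw c"
proof -
  have "hat (x - z) powr (- \<alpha>) * gain k c x z \<le> \<psi> z * br x powr l * mom (\<lambda>y. hat y powr (- \<alpha>) + br y powr l) c"
    using k_sing by (intro gain_le c stateD(7)[OF c])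
  also have "mom (\<lambda>y. hat y powr (- \<alpha>) + br y powr l) c = Mw c"
    using stateD[OF c] by (simp add: mom_def distrib_right)
  finally show ?thesis .
qed

text \<open>The source of linearity in the moment estimate: multiplied by a density in
  \<open>x\<close> and integrated, each term pairs a first moment with a moment of order
  \<open>l\<close>, never two moments of order \<open>l\<close>.\<close>

lemma gain_bal:
  assumes c: "state l \<alpha> c"
  shows "z\<^sup>2 * br x powr (l - 2) * gain k c x z \<le> \<psi> z * (br x powr l * M1 c + br x * Ml c)"
proof -
  have i: "integrable L (\<lambda>y. (br x powr l * br y + br x * br y powr l) * c y)"
    using stateD[OF c] by (simp add: distrib_right mult.assoc)
  have "z\<^sup>2 * br x powr (l - 2) * gain k c x z \<le> \<psi> z * mom (\<lambda>y. br x powr l * br y + br x * br y powr l) c"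
    using k_bal by (intro gain_le c i) (simp add: mult_ac)
  also have "mom (\<lambda>y. br x powr l * br y + br x * br y powr l) c = br x powr l * M1 c + br x * Ml c"
    using stateD[OF c] by (simp add: mom_def distrib_right mult.assoc)
  finally show ?thesis .
qed

lemma gain_lip:
  assumes c: "state l \<alpha> c" and h: "0 \<le> h" "h \<le> 1"
  shows "AE (x, z) in L2. \<bar>gain k c (x + h) z - gain k c x z\<bar> \<le> h * \<psi> z * br (x + h) * Mw c"
proof -
  note [measurable] = stateD(1)[OF c]
  let ?Q = "\<lambda>x y z. \<bar>k (x + h) y z - k x y z\<bar> \<le> h * \<psi> z * br (x + h) * (hat y powr (- \<alpha>) + br y powr l)"
  have swap: "(\<lambda>(z, y). (y, z)) \<in> measurable L2 L2" by measurable
  \<comment> \<open>The hypothesis is about triples ordered \<open>(x, y, z)\<close>, whereas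
    \<open>gain\<close> integrates over \<open>y\<close> at fixed \<open>x\<close> and
    \<open>z\<close>; the last two coordinates are swapped before Fubini.\<close>
  have 2: "AE x in L. AE z in L. AE y in L. ?Q x y z"
    using lborel3.AE_pair[OF k_lip[OF h]]
  proof eventually_elim
    case (elim x)
    then have "AE q in distr L2 L2 (\<lambda>(z, y). (y, z)). case q of (y, z) \<Rightarrow> ?Q x y z"
      unfolding lborel_pair.distr_pair_swap[symmetric] by simp
    from lborel_pair.AE_pair[OF AE_distrD[OF swap this]] show ?case by simp
  qed
  have 3: "AE x in L. AE z in L. \<bar>gain k c (x + h) z - gain k c x z\<bar> \<le> h * \<psi> z * br (x + h) * Mw c"
    using 2
  proof eventually_elim
    case (elim x)
    then show ?case
    proof eventually_elim
      case (elim z)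
      have "\<bar>gain k c (x + h) z - gain k c x z\<bar> = \<bar>LINT y|L. (k (x + h) y z - k x y z) * c y\<bar>"
        unfolding gain_def left_diff_distrib using gain_integrable[OF c] by simp
      also have "\<dots> \<le> (LINT y|L. \<bar>(k (x + h) y z - k x y z) * c y\<bar>)" by (rule integral_abs_bound)
      also have "\<dots> \<le> (LINT y|L. h * \<psi> z * br (x + h) * ((hat y powr (- \<alpha>) + br y powr l) * c y))"
      proof (rule integral_mono_AE)
        show "integrable L (\<lambda>y. \<bar>(k (x + h) y z - k x y z) * c y\<bar>)"
          unfolding left_diff_distrib using gain_integrable[OF c] by simp
        show "integrable L (\<lambda>y. h * \<psi> z * br (x + h) * ((hat y powr (- \<alpha>) + br y powr l) * c y))"
          using stateD(7)[OF c] by simp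
        show "AE y in L. \<bar>(k (x + h) y z - k x y z) * c y\<bar> \<le> h * \<psi> z * br (x + h) * ((hat y powr (- \<alpha>) + br y powr l) * c y)"
          using elim
        proof eventually_elim
          case (elim y)
          from mult_right_mono[OF this stateD(2)[OF c, of y]] show ?case
            using stateD(2)[OF c, of y] by (simp add: abs_mult mult.assoc)
        qed
      qed
      also have "\<dots> = h * \<psi> z * br (x + h) * Mw c"
        using stateD[OF c] by (simp add: mom_def distrib_right)
      finally show ?case .
    qed
  qed
  have m: "(\<lambda>(x, z). (x + h, z)) \<in> measurable L2 L2" by measurable
  have [measurable]: "(\<lambda>(x, z). gain k c (x + h) z) \<in> borel_measurable L2"
    using measurable_compose[OF m gain_meas[OF stateD(1)[OF c]]] by (simp add: case_prod_unfold)
  have "Measurable.pred L2 (\<lambda>(x, z). \<bar>gain k c (x + h) z - gain k c x z\<bar> \<le> h * \<psi> z * br (x + h) * Mw c)"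
    using stateD(1)[OF c] by measurable
  then show ?thesis
    using 3 by (intro lborel_pair.AE_pair_measure) (auto simp: pred_def)
qed

end

text \<open>\<open>N\<close> serves integrability and the restriction on the step size. The moment
  inequalities obtained below do not contain it, and therefore survive removal of the
  truncation.\<close>

locale bounded_kernel = kernel +
  fixes N :: real
  assumes N: "0 \<le> N" "k x y z \<le> N * \<psi> z"
begin

abbreviation "M0 \<equiv> \<lambda>c. LINT x|L. c x"

lemma gain_bounded:
  assumes b: "state l \<alpha> b"
  shows "gain k b x z \<le> \<psi> z * (N * M0 b)"
proof -
  have "1 * gain k b x z \<le> N * \<psi> z * mom (\<lambda>_. 1) b"
    by (intro gain_le b) (use N stateD(3)[OF b] in auto)
  then show ?thesis by (simp add: mom_def mult_ac)
qed

lemma flux_meas [measurable]: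
  assumes "state l \<alpha> b" and [measurable]: "u \<in> borel_measurable L"
  shows "case_prod (flux k b u) \<in> borel_measurable L2"
  unfolding flux_def[abs_def] using stateD(1)[OF assms(1)] by measurable

lemma M0_nonneg: "state l \<alpha> b \<Longrightarrow> 0 \<le> M0 b"
  by (intro Bochner_Integration.integral_nonneg stateD(2))

lemma weighted_flux_integrable:
  assumes b: "state l \<alpha> b" and u [measurable]: "u \<in> borel_measurable L"
    and F [measurable]: "F \<in> borel_measurable L2"
    and e: "integrable L (\<lambda>x. e x * u x)"
    and le: "\<And>x z. 0 < z \<Longrightarrow> z \<le> x \<Longrightarrow> \<bar>F (x, z)\<bar> * gain k b x z \<le> \<psi> z * e x"
  shows "integrable L2 (\<lambda>(x, z). F (x, z) * flux k b u x z)"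
proof (rule product_bound(1))
  note [measurable] = flux_meas[OF b u]
  show "(\<lambda>(x, z). F (x, z) * flux k b u x z) \<in> borel_measurable L2" by measurable
  show "integrable L (\<lambda>x. \<bar>e x * u x\<bar>)" using e by simp
  show "integrable L \<psi>" by (rule psi_int)
  show "AE (x, z) in L2. \<bar>case (x, z) of (x, z) \<Rightarrow> F (x, z) * flux k b u x z\<bar> \<le> \<bar>e x * u x\<bar> * \<psi> z"
  proof (rule AE_I2, clarify)
    fix x z
    show "\<bar>F (x, z) * flux k b u x z\<bar> \<le> \<bar>e x * u x\<bar> * \<psi> z"
    proof (cases "0 < z \<and> z \<le> x")
      case True
      have "\<bar>F (x, z)\<bar> * gain k b x z \<le> \<psi> z * \<bar>e x\<bar>"
        using le[of z x] True mult_left_mono[OF abs_ge_self[of "e x"] psi_nonneg[of z]] by linarith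
      from mult_right_mono[OF this abs_ge_zero[of "u x"]]
      show ?thesis using gain_nonneg[OF b, of x z] by (simp add: flux_def abs_mult mult_ac)
    next
      case False
      then show ?thesis using gain_supp[OF False, of b] psi_nonneg[of z] by (simp add: flux_def)
    qed
  qed
qed

lemma flux_integrable:
  assumes b: "state l \<alpha> b" and u: "integrable L u"
  shows "integrable L2 (case_prod (flux k b u))"
proof -
  have "integrable L2 (\<lambda>(x, z). (\<lambda>_. 1) (x, z) * flux k b u x z)"
  proof (rule weighted_flux_integrable[OF b])
    show "integrable L (\<lambda>x. N * M0 b * u x)" using u by simp
    show "\<bar>1\<bar> * gain k b x z \<le> \<psi> z * (N * M0 b)" for x z
      using gain_bounded[OF b] by simp
  qed (use u in auto)
  then show ?thesis by simp
qed

lemma step_meas [measurable]: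
  assumes b: "state l \<alpha> b" and [measurable]: "u \<in> borel_measurable L"
  shows "step k \<tau> b u \<in> borel_measurable L"
proof -
  note [measurable] = flux_meas[OF b]
  show ?thesis unfolding step_def[abs_def] by measurable
qed

lemma step_integrable:
  assumes b: "state l \<alpha> b" and u: "integrable L u"
  shows "integrable L (step k \<tau> b u)"
  unfolding step_def[abs_def] using u dsec_integrable[OF flux_integrable[OF b u]] by simp

text \<open>Common form of all moment estimates: \<open>e\<close> bounds the production of
  \<open>p\<close> and alone enters the inequality. The conditions \<open>up\<close> and
  \<open>down\<close> make the shifted terms integrable; \<open>down\<close> has its own majorant
  \<open>e1\<close> because \<open>p (x - z)\<close> is not controlled by \<open>p x\<close> when
  \<open>p\<close> is singular at 0.\<close>

lemma step_weight:
  assumes b: "state l \<alpha> b" and u [measurable]: "u \<in> borel_measurable L" and u0: "\<And>x. 0 \<le> u x"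
    and tau: "0 \<le> \<tau>"
    and p [measurable]: "p \<in> borel_measurable L" and p0: "\<And>x. 0 \<le> p x"
    and i: "integrable L (\<lambda>x. p x * u x)" "integrable L (\<lambda>x. e1 x * u x)" "integrable L (\<lambda>x. e x * u x)"
    and e0: "\<And>x. 0 \<le> e x"
    and up: "\<And>x z. 0 < z \<Longrightarrow> z \<le> x \<Longrightarrow> p (x + z) \<le> C * p x"
    and down: "\<And>x z. 0 < z \<Longrightarrow> z \<le> x \<Longrightarrow> p (x - z) * gain k b x z \<le> \<psi> z * e1 x"
    and D: "\<And>x z. 0 < z \<Longrightarrow> z \<le> x \<Longrightarrow> Delta z p x * gain k b x z \<le> \<psi> z * e x"
  shows "integrable L (\<lambda>x. p x * step k \<tau> b u x)"
    and "mom p (step k \<tau> b u) \<le> mom p u + \<tau> * (S * mom e u)"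
proof -
  note [measurable] = flux_meas[OF b u]
  have 0: "integrable L2 (\<lambda>(x, z). p x * flux k b u x z)"
  proof -
    have "integrable L2 (\<lambda>(x, z). (\<lambda>(x, z). p x) (x, z) * flux k b u x z)"
    proof (rule weighted_flux_integrable[OF b u])
      show "integrable L (\<lambda>x. N * M0 b * p x * u x)" using i(1) by (simp add: mult.assoc)
      show "\<bar>(\<lambda>(x, z). p x) (x, z)\<bar> * gain k b x z \<le> \<psi> z * (N * M0 b * p x)" for x z :: real
        using mult_right_mono[OF gain_bounded[OF b, of x z] p0[of x]] p0[of x] by (simp add: mult_ac)
    qed auto
    then show ?thesis by simp
  qed
  have 1: "integrable L2 (\<lambda>(x, z). p (x + z) * flux k b u x z)"
  proof -
    have "integrable L2 (\<lambda>(x, z). (\<lambda>(x, z). p (x + z)) (x, z) * flux k b u x z)"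
    proof (rule weighted_flux_integrable[OF b u])
      show "integrable L (\<lambda>x. N * M0 b * C * p x * u x)" using i(1) by (simp add: mult.assoc)
      fix x z :: real assume xz: "0 < z" "z \<le> x"
      have "p (x + z) * gain k b x z \<le> C * p x * (\<psi> z * (N * M0 b))"
        using up[OF xz] gain_bounded[OF b, of x z] gain_nonneg[OF b, of x z] p0[of "x + z"]
        by (intro mult_mono) auto
      then show "\<bar>(\<lambda>(x, z). p (x + z)) (x, z)\<bar> * gain k b x z \<le> \<psi> z * (N * M0 b * C * p x)"
        using p0[of "x + z"] by (simp add: mult_ac)
    qed auto
    then show ?thesis by simp
  qed
  have 2: "integrable L2 (\<lambda>(x, z). p (x - z) * flux k b u x z)"
  proof -
    have "integrable L2 (\<lambda>(x, z). (\<lambda>(x, z). p (x - z)) (x, z) * flux k b u x z)"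
      using down p0 by (intro weighted_flux_integrable[OF b u _ i(2)]) auto
    then show ?thesis by simp
  qed
  note w = dsec_weak[OF flux_meas[OF b u] p 0 1 2]
  have dist: "p x * step k \<tau> b u x = p x * u x + \<tau> * (p x * dsec (flux k b u) x)" for x
    by (simp add: step_def algebra_simps)
  show "integrable L (\<lambda>x. p x * step k \<tau> b u x)"
    unfolding dist using i(1) w(1) by simp
  have "mom p (step k \<tau> b u) = mom p u + \<tau> * (LINT (x, z)|L2. Delta z p x * flux k b u x z)"
    unfolding mom_def dist using i(1) w(1) by (simp add: w(2))
  also have "(LINT (x, z)|L2. Delta z p x * flux k b u x z) \<le> S * mom e u"
  proof -
    have ie: "integrable L2 (\<lambda>(x, z). (e x * u x) * \<psi> z)"
      by (rule product_bound(1)[OF _ integrable_abs[OF i(3)] psi_int]) (use i(3) psi_nonneg in \<open>auto simp: abs_mult\<close>)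
    have "(LINT (x, z)|L2. Delta z p x * flux k b u x z) \<le> (LINT (x, z)|L2. (e x * u x) * \<psi> z)"
    proof (rule integral_mono[OF w(3) ie], clarify)
      fix x z
      show "Delta z p x * flux k b u x z \<le> e x * u x * \<psi> z"
      proof (cases "0 < z \<and> z \<le> x")
        case True
        then show ?thesis using mult_right_mono[OF D u0[of x], of z x] by (simp add: flux_def mult_ac)
      next
        case False
        then show ?thesis using gain_supp[OF False, of b] psi_nonneg[of z] e0[of x] u0[of x] by (simp add: flux_def)
      qed
    qed
    also have "\<dots> = S * mom e u"
      using lborel_pair.integral_fst'[OF ie] by (simp add: mom_def mult.commute)
    finally show ?thesis .
  qed
  finally show "mom p (step k \<tau> b u) \<le> mom p u + \<tau> * (S * mom e u)"
    using tau by (simp add: mult_left_mono)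
qed

section \<open>Moments after one step\<close>

lemma br_powr_up: "0 < z \<Longrightarrow> z \<le> x \<Longrightarrow> 0 \<le> q \<Longrightarrow> br (x + z) powr q \<le> 2 powr q * br x powr q"
  by (subst powr_mult[symmetric]) (auto intro!: powr_mono2 simp: br_def)

lemma br_powr_down: "0 < z \<Longrightarrow> z \<le> x \<Longrightarrow> 0 \<le> q \<Longrightarrow> br (x - z) powr q \<le> br x powr q"
  by (auto intro!: powr_mono2 simp: br_def)

text \<open>As \<open>z \<le> x\<close>, an upward jump changes the weight at most by the factor
  \<open>2 powr q\<close> and a downward jump does not increase it, so boundedness of
  \<open>gain\<close> settles both integrability conditions.\<close>

lemma step_power_weight:
  assumes b: "state l \<alpha> b" and u: "u \<in> borel_measurable L" and u0: "\<And>x. 0 \<le> u x" and tau: "0 \<le> \<tau>"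
    and q: "0 \<le> q" and i: "integrable L (\<lambda>x. br x powr q * u x)" "integrable L (\<lambda>x. e x * u x)"
    and e0: "\<And>x. 0 \<le> e x"
    and D: "\<And>x z. 0 < z \<Longrightarrow> z \<le> x \<Longrightarrow> Delta z (\<lambda>x. br x powr q) x * gain k b x z \<le> \<psi> z * e x"
  shows "integrable L (\<lambda>x. br x powr q * step k \<tau> b u x)"
    and "mom (\<lambda>x. br x powr q) (step k \<tau> b u) \<le> mom (\<lambda>x. br x powr q) u + \<tau> * (S * mom e u)"
proof -
  have i1: "integrable L (\<lambda>x. N * M0 b * br x powr q * u x)" using i(1) by (simp add: mult.assoc)
  have down: "br (x - z) powr q * gain k b x z \<le> \<psi> z * (N * M0 b * br x powr q)" if "0 < z" "z \<le> x" for x z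
  proof -
    have "br (x - z) powr q * gain k b x z \<le> br x powr q * (\<psi> z * (N * M0 b))"
      using br_powr_down[OF that q] gain_bounded[OF b] gain_nonneg[OF b] by (intro mult_mono) auto
    then show ?thesis by (simp add: mult_ac)
  qed
  have p: "(\<lambda>x. br x powr q) \<in> borel_measurable L" by measurable
  note W = step_weight[OF b u u0 tau p _ i(1) i1 i(2) e0 br_powr_up[OF _ _ q] down D]
  show "integrable L (\<lambda>x. br x powr q * step k \<tau> b u x)" by (rule W(1)) auto
  show "mom (\<lambda>x. br x powr q) (step k \<tau> b u) \<le> mom (\<lambda>x. br x powr q) u + \<tau> * (S * mom e u)"
    by (rule W(2)) auto
qed

text \<open>The exponent 0 gives the constant weight, whose second difference vanishes, so zero
  production is admissible.\<close>

lemma step_M0: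
  assumes b: "state l \<alpha> b" and u: "integrable L u" and u0: "\<And>x. 0 \<le> u x" and tau: "0 \<le> \<tau>"
  shows "M0 (step k \<tau> b u) \<le> M0 u"
proof -
  have p: "br x powr 0 = 1" for x using br_pos[of x] by (simp del: br_pos)
  have m: "u \<in> borel_measurable L" using u by auto
  have i: "integrable L (\<lambda>x. br x powr 0 * u x)" unfolding p using u by simp
  have "mom (\<lambda>x. br x powr 0) (step k \<tau> b u) \<le> mom (\<lambda>x. br x powr 0) u + \<tau> * (S * mom (\<lambda>_. 0) u)"
    by (rule step_power_weight(2)[OF b m u0 tau _ i]) (auto simp: Delta_def p simp del: powr_zero_eq_one)
  then show ?thesis unfolding p by (simp add: mom_def)
qed

text \<open>\<open>br\<close> is affine on nonnegative arguments, and \<open>x - z \<ge> 0\<close>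
  on the support of the flux; again the second difference is 0.\<close>

lemma step_M1:
  assumes b: "state l \<alpha> b" and u: "integrable L (\<lambda>x. br x * u x)" "u \<in> borel_measurable L" and u0: "\<And>x. 0 \<le> u x" and tau: "0 \<le> \<tau>"
  shows "M1 (step k \<tau> b u) \<le> M1 u"
proof -
  have p: "br x powr 1 = br x" for x by simp
  have i: "integrable L (\<lambda>x. br x powr 1 * u x)" unfolding p using u by simp
  have "mom (\<lambda>x. br x powr 1) (step k \<tau> b u) \<le> mom (\<lambda>x. br x powr 1) u + \<tau> * (S * mom (\<lambda>_. 0) u)"
    by (rule step_power_weight(2)[OF b u(2) u0 tau _ i]) (auto simp: Delta_def br_def)
  then show ?thesis unfolding p by (simp add: mom_def)
qed

text \<open>The second difference is at most \<open>l * z\<^sup>2 * br x powr (l - 2)\<close>, the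
  very factor that \<open>gain_bal\<close> absorbs.\<close>

lemma step_Ml:
  assumes b: "state l \<alpha> b" and u: "integrable L (\<lambda>x. br x powr l * u x)" "u \<in> borel_measurable L" and u0: "\<And>x. 0 \<le> u x" and tau: "0 \<le> \<tau>"
  shows "integrable L (\<lambda>x. br x powr l * step k \<tau> b u x)"
    and "Ml (step k \<tau> b u) \<le> Ml u + \<tau> * (S * l * (M1 b * Ml u + Ml b * M1 u))"
proof -
  define e where "e x = l * (br x powr l * M1 b + br x * Ml b)" for x
  have i1: "integrable L (\<lambda>x. br x * u x)"
  proof (rule integrable_lower_weight[OF u(1) u(2)])
    show "\<bar>br x\<bar> \<le> br x powr l" for x
      using l br_le_powr[of l x] by simp
  qed simp
  have M: "0 \<le> M1 b" "0 \<le> Ml b"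
    using stateD(2)[OF b] by (auto intro!: mom_nonneg)
  have ie: "integrable L (\<lambda>x. e x * u x)"
  proof -
    have "(\<lambda>x. e x * u x) = (\<lambda>x. l * M1 b * (br x powr l * u x) + l * Ml b * (br x * u x))"
      by (auto simp: e_def algebra_simps)
    then show ?thesis using u(1) i1 by simp
  qed
  have e: "mom e u = l * (M1 b * Ml u + Ml b * M1 u)"
  proof -
    have "mom e u = (LINT x|L. l * M1 b * (br x powr l * u x) + l * Ml b * (br x * u x))"
      unfolding mom_def e_def by (intro Bochner_Integration.integral_cong) (auto simp: algebra_simps)
    also have "\<dots> = l * M1 b * Ml u + l * Ml b * M1 u"
      using u(1) i1 by (simp add: mom_def)
    finally show ?thesis by (simp add: algebra_simps)
  qed
  have D: "Delta z (\<lambda>x. br x powr l) x * gain k b x z \<le> \<psi> z * e x" if "0 < z" "z \<le> x" for x z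
  proof -
    have "Delta z (\<lambda>x. br x powr l) x * gain k b x z \<le> (l * z\<^sup>2 * br x powr (l - 2)) * gain k b x z"
      using Delta_br_powr[OF that, of l] l gain_nonneg[OF b] by (intro mult_right_mono) auto
    also have "\<dots> \<le> l * (\<psi> z * (br x powr l * M1 b + br x * Ml b))"
      using mult_left_mono[OF gain_bal[OF b, of z x], of l] l by (simp add: mult.assoc)
    finally show ?thesis by (simp add: e_def mult_ac)
  qed
  have e0: "0 \<le> e x" for x using M l by (simp add: e_def)
  have "0 \<le> l" using l by simp
  note W = step_power_weight[OF b u(2) u0 tau this u(1) ie e0 D]
  show "integrable L (\<lambda>x. br x powr l * step k \<tau> b u x)" by (rule W(1))
  show "Ml (step k \<tau> b u) \<le> Ml u + \<tau> * (S * l * (M1 b * Ml u + Ml b * M1 u))"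
    using W(2) by (simp add: e mult_ac)
qed

text \<open>The second difference of the cube is exactly \<open>6 * z\<^sup>2 * br x\<close>. Times
  the growth \<open>br x powr l\<close> of the rate it stays below a multiple of
  \<open>br x powr 3\<close>, because \<open>l \<le> 2\<close>. The growth factor contains no
  truncation parameter.\<close>

lemma step_M3:
  assumes b: "state l \<alpha> b" and u: "integrable L (\<lambda>x. br x powr 3 * u x)" "u \<in> borel_measurable L" and u0: "\<And>x. 0 \<le> u x" and tau: "0 \<le> \<tau>"
  shows "integrable L (\<lambda>x. br x powr 3 * step k \<tau> b u x)"
    and "mom (\<lambda>x. br x powr 3) (step k \<tau> b u) \<le> mom (\<lambda>x. br x powr 3) u * (1 + \<tau> * (6 * S * Ml b))"
proof -
  have M: "0 \<le> Ml b"
    using stateD(2)[OF b] by (auto intro!: mom_nonneg)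
  define e where "e x = 6 * Ml b * br x powr 3" for x
  have ie: "integrable L (\<lambda>x. e x * u x)" using u(1) by (simp add: e_def mult.assoc)
  have e: "mom e u = 6 * Ml b * mom (\<lambda>x. br x powr 3) u" by (simp add: mom_def e_def mult.assoc)
  have D: "Delta z (\<lambda>x. br x powr 3) x * gain k b x z \<le> \<psi> z * e x" if "0 < z" "z \<le> x" for x z
  proof -
    have "Delta z (\<lambda>x. br x powr 3) x = 6 * z\<^sup>2 * br x"
      using that by (simp add: Delta_def br_def power3_eq_cube power2_eq_square algebra_simps)
    then have "Delta z (\<lambda>x. br x powr 3) x * gain k b x z = 6 * br x * (z\<^sup>2 * gain k b x z)" by simp
    also have "\<dots> \<le> 6 * br x * (\<psi> z * br x powr l * Ml b)"
    proof (intro mult_left_mono)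
      have "z\<^sup>2 * gain k b x z \<le> (1 + z\<^sup>2) * gain k b x z"
        using gain_nonneg[OF b, of x z] by (simp add: distrib_right)
      also note gain_growth[OF b]
      finally show "z\<^sup>2 * gain k b x z \<le> \<psi> z * br x powr l * Ml b" .
    qed simp
    also have "\<dots> = \<psi> z * (6 * Ml b) * br x powr (1 + l)"
      using br_pos[of x] by (simp add: powr_add del: br_pos)
    also have "\<dots> \<le> \<psi> z * (6 * Ml b) * br x powr 3"
      using l br_ge_1[of x] M psi_nonneg by (intro mult_left_mono powr_mono) auto
    finally show ?thesis by (simp add: e_def mult_ac)
  qed
  have e0: "0 \<le> e x" for x using M by (simp add: e_def)
  note W = step_power_weight[OF b u(2) u0 tau _ u(1) ie e0 D]
  show "integrable L (\<lambda>x. br x powr 3 * step k \<tau> b u x)" by (rule W(1)) auto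
  have "mom (\<lambda>x. br x powr 3) (step k \<tau> b u) \<le> mom (\<lambda>x. br x powr 3) u + \<tau> * (S * mom e u)"
    by (rule W(2)) auto
  then show "mom (\<lambda>x. br x powr 3) (step k \<tau> b u) \<le> mom (\<lambda>x. br x powr 3) u * (1 + \<tau> * (6 * S * Ml b))"
    by (simp add: e algebra_simps)
qed

text \<open>The weight decreases on positive arguments, so its value at \<open>x + z\<close> minus
  twice its value at \<open>x\<close> is at most 0. Only the value at \<open>x - z\<close> can
  produce, and this is what \<open>k_sing\<close> controls.\<close>

lemma step_Ms:
  assumes b: "state l \<alpha> b" and u: "state l \<alpha> u" and tau: "0 \<le> \<tau>"
  shows "integrable L (\<lambda>x. hat x powr (- \<alpha>) * step k \<tau> b u x)"
    and "Ms (step k \<tau> b u) \<le> Ms u + \<tau> * (S * (Mw b * Ml u))"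
proof -
  have M: "0 \<le> Mw b"
    using stateD(2)[OF b] by (auto intro!: mom_nonneg add_nonneg_nonneg)
  define e where "e x = br x powr l * Mw b" for x
  have eq: "(\<lambda>x. e x * u x) = (\<lambda>x. Mw b * (br x powr l * u x))" by (auto simp: e_def)
  have ie: "integrable L (\<lambda>x. e x * u x)" unfolding eq using stateD(5)[OF u] by simp
  have e: "mom e u = Mw b * Ml u" unfolding mom_def[of e] eq by (simp add: mom_def)
  have e0: "0 \<le> e x" for x using M by (simp add: e_def)
  have down: "hat (x - z) powr (- \<alpha>) * gain k b x z \<le> \<psi> z * e x" for x z
    using gain_sing[OF b, of x z] by (simp add: e_def mult_ac)
  have up: "hat (x + z) powr (- \<alpha>) \<le> 1 * hat x powr (- \<alpha>)" if "0 < z" "z \<le> x" for x z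
    using that alpha by (auto intro!: powr_mono2' simp: hat_def)
  have D: "Delta z (\<lambda>x. hat x powr (- \<alpha>)) x * gain k b x z \<le> \<psi> z * e x" if "0 < z" "z \<le> x" for x z
  proof -
    have "Delta z (\<lambda>x. hat x powr (- \<alpha>)) x * gain k b x z \<le> hat (x - z) powr (- \<alpha>) * gain k b x z"
    proof (intro mult_right_mono gain_nonneg[OF b])
      show "Delta z (\<lambda>x. hat x powr (- \<alpha>)) x \<le> hat (x - z) powr (- \<alpha>)"
        using up[OF that] powr_ge_zero[of "hat x" "- \<alpha>"] unfolding Delta_def by linarith
    qed
    also note down
    finally show ?thesis .
  qed
  have p: "(\<lambda>x. hat x powr (- \<alpha>)) \<in> borel_measurable L" by measurable
  note W = step_weight[OF b stateD(1)[OF u] stateD(2)[OF u] tau p powr_ge_zero stateD(6)[OF u] ie ie e0 up down D]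
  show "integrable L (\<lambda>x. hat x powr (- \<alpha>) * step k \<tau> b u x)" by (rule W(1))
  show "Ms (step k \<tau> b u) \<le> Ms u + \<tau> * (S * (Mw b * Ml u))" using W(2) by (simp add: e)
qed

section \<open>Positivity and contraction of one step\<close>

lemma gain_integrable_z:
  assumes b: "state l \<alpha> b"
  shows "integrable L (gain k b x)" and "(LINT z|L. gain k b x z) \<le> S * (N * M0 b)"
proof -
  have m: "(\<lambda>z. (x, z)) \<in> measurable L L2" by measurable
  have gm: "gain k b x \<in> borel_measurable L"
    using measurable_compose[OF m gain_meas[OF stateD(1)[OF b]]] by simp
  have ip: "integrable L (\<lambda>z. \<psi> z * (N * M0 b))" using psi_int by simp
  have nn: "0 \<le> gain k b x z" for z by (rule gain_nonneg[OF b])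
  show i: "integrable L (gain k b x)"
  proof (rule Bochner_Integration.integrable_bound[OF ip gm], rule AE_I2)
    fix z show "norm (gain k b x z) \<le> norm (\<psi> z * (N * M0 b))"
      using gain_bounded[OF b, of x z] nn[of z] by simp
  qed
  have "(LINT z|L. gain k b x z) \<le> (LINT z|L. \<psi> z * (N * M0 b))"
    using gain_bounded[OF b] by (intro integral_mono i ip)
  then show "(LINT z|L. gain k b x z) \<le> S * (N * M0 b)" by simp
qed

text \<open>The loss per unit time is at most \<open>2 * u x\<close> times a total rate of at most
  \<open>S * (N * M0 b)\<close>; the condition on \<open>\<tau>\<close> keeps it below
  \<open>u x\<close>, and the two incoming terms are nonnegative.\<close>

lemma step_nonneg:
  assumes b: "state l \<alpha> b" and u0: "\<And>x. 0 \<le> u x" and tau: "0 \<le> \<tau>" "2 * \<tau> * (S * (N * M0 b)) \<le> 1"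
  shows "0 \<le> step k \<tau> b u x"
proof -
  let ?F = "\<lambda>z. flux k b u (x - z) z + flux k b u (x + z) z - 2 * flux k b u x z"
  have g: "- (2 * u x) * (S * (N * M0 b)) \<le> - (2 * u x) * (LINT z|L. gain k b x z)"
    using gain_integrable_z(2)[OF b, of x] u0[of x] by (intro mult_left_mono_neg) auto
  have "- (2 * u x) * (S * (N * M0 b)) \<le> dsec (flux k b u) x"
  proof (cases "integrable L ?F")
    case True
    have "- (2 * u x) * (LINT z|L. gain k b x z) = (LINT z|L. - (2 * u x) * gain k b x z)" by simp
    also have "\<dots> \<le> (LINT z|L. ?F z)"
      using gain_integrable_z(1)[OF b, of x] True gain_nonneg[OF b] u0
      by (intro integral_mono) (auto simp: flux_def)
    finally show ?thesis using g by (simp add: dsec_def)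
  next
    case False
    \<comment> \<open>Where the section is not integrable, the Bochner integral is 0 and the step
      leaves \<open>u x\<close> unchanged; hence positivity at every \<open>x\<close> and not just
      almost everywhere.\<close>
    then have "dsec (flux k b u) x = 0" by (simp add: dsec_def not_integrable_integral_eq)
    moreover have "0 \<le> u x * (S * (N * M0 b))"
      using u0 N M0_nonneg[OF b] by (intro mult_nonneg_nonneg) auto
    ultimately show ?thesis by (simp add: mult_ac)
  qed
  from mult_left_mono[OF this tau(1)] have "u x * (1 - 2 * \<tau> * (S * (N * M0 b))) \<le> step k \<tau> b u x"
    by (simp add: step_def algebra_simps)
  moreover have "0 \<le> u x * (1 - 2 * \<tau> * (S * (N * M0 b)))" using u0 tau by simp
  ultimately show ?thesis by linarith
qed

text \<open>A positive linear map that does not increase mass contracts L1: the modulus of the step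
  of \<open>v\<close> is dominated by the step of the modulus. The comparison is made almost
  everywhere, where the sections are integrable and the loss can be split off.\<close>

lemma step_L1_contraction:
  assumes b: "state l \<alpha> b" and v: "integrable L v" and tau: "0 \<le> \<tau>" "2 * \<tau> * (S * (N * M0 b)) \<le> 1"
  shows "M0 (\<lambda>x. \<bar>step k \<tau> b v x\<bar>) \<le> M0 (\<lambda>x. \<bar>v x\<bar>)"
proof -
  let ?w = "\<lambda>x. \<bar>v x\<bar>"
  have w: "integrable L ?w" using v by simp
  have "M0 (\<lambda>x. \<bar>step k \<tau> b v x\<bar>) \<le> M0 (step k \<tau> b ?w)"
  proof (rule integral_mono_AE)
    show "integrable L (\<lambda>x. \<bar>step k \<tau> b v x\<bar>)" using step_integrable[OF b v] by simp
    show "integrable L (step k \<tau> b ?w)" using step_integrable[OF b w] .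
    show "AE x in L. \<bar>step k \<tau> b v x\<bar> \<le> step k \<tau> b ?w x"
      using AE_integrable_shift[OF flux_integrable[OF b v]] AE_integrable_shift[OF flux_integrable[OF b w]]
    proof eventually_elim
      case (elim x)
      define G where "G = (LINT z|L. gain k b x z)"
      have G: "0 \<le> 1 - 2 * \<tau> * G"
      proof -
        have "2 * \<tau> * G \<le> 2 * \<tau> * (S * (N * M0 b))"
          unfolding G_def using gain_integrable_z(2)[OF b, of x] tau by (intro mult_left_mono) auto
        then show ?thesis using tau by simp
      qed
      have d: "dsec (flux k b f) x = (LINT z|L. flux k b f (x - z) z + flux k b f (x + z) z) - 2 * f x * G"
        if "integrable L (\<lambda>z. flux k b f (x - z) z) \<and> integrable L (\<lambda>z. flux k b f (x + z) z) \<and> integrable L (flux k b f x)" for f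
      proof -
        have "(LINT z|L. flux k b f x z) = f x * G" by (simp add: flux_def G_def)
        then show ?thesis unfolding dsec_def using that by simp
      qed
      have alg: "a + \<tau> * (I - 2 * a * G) = a * (1 - 2 * \<tau> * G) + \<tau> * I" for a I
        by (simp add: algebra_simps)
      have fw: "flux k b ?w y z = \<bar>flux k b v y z\<bar>" for y z
        using gain_nonneg[OF b, of y z] by (simp add: flux_def abs_mult)
      have le: "\<bar>LINT z|L. flux k b v (x - z) z + flux k b v (x + z) z\<bar> \<le> (LINT z|L. flux k b ?w (x - z) z + flux k b ?w (x + z) z)"
      proof -
        have "\<bar>LINT z|L. flux k b v (x - z) z + flux k b v (x + z) z\<bar> \<le> (LINT z|L. \<bar>flux k b v (x - z) z + flux k b v (x + z) z\<bar>)"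
          by (rule integral_abs_bound)
        also have "\<dots> \<le> (LINT z|L. flux k b ?w (x - z) z + flux k b ?w (x + z) z)"
          using elim by (intro integral_mono) (auto simp: fw)
        finally show ?thesis .
      qed
      have "step k \<tau> b v x = v x * (1 - 2 * \<tau> * G) + \<tau> * (LINT z|L. flux k b v (x - z) z + flux k b v (x + z) z)"
        unfolding step_def d[OF elim(1)] by (rule alg)
      then have "\<bar>step k \<tau> b v x\<bar> \<le> \<bar>v x * (1 - 2 * \<tau> * G)\<bar> + \<bar>\<tau> * (LINT z|L. flux k b v (x - z) z + flux k b v (x + z) z)\<bar>"
        by simp
      also have "\<dots> \<le> ?w x * (1 - 2 * \<tau> * G) + \<tau> * (LINT z|L. flux k b ?w (x - z) z + flux k b ?w (x + z) z)"
        using G tau le by (intro add_mono) (auto simp: abs_mult intro!: mult_left_mono)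
      also have "\<dots> = step k \<tau> b ?w x"
        unfolding step_def d[OF elim(2)] by (rule alg[symmetric])
      finally show ?case .
    qed
  qed
  also have "\<dots> \<le> M0 ?w" by (rule step_M0[OF b w _ tau(1)]) simp
  finally show ?thesis .
qed

lemma step_add:
  assumes b: "state l \<alpha> b" and c: "integrable L c" and u: "integrable L u" and v: "integrable L v"
    and eq: "AE x in L. c x = u x + v x"
  shows "AE x in L. step k \<tau> b c x = step k \<tau> b u x + step k \<tau> b v x"
proof -
  note iu = flux_integrable[OF b u] and iv = flux_integrable[OF b v]
  have uv: "integrable L2 (\<lambda>(x, z). flux k b u x z + flux k b v x z)"
    using Bochner_Integration.integrable_add[OF iu iv] by (simp add: case_prod_unfold)
  have "AE x in L. dsec (flux k b c) x = dsec (\<lambda>x z. flux k b u x z + flux k b v x z) x"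
    using eq by (intro dsec_cong_AE flux_integrable[OF b c] uv) (auto elim!: eventually_mono simp: flux_def algebra_simps)
  then show ?thesis
    using dsec_add[OF iu iv] eq by eventually_elim (simp add: step_def algebra_simps)
qed

end

section \<open>The explicit Euler scheme\<close>

text \<open>The recursion is required below \<open>j\<close> only, since the rates used later are
  bounded only up to a fixed time. \<open>B\<close> is a rate times the step size, so
  \<open>B * real j\<close> is that rate times the elapsed time.\<close>

lemma discrete_Gronwall:
  fixes a :: "nat \<Rightarrow> real"
  assumes "\<And>i. i < j \<Longrightarrow> a (Suc i) \<le> a i * (1 + B)" and B: "0 \<le> B" and a: "0 \<le> a 0"
  shows "a j \<le> exp (B * real j) * a 0"
  using assms(1)
proof (induction j)
  case (Suc j)
  have "a (Suc j) \<le> a j * (1 + B)" using Suc.prems by simp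
  also have "\<dots> \<le> (exp (B * real j) * a 0) * (1 + B)"
    using Suc.IH Suc.prems B by (intro mult_right_mono) auto
  also have "\<dots> \<le> (exp (B * real j) * a 0) * exp B"
    using a by (intro mult_left_mono exp_ge_add_one_self) auto
  also have "\<dots> = exp (B * real (Suc j)) * a 0" by (simp add: distrib_left exp_add mult_ac)
  finally show ?case .
qed simp

text \<open>Defined outside the locales to make visible that neither truncation nor step size
  enters. The rate is that of \<open>step_Ml\<close> with \<open>b = u\<close>, where the two terms
  coincide.\<close>

definition growth_bound :: "(real \<Rightarrow> real) \<Rightarrow> real \<Rightarrow> (real \<Rightarrow> real) \<Rightarrow> real \<Rightarrow> real" where
  "growth_bound \<psi> l c T = exp (2 * (LINT z|L. \<psi> z) * l * mom br c * T) * mom (\<lambda>x. br x powr l) c"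

definition weight_bound :: "(real \<Rightarrow> real) \<Rightarrow> real \<Rightarrow> real \<Rightarrow> (real \<Rightarrow> real) \<Rightarrow> real \<Rightarrow> real" where
  "weight_bound \<psi> l \<alpha> c T =
     exp ((2 * (LINT z|L. \<psi> z) * l * mom br c + (LINT z|L. \<psi> z) * growth_bound \<psi> l c T) * T) *
     (mom (\<lambda>x. hat x powr (- \<alpha>)) c + mom (\<lambda>x. br x powr l) c)"

locale euler_scheme = bounded_kernel +
  fixes \<tau> :: real and c0 :: "real \<Rightarrow> real"
  assumes tau: "0 < \<tau>" "2 * \<tau> * (S * (N * M0 c0)) \<le> 1" and c0: "state l \<alpha> c0"
begin

abbreviation "c \<equiv> euler k \<tau> c0"
abbreviation "A \<equiv> growth_bound \<psi> l c0"
abbreviation "W \<equiv> weight_bound \<psi> l \<alpha> c0"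

lemma tau_nonneg: "0 \<le> \<tau>" using tau by simp

text \<open>A joint induction: positivity of the next iterate needs the step-size condition for the
  current mass, and mass does not increase as long as the iterates are nonnegative.\<close>

lemma euler_invariants: "state l \<alpha> (c j) \<and> M0 (c j) \<le> M0 c0 \<and> M1 (c j) \<le> M1 c0"
proof (induction j)
  case (Suc j)
  then have s: "state l \<alpha> (c j)" by simp
  note D = stateD[OF s]
  have "S * (N * M0 (c j)) \<le> S * (N * M0 c0)"
    using Suc N by (intro mult_left_mono S_nonneg) auto
  then have t: "2 * \<tau> * (S * (N * M0 (c j))) \<le> 1"
    by (rule order_trans[OF mult_left_mono tau(2)]) (use tau in simp)
  have "0 \<le> c (Suc j) x" for x using step_nonneg[OF s D(2) tau_nonneg t] by simp
  moreover have "c (Suc j) \<in> borel_measurable L" using step_meas[OF s D(1)] by simp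
  moreover have "integrable L (\<lambda>x. br x powr l * c (Suc j) x)"
    using step_Ml(1)[OF s D(5) D(1) D(2) tau_nonneg] by simp
  moreover have "integrable L (\<lambda>x. hat x powr (- \<alpha>) * c (Suc j) x)"
    using step_Ms(1)[OF s s tau_nonneg] by simp
  moreover have "M0 (c (Suc j)) \<le> M0 c0" using step_M0[OF s D(3) D(2) tau_nonneg] Suc by simp
  moreover have "M1 (c (Suc j)) \<le> M1 c0" using step_M1[OF s D(4) D(1) D(2) tau_nonneg] Suc by simp
  ultimately show ?case by (simp add: state_def)
qed (simp add: c0)

lemma euler_state: "state l \<alpha> (c j)" using euler_invariants by blast

lemmas eulerD = stateD[OF euler_state]

lemma euler_small: "2 * \<tau> * (S * (N * M0 (c j))) \<le> 1"
proof -
  have "S * (N * M0 (c j)) \<le> S * (N * M0 c0)"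
    using euler_invariants N by (intro mult_left_mono S_nonneg) auto
  then show ?thesis
    by (rule order_trans[OF mult_left_mono tau(2)]) (use tau in simp)
qed

section \<open>Bounds up to a fixed time, uniform in truncation and step size\<close>

lemma mom_euler_nonneg: "0 \<le> M1 (c j)" "0 \<le> Ml (c j)" "0 \<le> Ms (c j)" "0 \<le> M0 (c j)"
  using eulerD(2) by (auto intro!: mom_nonneg M0_nonneg euler_state)

lemma mom_c0_nonneg: "0 \<le> M1 c0" "0 \<le> Ml c0" "0 \<le> Ms c0" "0 \<le> M0 c0"
  using mom_euler_nonneg[of 0] by simp_all

lemma A_nonneg: "0 \<le> A T" unfolding growth_bound_def using mom_c0_nonneg by simp

lemma W_nonneg: "0 \<le> W T" unfolding weight_bound_def using mom_c0_nonneg by simp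

lemma Ml_step: "Ml (c (Suc j)) \<le> Ml (c j) * (1 + \<tau> * (2 * S * l * M1 c0))"
proof -
  have "Ml (c (Suc j)) \<le> Ml (c j) + \<tau> * (S * l * (M1 (c j) * Ml (c j) + Ml (c j) * M1 (c j)))"
    using step_Ml(2)[OF euler_state eulerD(5) eulerD(1) eulerD(2) tau_nonneg, of j j] by simp
  also have "\<dots> = Ml (c j) + \<tau> * (2 * S * l * Ml (c j)) * M1 (c j)" by (simp add: algebra_simps)
  also have "\<dots> \<le> Ml (c j) + \<tau> * (2 * S * l * Ml (c j)) * M1 c0"
    using euler_invariants[of j] mom_euler_nonneg[of j] tau l
    by (intro add_left_mono mult_left_mono mult_nonneg_nonneg) auto
  finally show ?thesis by (simp add: algebra_simps)
qed

lemma Ml_le: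
  assumes "\<tau> * real j \<le> T"
  shows "Ml (c j) \<le> A T"
proof -
  have B: "0 \<le> 2 * S * l * M1 c0" using mom_c0_nonneg l by simp
  have "Ml (c j) \<le> exp (\<tau> * (2 * S * l * M1 c0) * real j) * Ml (c 0)"
    using Ml_step B tau mom_c0_nonneg by (intro discrete_Gronwall) auto
  also have "\<dots> \<le> A T"
    unfolding growth_bound_def using mult_left_mono[OF assms B] mom_c0_nonneg
    by (intro mult_mono) (auto simp: mult_ac)
  finally show ?thesis .
qed

text \<open>The production of \<open>Ms\<close> involves \<open>Mw\<close> times \<open>Ml\<close>,
  so the two moments are added; replacing \<open>Ml\<close> by its known bound \<open>A T\<close>
  makes the recursion for the sum linear.\<close>

lemma Mw_le:
  assumes j: "\<tau> * real j \<le> T"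
  shows "Mw (c j) \<le> W T"
proof -
  define B where "B = 2 * S * l * M1 c0 + S * A T"
  have B: "0 \<le> B" using mom_c0_nonneg l A_nonneg by (simp add: B_def)
  have "Mw (c (Suc i)) \<le> Mw (c i) * (1 + \<tau> * B)" if "i < j" for i
  proof -
    have "\<tau> * real i \<le> T" using j that tau by (smt (verit) mult_left_mono of_nat_less_iff)
    note Ai = Ml_le[OF this]
    have "Ms (c (Suc i)) \<le> Ms (c i) + \<tau> * (S * (Mw (c i) * Ml (c i)))"
      using step_Ms(2)[OF euler_state euler_state tau_nonneg] by simp
    also have "\<dots> \<le> Ms (c i) + \<tau> * (S * (Mw (c i) * A T))"
      using Ai tau mom_euler_nonneg[of i] by (intro add_left_mono mult_left_mono) auto
    finally have 1: "Ms (c (Suc i)) \<le> Ms (c i) + \<tau> * (S * (Mw (c i) * A T))" .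
    have "Ml (c i) * (\<tau> * (2 * S * l * M1 c0)) \<le> Mw (c i) * (\<tau> * (2 * S * l * M1 c0))"
    proof (rule mult_right_mono)
      show "0 \<le> \<tau> * (2 * S * l * M1 c0)" using mom_c0_nonneg tau l by simp
    qed (use mom_euler_nonneg[of i] in simp)
    then have 2: "Ml (c (Suc i)) \<le> Ml (c i) + Mw (c i) * (\<tau> * (2 * S * l * M1 c0))"
      using Ml_step[of i] unfolding distrib_left mult_1_right by linarith
    have "Mw (c (Suc i)) \<le> (Ms (c i) + \<tau> * (S * (Mw (c i) * A T))) + (Ml (c i) + Mw (c i) * (\<tau> * (2 * S * l * M1 c0)))"
      using 1 2 by (rule add_mono)
    also have "\<dots> = Mw (c i) * (1 + \<tau> * B)" by (simp add: B_def algebra_simps)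
    finally show ?thesis .
  qed
  then have "Mw (c j) \<le> exp (\<tau> * B * real j) * Mw (c 0)"
    using B tau mom_c0_nonneg by (intro discrete_Gronwall) auto
  also have "\<dots> \<le> W T"
    unfolding weight_bound_def using mult_left_mono[OF j B] mom_c0_nonneg
    by (intro mult_mono) (auto simp: mult_ac B_def)
  finally show ?thesis .
qed

section \<open>Lipschitz continuity in time with values in L1\<close>

lemma flux_norm_le:
  "(LINT (x, z)|L2. \<bar>flux k (c j) (c j) x z\<bar>) \<le> S * (Ml (c j))\<^sup>2"
proof -
  note [measurable] = flux_meas[OF euler_state eulerD(1), of j j]
  have i: "integrable L (\<lambda>x. Ml (c j) * (br x powr l * c j x))" using eulerD(5) by simp
  have "(LINT p|L2. \<bar>case_prod (flux k (c j) (c j)) p\<bar>) \<le> (LINT x|L. Ml (c j) * (br x powr l * c j x)) * S"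
  proof (rule product_bound(2)[OF _ i psi_int])
    show "AE (x, z) in L2. \<bar>case (x, z) of (x, z) \<Rightarrow> flux k (c j) (c j) x z\<bar> \<le> Ml (c j) * (br x powr l * c j x) * \<psi> z"
    proof (rule AE_I2, clarify)
      fix x z
      have "gain k (c j) x z \<le> (1 + z\<^sup>2) * gain k (c j) x z"
        using gain_nonneg[OF euler_state, of j x z] by (simp add: distrib_right)
      also note gain_growth[OF euler_state]
      finally have "gain k (c j) x z * c j x \<le> \<psi> z * br x powr l * Ml (c j) * c j x"
        using eulerD(2) by (intro mult_right_mono)
      then show "\<bar>flux k (c j) (c j) x z\<bar> \<le> Ml (c j) * (br x powr l * c j x) * \<psi> z"
        using gain_nonneg[OF euler_state, of j x z] eulerD(2)[of j x] by (simp add: flux_def abs_mult mult_ac)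
    qed
  qed measurable
  also have "(LINT x|L. Ml (c j) * (br x powr l * c j x)) = (Ml (c j))\<^sup>2"
    by (simp add: mom_def power2_eq_square)
  finally show ?thesis by (simp add: case_prod_unfold mult.commute)
qed

lemma euler_time_step:
  assumes "\<tau> * real j \<le> T"
  shows "dist1 (c (Suc j)) (c j) \<le> \<tau> * (4 * S * (A T)\<^sup>2)"
proof -
  have "dist1 (c (Suc j)) (c j) = \<tau> * (LINT x|L. \<bar>dsec (flux k (c j) (c j)) x\<bar>)"
    using tau by (simp add: step_def abs_mult)
  also have "\<dots> \<le> \<tau> * (4 * (S * (Ml (c j))\<^sup>2))"
    using dsec_norm_le[OF flux_integrable[OF euler_state eulerD(3), of j j]] flux_norm_le[of j] tau
    by (intro mult_left_mono) auto
  also have "\<dots> \<le> \<tau> * (4 * (S * (A T)\<^sup>2))"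
    using Ml_le[OF assms] mom_euler_nonneg[of j] tau by (intro mult_left_mono power_mono) auto
  finally show ?thesis by (simp add: mult_ac)
qed

lemma euler_time:
  assumes "i \<le> j" "\<tau> * real j \<le> T"
  shows "dist1 (c j) (c i) \<le> \<tau> * real (j - i) * (4 * S * (A T)\<^sup>2)"
  using assms
proof (induction j rule: dec_induct)
  case (step n)
  have n: "\<tau> * real n \<le> T" using step.prems tau by (smt (verit) mult_left_mono of_nat_Suc)
  have "dist1 (c (Suc n)) (c i) \<le> M0 (\<lambda>x. \<bar>c (Suc n) x - c n x\<bar> + \<bar>c n x - c i x\<bar>)"
    using eulerD(3)[of "Suc n"] eulerD(3)[of n] eulerD(3)[of i]
    by (intro integral_mono L1_intros) linarith+
  also have "\<dots> = dist1 (c (Suc n)) (c n) + dist1 (c n) (c i)"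
    using eulerD(3)[of "Suc n"] eulerD(3)[of n] eulerD(3)[of i] by (intro Bochner_Integration.integral_add integrable_abs Bochner_Integration.integrable_diff)
  also have "\<dots> \<le> \<tau> * (4 * S * (A T)\<^sup>2) + \<tau> * real (n - i) * (4 * S * (A T)\<^sup>2)"
    using euler_time_step[OF n] step.IH[OF n] by (rule add_mono)
  also have "\<dots> = \<tau> * real (Suc n - i) * (4 * S * (A T)\<^sup>2)"
    using step.hyps by (simp add: Suc_diff_le algebra_simps)
  finally show ?case .
qed simp

text \<open>The difference \<open>v\<close> of a translate and the original is propagated by the same linear step, up to
  the flux \<open>R\<close> that comes from the translation of the kernel.\<close>

lemma euler_translation_step:
  assumes h: "0 \<le> h" "h \<le> 1" and j: "\<tau> * real j \<le> T"
  shows "osc (c (Suc j)) h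
    \<le> osc (c j) h + \<tau> * (4 * h * S * M1 c0 * W T)"
proof -
  define b where "b = c j"
  have b: "state l \<alpha> b" unfolding b_def by (rule euler_state)
  note D = stateD[OF b]
  define v where "v x = b (x + h) - b x" for x
  have iv: "integrable L v" unfolding v_def using D(3) integrable_shift_real by auto
  \<comment> \<open>The flux that comes from taking the coefficient at \<open>x + h\<close> instead
    of \<open>x\<close>; the rest of the translated flux has its coefficient at
    \<open>x\<close>.\<close>
  define R where "R x z = (gain k b (x + h) z - gain k b x z) * b (x + h)" for x z
  have m: "(\<lambda>(x, z). (x + h, z)) \<in> measurable L2 L2" by measurable
  have [measurable]: "b \<in> borel_measurable L" by (rule D(1))
  have [measurable]: "(\<lambda>(x, z). gain k b (x + h) z) \<in> borel_measurable L2"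
    using measurable_compose[OF m gain_meas[OF D(1)]] by (simp add: case_prod_unfold)
  have mR: "case_prod R \<in> borel_measurable L2" unfolding R_def by measurable
  have ig: "integrable L (\<lambda>x. h * Mw b * (br (x + h) * b (x + h)))"
    using integrable_shift_real[OF D(4), of h] by simp
  have le: "AE (x, z) in L2. \<bar>case_prod R (x, z)\<bar> \<le> h * Mw b * (br (x + h) * b (x + h)) * \<psi> z"
    using gain_lip[OF b h]
  proof eventually_elim
    case (elim p)
    obtain x z where p: "p = (x, z)" by (cases p)
    from elim have "\<bar>gain k b (x + h) z - gain k b x z\<bar> * b (x + h) \<le> (h * \<psi> z * br (x + h) * Mw b) * b (x + h)"
      unfolding p using D(2) by (intro mult_right_mono) auto
    then show ?case using D(2)[of "x + h"] by (simp add: p R_def abs_mult mult_ac)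
  qed
  note pb = product_bound[OF mR ig psi_int le]
  have iR: "integrable L2 (case_prod R)" by (rule pb(1))
  have nR: "(LINT (x, z)|L2. \<bar>R x z\<bar>) \<le> h * Mw b * M1 b * S"
  proof -
    have "(LINT x|L. br (x + h) * b (x + h)) = M1 b"
      using lborel_integral_real_affine[of 1 "\<lambda>x. br x * b x" h] by (simp add: mom_def add.commute)
    then have "(LINT x|L. h * Mw b * (br (x + h) * b (x + h))) = h * Mw b * M1 b"
      by (subst integral_mult_right_zero) simp
    then show ?thesis using pb(2) by (simp only: case_prod_unfold fst_conv snd_conv)
  qed
  note if1 = flux_integrable[OF b iv] and if2 = flux_integrable[OF b D(3)]
  have shift: "dsec P (x + h) = dsec (\<lambda>x z. P (x + h) z) x" for P x
    unfolding dsec_def by (simp add: algebra_simps)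
  have eq: "(\<lambda>x z. flux k b b (x + h) z) = (\<lambda>x z. (flux k b v x z + flux k b b x z) + R x z)"
    by (auto simp: fun_eq_iff flux_def v_def R_def algebra_simps)
  have i12: "integrable L2 (\<lambda>(x, z). flux k b v x z + flux k b b x z)"
    using Bochner_Integration.integrable_add[OF if1 if2] by (simp add: case_prod_unfold)
  \<comment> \<open>Translation commutes with \<open>dsec\<close>, so the translated flux splits
    into the flux of \<open>v\<close>, the untranslated flux, and \<open>R\<close>.\<close>
  have "AE x in L. dsec (flux k b b) (x + h) = dsec (flux k b v) x + dsec (flux k b b) x + dsec R x"
    unfolding shift eq using dsec_add[OF i12 iR] dsec_add[OF if1 if2] by eventually_elim simp
  then have ae: "AE x in L. c (Suc j) (x + h) - c (Suc j) x = step k \<tau> b v x + \<tau> * dsec R x"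
    by eventually_elim (simp add: step_def b_def[symmetric] v_def algebra_simps)
  have ist: "integrable L (step k \<tau> b v)" by (rule step_integrable[OF b iv])
  have id: "integrable L (dsec R)" by (rule dsec_integrable[OF iR])
  have "osc (c (Suc j)) h \<le> M0 (\<lambda>x. \<bar>step k \<tau> b v x\<bar> + \<tau> * \<bar>dsec R x\<bar>)"
  proof (rule integral_mono_AE)
    show "integrable L (\<lambda>x. \<bar>c (Suc j) (x + h) - c (Suc j) x\<bar>)"
      using eulerD(3)[of "Suc j"] integrable_shift_real[OF eulerD(3)[of "Suc j"], of h]
      by (intro integrable_abs Bochner_Integration.integrable_diff)
    show "integrable L (\<lambda>x. \<bar>step k \<tau> b v x\<bar> + \<tau> * \<bar>dsec R x\<bar>)" using ist id by simp
    show "AE x in L. \<bar>c (Suc j) (x + h) - c (Suc j) x\<bar> \<le> \<bar>step k \<tau> b v x\<bar> + \<tau> * \<bar>dsec R x\<bar>"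
      using ae
    proof eventually_elim
      case (elim x)
      show ?case unfolding elim using abs_triangle_ineq[of "step k \<tau> b v x" "\<tau> * dsec R x"] tau by (simp add: abs_mult)
    qed
  qed
  also have "\<dots> = M0 (\<lambda>x. \<bar>step k \<tau> b v x\<bar>) + \<tau> * (LINT x|L. \<bar>dsec R x\<bar>)"
    using ist id by simp
  also have "\<dots> \<le> M0 (\<lambda>x. \<bar>v x\<bar>) + \<tau> * (4 * (h * W T * M1 c0 * S))"
  proof (intro add_mono mult_left_mono)
    show "M0 (\<lambda>x. \<bar>step k \<tau> b v x\<bar>) \<le> M0 (\<lambda>x. \<bar>v x\<bar>)"
      using step_L1_contraction[OF b iv tau_nonneg] euler_small[of j] by (simp add: b_def)
    have "(LINT x|L. \<bar>dsec R x\<bar>) \<le> 4 * (LINT (x, z)|L2. \<bar>R x z\<bar>)" by (rule dsec_norm_le[OF iR])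
    also have "\<dots> \<le> 4 * (h * Mw b * M1 b * S)" using nR by simp
    also have "\<dots> \<le> 4 * (h * W T * M1 c0 * S)"
      using Mw_le[OF j] euler_invariants[of j] mom_euler_nonneg[of j] h W_nonneg[of T] unfolding b_def
      by (intro mult_left_mono mult_right_mono mult_mono) auto
    finally show "(LINT x|L. \<bar>dsec R x\<bar>) \<le> 4 * (h * W T * M1 c0 * S)" .
  qed (use tau in simp)
  finally show ?thesis by (simp add: v_def b_def mult_ac)
qed

lemma euler_translation:
  assumes h: "0 \<le> h" "h \<le> 1" and j: "\<tau> * real j \<le> T"
  shows "osc (c j) h
    \<le> osc c0 h + \<tau> * real j * (4 * h * S * M1 c0 * W T)"
  using j
proof (induction j)
  case (Suc j)
  have j: "\<tau> * real j \<le> T" using Suc.prems tau by (smt (verit) mult_left_mono of_nat_Suc)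
  show ?case using euler_translation_step[OF h j] Suc.IH[OF j] by (simp add: algebra_simps)
qed simp

text \<open>Since the step is linear in its last argument, the two parts of the initial datum can be evolved
  separately, with the coefficients frozen along the full solution.\<close>

lemma euler_split:
  assumes c0_split: "\<And>x. c0 x = u0 x + v0 x" "\<And>x. 0 \<le> u0 x" "\<And>x. 0 \<le> v0 x"
      "integrable L (\<lambda>x. br x powr 3 * u0 x)" "integrable L (\<lambda>x. br x powr l * v0 x)"
      "u0 \<in> borel_measurable L" "v0 \<in> borel_measurable L"
    and j: "\<tau> * real j \<le> T"
  shows "\<exists>u v. (AE x in L. c j x = u x + v x) \<and> (\<forall>x. 0 \<le> u x) \<and> (\<forall>x. 0 \<le> v x) \<and>
     integrable L (\<lambda>x. br x powr 3 * u x) \<and> integrable L (\<lambda>x. br x powr l * v x) \<and>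
     u \<in> borel_measurable L \<and> v \<in> borel_measurable L \<and>
     mom (\<lambda>x. br x powr 3) u \<le> exp (6 * S * A T * (\<tau> * real j)) * mom (\<lambda>x. br x powr 3) u0 \<and>
     Ml v \<le> exp (2 * S * l * A T * (\<tau> * real j)) * Ml v0"
  using j
proof (induction j)
  case 0
  show ?case using c0_split by (intro exI[of _ u0] exI[of _ v0]) auto
next
  case (Suc j)
  have j: "\<tau> * real j \<le> T" using Suc.prems tau by (smt (verit) mult_left_mono of_nat_Suc)
  from Suc.IH[OF j] obtain u v where uv: "AE x in L. c j x = u x + v x" and pos: "\<And>x. 0 \<le> u x" "\<And>x. 0 \<le> v x"
    and i: "integrable L (\<lambda>x. br x powr 3 * u x)" "integrable L (\<lambda>x. br x powr l * v x)"
    and m [measurable]: "u \<in> borel_measurable L" "v \<in> borel_measurable L"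
    and bu: "mom (\<lambda>x. br x powr 3) u \<le> exp (6 * S * A T * (\<tau> * real j)) * mom (\<lambda>x. br x powr 3) u0"
    and bv: "Ml v \<le> exp (2 * S * l * A T * (\<tau> * real j)) * Ml v0" by blast
  let ?b = "c j" and ?u = "step k \<tau> (c j) u" and ?v = "step k \<tau> (c j) v"
  have iu: "integrable L u" "integrable L v"
  proof -
    have "integrable L (\<lambda>x. 1 * u x)"
      using br_ge_1 by (intro integrable_lower_weight[OF i(1)] m) (auto intro!: ge_one_powr_ge_zero)
    then show "integrable L u" by simp
    have "integrable L (\<lambda>x. 1 * v x)"
      using br_ge_1 l by (intro integrable_lower_weight[OF i(2)] m) (auto intro!: ge_one_powr_ge_zero)
    then show "integrable L v" by simp
  qed
  have bl: "br x \<le> br x powr l" for x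
    using l br_le_powr[of l x] by simp
  have i1: "integrable L (\<lambda>x. br x * v x)"
    using bl by (intro integrable_lower_weight[OF i(2)] m) auto
  have M1v: "M1 v \<le> Ml v"
    unfolding mom_def using bl pos by (intro integral_mono i i1 mult_right_mono) auto
  have nn: "0 \<le> M1 v" "0 \<le> Ml v" "0 \<le> mom (\<lambda>x. br x powr 3) u"
    using pos by (auto intro!: mom_nonneg)
  have ex: "a * (1 + \<tau> * B) \<le> exp (B * (\<tau> * real (Suc j))) * a0"
    if "a \<le> exp (B * (\<tau> * real j)) * a0" "0 \<le> B" "0 \<le> a" for a a0 B
  proof -
    have "a * (1 + \<tau> * B) \<le> a * exp (\<tau> * B)"
      using that by (intro mult_left_mono exp_ge_add_one_self) auto
    also have "\<dots> \<le> (exp (B * (\<tau> * real j)) * a0) * exp (\<tau> * B)" using that by (intro mult_right_mono) auto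
    also have "\<dots> = exp (B * (\<tau> * real (Suc j))) * a0" by (simp add: distrib_left exp_add mult_ac)
    finally show ?thesis .
  qed
  note sm = euler_small[of j]
  have "AE x in L. c (Suc j) x = ?u x + ?v x"
    using step_add[OF euler_state eulerD(3) iu uv] by simp
  moreover have "\<forall>x. 0 \<le> ?u x" "\<forall>x. 0 \<le> ?v x"
    using step_nonneg[OF euler_state _ tau_nonneg sm] pos by auto
  moreover note step_M3(1)[OF euler_state i(1) m(1) pos(1) tau_nonneg] step_Ml(1)[OF euler_state i(2) m(2) pos(2) tau_nonneg]
    step_meas[OF euler_state m(1)] step_meas[OF euler_state m(2)]
  moreover have "mom (\<lambda>x. br x powr 3) ?u \<le> exp (6 * S * A T * (\<tau> * real (Suc j))) * mom (\<lambda>x. br x powr 3) u0"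
  proof -
    have "mom (\<lambda>x. br x powr 3) ?u \<le> mom (\<lambda>x. br x powr 3) u * (1 + \<tau> * (6 * S * Ml ?b))"
      by (rule step_M3(2)[OF euler_state i(1) m(1) pos(1) tau_nonneg])
    also have "\<dots> \<le> mom (\<lambda>x. br x powr 3) u * (1 + \<tau> * (6 * S * A T))"
      using Ml_le[OF j] nn tau by (intro mult_left_mono add_left_mono) auto
    also have "\<dots> \<le> exp (6 * S * A T * (\<tau> * real (Suc j))) * mom (\<lambda>x. br x powr 3) u0"
      using bu nn A_nonneg by (intro ex) auto
    finally show ?thesis .
  qed
  moreover have "Ml ?v \<le> exp (2 * S * l * A T * (\<tau> * real (Suc j))) * Ml v0"
  proof -
    have "Ml ?v \<le> Ml v + \<tau> * (S * l * (M1 ?b * Ml v + Ml ?b * M1 v))"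
      by (rule step_Ml(2)[OF euler_state i(2) m(2) pos(2) tau_nonneg])
    \<comment> \<open>Both moments of the coefficient are bounded by \<open>A T\<close>, and
      \<open>M1 v\<close> by \<open>Ml v\<close>. The inequality is then homogeneous in
      \<open>v\<close>: a small part of the datum stays small.\<close>
    also have "\<dots> \<le> Ml v + \<tau> * (S * l * (A T * Ml v + A T * Ml v))"
      using Ml_le[OF j] M1_le_Ml[OF euler_state, of j] nn M1v tau l mom_euler_nonneg[of j] A_nonneg[of T]
      by (intro add_left_mono mult_left_mono add_mono mult_mono) auto
    also have "\<dots> = Ml v * (1 + \<tau> * (2 * S * l * A T))" by (simp add: algebra_simps)
    also have "\<dots> \<le> exp (2 * S * l * A T * (\<tau> * real (Suc j))) * Ml v0"
      using bv nn A_nonneg l by (intro ex) auto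
    finally show ?thesis .
  qed
  ultimately show ?case by blast
qed

text \<open>Where \<open>br x \<ge> R'\<close>, the weight \<open>br x powr l\<close> is at most
  \<open>br x powr 3 / R'\<close>, as \<open>l \<le> 2\<close>. This handles the part with a third
  moment; the other part is counted in full. The two radii are independent: \<open>R\<close> makes
  the second term small, and afterwards \<open>R'\<close> the first.\<close>

lemma euler_tail:
  assumes j: "\<tau> * real j \<le> T" and R: "0 \<le> R" and R': "0 < R'"
  shows "(tail_mom l R' (c j))
    \<le> exp (6 * S * A T * T) * mom (\<lambda>x. br x powr 3) (\<lambda>x. indicator {-R..R} x * c0 x) / R'
      + exp (2 * S * l * A T * T) * Ml (\<lambda>x. indicator (- {-R..R}) x * c0 x)"
proof -
  let ?u0 = "\<lambda>x. indicator {-R..R} x * c0 x" and ?v0 = "\<lambda>x. indicator (- {-R..R}) x * c0 x"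
  have [measurable]: "c0 \<in> borel_measurable L" by (rule stateD(1)[OF c0])
  have 1: "c0 x = ?u0 x + ?v0 x" for x by (simp add: indicator_def)
  have 2: "0 \<le> ?u0 x" "0 \<le> ?v0 x" for x using stateD(2)[OF c0] by auto
  have 3: "integrable L (\<lambda>x. br x powr 3 * ?u0 x)"
  proof -
    have "integrable L (\<lambda>x. (br x powr 3 * indicator {-R..R} x) * c0 x)"
    proof (rule integrable_bounded_mult[OF _ _ stateD(3)[OF c0]])
      show "\<bar>br x powr 3 * indicator {-R..R} x\<bar> \<le> br R powr 3" for x
        using R by (auto simp: indicator_def br_def intro!: power_mono)
    qed measurable
    then show ?thesis by (simp add: mult.assoc)
  qed
  have 4: "integrable L (\<lambda>x. br x powr l * ?v0 x)"
    using integrable_mult_indicator[OF _ stateD(5)[OF c0], of "- {-R..R}"] by (simp add: mult_ac)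
  obtain u v where uv: "AE x in L. c j x = u x + v x" and pos: "\<And>x. 0 \<le> u x" "\<And>x. 0 \<le> v x"
    and i: "integrable L (\<lambda>x. br x powr 3 * u x)" "integrable L (\<lambda>x. br x powr l * v x)"
    and m [measurable]: "u \<in> borel_measurable L" "v \<in> borel_measurable L"
    and bu: "mom (\<lambda>x. br x powr 3) u \<le> exp (6 * S * A T * (\<tau> * real j)) * mom (\<lambda>x. br x powr 3) ?u0"
    and bv: "Ml v \<le> exp (2 * S * l * A T * (\<tau> * real j)) * Ml ?v0"
    using euler_split[OF 1 2 3 4 _ _ j] by fastforce
  have "(tail_mom l R' (c j))
     \<le> (LINT x|L. (br x powr 3 * u x) / R' + br x powr l * v x)"
  proof (rule integral_mono_AE)
    show "integrable L (\<lambda>x. indicator {x. R' \<le> br x} x * (br x powr l * c j x))"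
      using integrable_mult_indicator[OF _ eulerD(5)[of j], of "{x. R' \<le> br x}"] by simp
    show "integrable L (\<lambda>x. (br x powr 3 * u x) / R' + br x powr l * v x)" using i by simp
    show "AE x in L. indicator {x. R' \<le> br x} x * (br x powr l * c j x) \<le> (br x powr 3 * u x) / R' + br x powr l * v x"
      using uv
    proof eventually_elim
      case (elim x)
      show ?case
      proof (cases "R' \<le> br x")
        case True
        have "br x powr l * R' \<le> br x powr 2 * br x"
          using True l br_ge_1[of x] R' by (intro mult_mono powr_mono) auto
        also have "\<dots> = br x powr 3" using br_ge_1[of x] by (simp add: power2_eq_square power3_eq_cube)
        finally have "br x powr l * R' * u x \<le> br x powr 3 * u x" using pos(1) by (rule mult_right_mono)
        then have "br x powr l * u x \<le> (br x powr 3 * u x) / R'"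
          using R' by (simp add: pos_le_divide_eq mult_ac)
        then show ?thesis using True by (simp add: elim distrib_left)
      next
        case False
        then show ?thesis using pos R' by simp
      qed
    qed
  qed
  also have "\<dots> = mom (\<lambda>x. br x powr 3) u / R' + Ml v" using i by (simp add: mom_def)
  also have "\<dots> \<le> exp (6 * S * A T * T) * mom (\<lambda>x. br x powr 3) ?u0 / R' + exp (2 * S * l * A T * T) * Ml ?v0"
  proof (intro add_mono divide_right_mono)
    have "0 \<le> mom (\<lambda>x. br x powr 3) ?u0" "0 \<le> Ml ?v0" using 2 by (auto intro!: mom_nonneg)
    moreover have "6 * S * A T * (\<tau> * real j) \<le> 6 * S * A T * T" "2 * S * l * A T * (\<tau> * real j) \<le> 2 * S * l * A T * T"
      using j A_nonneg[of T] l by (auto intro!: mult_left_mono)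
    ultimately have "exp (6 * S * A T * (\<tau> * real j)) * mom (\<lambda>x. br x powr 3) ?u0 \<le> exp (6 * S * A T * T) * mom (\<lambda>x. br x powr 3) ?u0"
        "exp (2 * S * l * A T * (\<tau> * real j)) * Ml ?v0 \<le> exp (2 * S * l * A T * T) * Ml ?v0"
      by (auto intro!: mult_right_mono)
    then show "mom (\<lambda>x. br x powr 3) u \<le> exp (6 * S * A T * T) * mom (\<lambda>x. br x powr 3) ?u0"
        "Ml v \<le> exp (2 * S * l * A T * T) * Ml ?v0" using bu bv by linarith+
  qed (use R' in simp)
  finally show ?thesis .
qed

end

section \<open>Passage to the limit\<close>

lemma translation_continuous_open:
  fixes U :: "real set"
  assumes U: "open U" "emeasure L U < \<infinity>"
  shows "((\<lambda>h. LINT x|L. \<bar>indicator U (x + h) - indicator U x :: real\<bar>) \<longlongrightarrow> 0) (at 0)"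
proof -
  have [measurable]: "U \<in> sets borel" using U by auto
  have i: "integrable L (indicator U :: real \<Rightarrow> real)" using U by (intro integrable_real_indicator) auto
  note ih = integrable_shift_real[OF i]
  have ip: "integrable L (\<lambda>x. indicator U x * indicator U (x + h) :: real)" for h
    using integrable_mult_indicator[OF _ ih, of U h] by simp
  \<comment> \<open>For indicators the modulus of the difference is the sum minus twice the product.
    Translation invariance removes \<open>h\<close> from the sum, and openness of \<open>U\<close>
    makes the product converge pointwise.\<close>
  have eq: "(LINT x|L. \<bar>indicator U (x + h) - indicator U x :: real\<bar>)
      = 2 * (LINT x|L. indicator U x) - 2 * (LINT x|L. indicator U x * indicator U (x + h))" for h
  proof -
    have "(LINT x|L. \<bar>indicator U (x + h) - indicator U x :: real\<bar>)
        = (LINT x|L. (indicator U (x + h) + indicator U x) - 2 * (indicator U x * indicator U (x + h)))"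
      by (intro Bochner_Integration.integral_cong) (auto simp: indicator_def)
    also have "\<dots> = ((LINT x|L. indicator U (x + h)) + (LINT x|L. indicator U x)) - 2 * (LINT x|L. indicator U x * indicator U (x + h))"
      using i ih[of h] ip[of h]
      by (subst Bochner_Integration.integral_diff) (auto simp del: integral_indicator)
    also have "(LINT x|L. indicator U (x + h)) = (LINT x|L. indicator U x :: real)"
      by (rule integral_shift_real)
    finally show ?thesis by simp
  qed
  have lim: "((\<lambda>h. LINT x|L. indicator U x * indicator U (x + h)) \<longlongrightarrow> (LINT x|L. indicator U x :: real)) (at 0)"
    unfolding tendsto_at_iff_sequentially
  proof (intro allI impI)
    fix X :: "nat \<Rightarrow> real"
    assume X: "\<forall>i. X i \<in> UNIV - {0}" "X \<longlonglongrightarrow> 0"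
    have "(\<lambda>i. LINT x|L. indicator U x * indicator U (x + X i)) \<longlonglongrightarrow> (LINT x|L. indicator U x :: real)"
    proof (rule integral_dominated_convergence[where w="indicator U"])
      show "AE x in L. (\<lambda>i. indicator U x * indicator U (x + X i)) \<longlonglongrightarrow> (indicator U x :: real)"
      proof (rule AE_I2)
        fix x :: real
        show "(\<lambda>i. indicator U x * indicator U (x + X i)) \<longlonglongrightarrow> (indicator U x :: real)"
        proof (cases "x \<in> U")
          case True
          have "(\<lambda>i. x + X i) \<longlonglongrightarrow> x" using tendsto_add[OF tendsto_const X(2), of x] by simp
          then have "eventually (\<lambda>i. x + X i \<in> U) sequentially"
            using U(1) True by (auto simp: tendsto_def)
          then show ?thesis
            using True by (intro tendsto_eventually) (auto elim!: eventually_mono)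
        qed simp
      qed
    qed (use i in \<open>auto simp: indicator_def\<close>)
    then show "((\<lambda>h. LINT x|L. indicator U x * indicator U (x + h)) \<circ> X) \<longlonglongrightarrow> (LINT x|L. indicator U x :: real)"
      by (simp add: o_def)
  qed
  show ?thesis
    unfolding eq using tendsto_diff[OF tendsto_const tendsto_mult_left[OF lim, of 2], of "2 * (LINT x|L. indicator U x)"] by simp
qed

text \<open>The functions with this property form a closed subset of L1, since \<open>osc\<close>
  changes by at most twice the L1 distance.\<close>

lemma translation_continuous_approx:
  fixes f :: "real \<Rightarrow> real"
  assumes f: "integrable L f"
    and approx: "\<And>e. e > 0 \<Longrightarrow> \<exists>g. integrable L g \<and> (dist1 f g) < e \<and>
        ((\<lambda>h. LINT x|L. \<bar>g (x + h) - g x\<bar>) \<longlongrightarrow> 0) (at 0)"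
  shows "((\<lambda>h. LINT x|L. \<bar>f (x + h) - f x\<bar>) \<longlongrightarrow> 0) (at 0)"
proof (rule tendstoI)
  fix e :: real assume e: "e > 0"
  then obtain g where g: "integrable L g" "(dist1 f g) < e/3"
      "((\<lambda>h. LINT x|L. \<bar>g (x + h) - g x\<bar>) \<longlongrightarrow> 0) (at 0)"
    using approx[of "e/3"] by auto
  have le: "(osc f h) \<le> 2 * (dist1 f g) + (osc g h)" for h
  proof -
    note ifs = f g(1) integrable_shift_real[OF f, of h] integrable_shift_real[OF g(1), of h]
    have "(osc f h) \<le> (LINT x|L. (\<bar>f (x + h) - g (x + h)\<bar> + \<bar>f x - g x\<bar>) + \<bar>g (x + h) - g x\<bar>)"
      using ifs by (intro integral_mono L1_intros) auto
    also have "\<dots> = (LINT x|L. \<bar>f (x + h) - g (x + h)\<bar>) + (dist1 f g) + (osc g h)"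
      using ifs by simp
    also have "(LINT x|L. \<bar>f (x + h) - g (x + h)\<bar>) = (dist1 f g)"
      by (rule integral_shift_real[of "\<lambda>x. \<bar>f x - g x\<bar>"])
    finally show ?thesis by simp
  qed
  have "eventually (\<lambda>h. (osc g h) < e/3) (at 0)"
    using order_tendstoD(2)[OF g(3), of "e/3"] e by simp
  then show "eventually (\<lambda>h. dist (osc f h) 0 < e) (at 0)"
  proof eventually_elim
    case (elim h)
    then show ?case using le[of h] g(2) by (simp add: dist_real_def)
  qed
qed

lemma translation_continuous:
  fixes f :: "real \<Rightarrow> real"
  assumes "integrable L f"
  shows "((\<lambda>h. LINT x|L. \<bar>f (x + h) - f x\<bar>) \<longlongrightarrow> 0) (at 0)"
  using assms
proof (induction f rule: integrable_induct)
  case (base A c)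
  have A [measurable]: "A \<in> sets borel" using base by simp
  have iA: "integrable L (indicator A :: real \<Rightarrow> real)" using base by (intro integrable_real_indicator) auto
  have "((\<lambda>h. LINT x|L. \<bar>indicator A (x + h) - indicator A x :: real\<bar>) \<longlongrightarrow> 0) (at 0)"
  proof (rule translation_continuous_approx[OF iA])
    fix e :: real assume "e > 0"
    \<comment> \<open>Outer regularity replaces a measurable set by an open one at small cost in
      L1.\<close>
    then obtain U where U: "open U" "A \<subseteq> U" "emeasure L (U - A) < e"
      using outer_regular_lborel[OF A] by blast
    have [measurable]: "U \<in> sets borel" using U by auto
    have "emeasure L U = emeasure L A + emeasure L (U - A)"
      using U(2) by (subst plus_emeasure) (auto intro!: arg_cong[where f="emeasure L"])
    also have "\<dots> < \<infinity>" using base U(3) by (auto intro: less_le_trans simp: less_top[symmetric])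
    finally have fin: "emeasure L U < \<infinity>" .
    then have iU: "integrable L (indicator U :: real \<Rightarrow> real)" by (intro integrable_real_indicator) auto
    have "(LINT x|L. \<bar>indicator A x - indicator U x :: real\<bar>) = (LINT x|L. indicator (U - A) x)"
      using U(2) by (intro Bochner_Integration.integral_cong) (auto simp: indicator_def)
    also have "\<dots> = measure L (U - A)" by simp
    also have "\<dots> < e" using U(3) \<open>e > 0\<close>
      by (metis emeasure_eq_ennreal_measure ennreal_less_iff measure_nonneg order_less_imp_not_eq2 top.not_eq_extremum ennreal_less_top order.strict_trans)
    finally show "\<exists>g. integrable L g \<and> (dist1 (indicator A) g) < e \<and> ((\<lambda>h. LINT x|L. \<bar>g (x + h) - g x\<bar>) \<longlongrightarrow> 0) (at 0)"
      using iU translation_continuous_open[OF U(1) fin] by blast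
  qed
  from tendsto_mult_left[OF this, of "\<bar>c\<bar>"]
  have "((\<lambda>h. LINT x|L. \<bar>c\<bar> * \<bar>indicator A (x + h) - indicator A x :: real\<bar>) \<longlongrightarrow> 0) (at 0)" by simp
  moreover have "\<bar>c\<bar> * \<bar>indicator A (x + h) - indicator A x :: real\<bar> = \<bar>indicator A (x + h) *\<^sub>R c - indicator A x *\<^sub>R c\<bar>" for x h
    by (simp add: abs_mult[symmetric] algebra_simps)
  ultimately show ?case by simp
next
  case (add f g)
  have "((\<lambda>h. (osc f h) + (osc g h)) \<longlongrightarrow> 0) (at 0)"
    using tendsto_add[OF add.IH] by simp
  then show ?case
  proof (rule Lim_null_comparison[rotated], intro always_eventually allI)
    fix h
    have "(LINT x|L. \<bar>f (x + h) + g (x + h) - (f x + g x)\<bar>) \<le> (osc f h) + (osc g h)"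
  proof -
    note ifs = add.hyps integrable_shift_real[OF add.hyps(1), of h] integrable_shift_real[OF add.hyps(2), of h]
    have "(LINT x|L. \<bar>f (x + h) + g (x + h) - (f x + g x)\<bar>) \<le> (LINT x|L. \<bar>f (x + h) - f x\<bar> + \<bar>g (x + h) - g x\<bar>)"
      using ifs by (intro integral_mono L1_intros) auto
    then show ?thesis using ifs by simp
  qed
    then show "norm (LINT x|L. \<bar>f (x + h) + g (x + h) - (f x + g x)\<bar>) \<le> (osc f h) + (osc g h)"
      by simp
  qed
next
  case (lim f s)
  have "(\<lambda>i. LINT x|L. \<bar>f x - s i x\<bar>) \<longlonglongrightarrow> (LINT x|L. 0)"
  \<comment> \<open>The approximants of \<open>integrable_induct\<close> are at most
    \<open>2 * \<bar>f x\<bar>\<close> in modulus, hence the factor 3.\<close>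
  proof (rule integral_dominated_convergence[where w="\<lambda>x. 3 * \<bar>f x\<bar>"])
    show "AE x in L. (\<lambda>i. \<bar>f x - s i x\<bar>) \<longlonglongrightarrow> 0"
    proof (rule AE_I2)
      fix x :: real
      have "(\<lambda>i. s i x) \<longlonglongrightarrow> f x" using lim.hyps(2) by simp
      from tendsto_rabs[OF tendsto_diff[OF tendsto_const[of "f x"] this]]
      show "(\<lambda>i. \<bar>f x - s i x\<bar>) \<longlonglongrightarrow> 0" by simp
    qed
    show "AE x in L. norm \<bar>f x - s i x\<bar> \<le> 3 * \<bar>f x\<bar>" for i
    proof (rule AE_I2)
      fix x
      have "\<bar>s i x\<bar> \<le> 2 * \<bar>f x\<bar>" using lim.hyps(3)[of x i] by simp
      then show "norm \<bar>f x - s i x\<bar> \<le> 3 * \<bar>f x\<bar>" by simp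
    qed
  qed (use lim.hyps(1,4) in auto)
  then have l: "(\<lambda>i. LINT x|L. \<bar>f x - s i x\<bar>) \<longlonglongrightarrow> 0" by simp
  show ?case
  proof (rule translation_continuous_approx[OF lim.hyps(4)])
    fix e :: real assume "e > 0"
    from order_tendstoD(2)[OF l this] obtain i where "(dist1 f (s i)) < e"
      by (auto simp: eventually_sequentially)
    then show "\<exists>g. integrable L g \<and> (dist1 f g) < e \<and> ((\<lambda>h. LINT x|L. \<bar>g (x + h) - g x\<bar>) \<longlongrightarrow> 0) (at 0)"
      using lim.hyps(1) lim.IH by blast
  qed
qed

section \<open>Integrals over three variables\<close>

lemma triple_product:
  fixes g h s :: "real \<Rightarrow> real"
  assumes "integrable L g" "integrable L h" "integrable L s"
  shows "integrable L3 (\<lambda>(x, y, z). g x * h y * s z)"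
    and "(LINT (x, y, z)|L3. g x * h y * s z) = (LINT x|L. g x) * (LINT y|L. h y) * (LINT z|L. s z)"
proof -
  have [measurable]: "g \<in> borel_measurable L" "h \<in> borel_measurable L" "s \<in> borel_measurable L" using assms by auto
  have i2: "integrable L2 (\<lambda>(y, z). h y * s z)"
    by (rule product_bound(1)[where g="\<lambda>y. \<bar>h y\<bar>" and s="\<lambda>z. \<bar>s z\<bar>"]) (use assms in \<open>auto simp: abs_mult\<close>)
  have e2: "(LINT (y, z)|L2. h y * s z) = (LINT y|L. h y) * (LINT z|L. s z)"
    using lborel_pair.integral_fst'[OF i2] by (simp add: assms)
  have i2': "integrable L2 (\<lambda>q. g x * (case q of (y, z) \<Rightarrow> h y * s z))" for x
    using i2 by simp
  show i3: "integrable L3 (\<lambda>(x, y, z). g x * h y * s z)"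
  proof (rule lborel3.Fubini_integrable)
    show "(\<lambda>(x, y, z). g x * h y * s z) \<in> borel_measurable L3" by measurable
    have *: "norm (case (x, q) of (x, y, z) \<Rightarrow> g x * h y * s z) = \<bar>g x\<bar> * norm (case q of (y, z) \<Rightarrow> h y * s z)" for x q
      by (simp add: abs_mult split: prod.split)
    show "integrable L (\<lambda>x. LINT q|L2. norm (case (x, q) of (x, y, z) \<Rightarrow> g x * h y * s z))"
      unfolding * using assms(1) by simp
    show "AE x in L. integrable L2 (\<lambda>q. case (x, q) of (x, y, z) \<Rightarrow> g x * h y * s z)"
      using i2' by (intro AE_I2) (simp add: case_prod_unfold mult.assoc)
  qed
  show "(LINT (x, y, z)|L3. g x * h y * s z) = (LINT x|L. g x) * (LINT y|L. h y) * (LINT z|L. s z)"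
    unfolding lborel3.integral_fst'[OF i3, symmetric] using e2
    by (simp add: case_prod_unfold mult.assoc)
qed

lemma triple_bound:
  fixes F :: "real \<times> real \<times> real \<Rightarrow> real"
  assumes F: "F \<in> borel_measurable L3"
    and ghs: "integrable L g" "integrable L h" "integrable L s"
    and le: "\<And>x y z. \<bar>F (x, y, z)\<bar> \<le> g x * h y * s z"
  shows "integrable L3 F" and "(LINT p|L3. \<bar>F p\<bar>) \<le> (LINT x|L. g x) * (LINT y|L. h y) * (LINT z|L. s z)"
proof -
  note t = triple_product[OF ghs]
  show i: "integrable L3 F"
  proof (rule Bochner_Integration.integrable_bound[OF t(1) F], rule AE_I2)
    fix p show "norm (F p) \<le> norm (case p of (x, y, z) \<Rightarrow> g x * h y * s z)"
      by (cases p) (auto intro: order_trans[OF le abs_ge_self])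
  qed
  have "(LINT p|L3. \<bar>F p\<bar>) \<le> (LINT (x, y, z)|L3. g x * h y * s z)"
    using i t(1) le by (intro integral_mono) auto
  then show "(LINT p|L3. \<bar>F p\<bar>) \<le> (LINT x|L. g x) * (LINT y|L. h y) * (LINT z|L. s z)" by (simp only: t(2))
qed

section \<open>The weak form of the exchange operator\<close>

context kernel begin

text \<open>The domain of integration is the whole space because \<open>k_supp\<close> already
  confines the rate to \<open>Dset\<close>.\<close>

definition coll :: "(real \<Rightarrow> real) \<Rightarrow> (real \<Rightarrow> real) \<Rightarrow> real" where
  "coll u f = (LINT (x, y, z)|L3. Delta z f x * (k x y z * u x * u y))"

lemma rate_meas:
  assumes [measurable]: "u \<in> borel_measurable L"
  shows "(\<lambda>(x, y, z). k x y z * u x * u y) \<in> borel_measurable L3"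
  using k_meas by (simp add: case_prod_unfold)

lemma rate_le:
  assumes u: "\<And>x. 0 \<le> u x"
  shows "k x y z * u x * u y \<le> (br x powr l * u x) * (br y powr l * u y) * \<psi> z"
proof -
  have "k x y z * (u x * u y) \<le> (\<psi> z * br x powr l * br y powr l) * (u x * u y)"
    using k_le u by (intro mult_right_mono) auto
  then show ?thesis by (simp add: mult_ac)
qed

lemma rate_integrable:
  assumes u: "state l \<alpha> u"
  shows "integrable L3 (\<lambda>(x, y, z). k x y z * u x * u y)"
    and "(LINT (x, y, z)|L3. k x y z * u x * u y) \<le> S * (Ml u)\<^sup>2"
proof -
  note D = stateD[OF u]
  have le: "\<bar>case (x, y, z) of (x, y, z) \<Rightarrow> k x y z * u x * u y\<bar> \<le> (br x powr l * u x) * (br y powr l * u y) * \<psi> z" for x y z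
    using rate_le[of u x y z, OF D(2)] k_nonneg[of x y z] D(2)[of x] D(2)[of y] by simp
  note t = triple_bound[OF rate_meas[OF D(1)] D(5) D(5) psi_int le]
  show i: "integrable L3 (\<lambda>(x, y, z). k x y z * u x * u y)" by (rule t(1))
  have "(LINT p|L3. (case p of (x, y, z) \<Rightarrow> k x y z * u x * u y)) \<le> (LINT p|L3. \<bar>case p of (x, y, z) \<Rightarrow> k x y z * u x * u y\<bar>)"
    using i by (intro integral_mono) auto
  also note t(2)
  finally show "(LINT (x, y, z)|L3. k x y z * u x * u y) \<le> S * (Ml u)\<^sup>2"
    by (simp add: mom_def power2_eq_square mult_ac)
qed

lemma Delta_meas:
  assumes [measurable]: "f \<in> borel_measurable L"
  shows "(\<lambda>(x, y, z). Delta z f x) \<in> borel_measurable L3" "(\<lambda>(x, z). Delta z f x) \<in> borel_measurable L2"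
  unfolding Delta_def by measurable

lemma Delta_abs_le:
  assumes "\<And>x. \<bar>f x\<bar> \<le> B"
  shows "\<bar>Delta z f x\<bar> \<le> 4 * B"
  using assms[of "x + z"] assms[of x] assms[of "x - z"] unfolding Delta_def by linarith

lemma coll_integrable:
  assumes u: "state l \<alpha> u" and f: "f \<in> borel_measurable L" "\<And>x. \<bar>f x\<bar> \<le> B"
  shows "integrable L3 (\<lambda>(x, y, z). Delta z f x * (k x y z * u x * u y))"
proof -
  have "integrable L3 (\<lambda>p. (case p of (x, y, z) \<Rightarrow> Delta z f x) * (case p of (x, y, z) \<Rightarrow> k x y z * u x * u y))"
    using Delta_abs_le[of f B, OF f(2)]
    by (intro integrable_bounded_mult[OF Delta_meas(1)[OF f(1)], of "4 * B"] rate_integrable[OF u]) (auto split: prod.split)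
  then show ?thesis by (simp add: case_prod_unfold)
qed

lemma coll_abs_le:
  assumes u: "state l \<alpha> u" and f: "f \<in> borel_measurable L" "\<And>x. \<bar>f x\<bar> \<le> B"
  shows "\<bar>coll u f\<bar> \<le> 4 * B * (S * (Ml u)\<^sup>2)"
proof -
  have B: "0 \<le> B" using f(2)[of 0] by simp
  have "\<bar>coll u f\<bar> \<le> (LINT p|L3. \<bar>case p of (x, y, z) \<Rightarrow> Delta z f x * (k x y z * u x * u y)\<bar>)"
    unfolding coll_def by (rule integral_abs_bound)
  also have "\<dots> \<le> (LINT p|L3. 4 * B * (case p of (x, y, z) \<Rightarrow> k x y z * u x * u y))"
  proof (rule integral_mono)
    show "integrable L3 (\<lambda>p. \<bar>case p of (x, y, z) \<Rightarrow> Delta z f x * (k x y z * u x * u y)\<bar>)"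
      using coll_integrable[OF u f] by simp
    show "integrable L3 (\<lambda>p. 4 * B * (case p of (x, y, z) \<Rightarrow> k x y z * u x * u y))"
      using rate_integrable[OF u] by simp
    fix p :: "real \<times> real \<times> real"
    obtain x y z where p: "p = (x, y, z)" by (cases p)
    show "\<bar>case p of (x, y, z) \<Rightarrow> Delta z f x * (k x y z * u x * u y)\<bar> \<le> 4 * B * (case p of (x, y, z) \<Rightarrow> k x y z * u x * u y)"
      using Delta_abs_le[of f B, OF f(2)] k_nonneg[of x y z] stateD(2)[OF u]
      by (auto simp: p abs_mult intro!: mult_right_mono)
  qed
  also have "\<dots> \<le> 4 * B * (S * (Ml u)\<^sup>2)"
    using rate_integrable(2)[OF u] B by (simp add: mult_left_mono)
  finally show ?thesis .
qed

text \<open>Integrating out \<open>y\<close> first produces \<open>gain\<close>. As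
  \<open>L3\<close> pairs \<open>y\<close> with \<open>z\<close>, the inner double integral is
  evaluated with \<open>y\<close> innermost.\<close>

lemma coll_eq_flux:
  assumes u: "state l \<alpha> u" and f: "f \<in> borel_measurable L" "\<And>x. \<bar>f x\<bar> \<le> B"
  shows "integrable L2 (\<lambda>(x, z). Delta z f x * flux k u u x z)"
    and "coll u f = (LINT (x, z)|L2. Delta z f x * flux k u u x z)"
proof -
  let ?F = "\<lambda>(x, y, z). Delta z f x * (k x y z * u x * u y)"
  note i3 = coll_integrable[OF u f]
  have inner: "(LINT y|L. ?F (x, y, z)) = Delta z f x * flux k u u x z" for x z
  proof -
    have "(LINT y|L. ?F (x, y, z)) = (LINT y|L. (Delta z f x * u x) * (k x y z * u y))"
      by (intro Bochner_Integration.integral_cong) auto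
    also have "\<dots> = (Delta z f x * u x) * (LINT y|L. k x y z * u y)" by (rule integral_mult_right_zero)
    finally show ?thesis by (simp add: flux_def gain_def mult_ac)
  qed
  have i: "integrable L2 (\<lambda>(x, z). Delta z f x * flux k u u x z)"
  proof (rule Bochner_Integration.integrable_bound)
    show "integrable L2 (\<lambda>(x, z). (4 * B * Ml u) * ((br x powr l * u x) * \<psi> z))"
      using product_bound(1)[of "\<lambda>(x, z). (br x powr l * u x) * \<psi> z" "\<lambda>x. br x powr l * u x" \<psi>] stateD(1,2,5)[OF u] psi_int psi_nonneg
      by (auto simp: case_prod_unfold)
    show "(\<lambda>(x, z). Delta z f x * flux k u u x z) \<in> borel_measurable L2"
      using Delta_meas(2)[OF f(1)] gain_meas[OF stateD(1)[OF u]] stateD(1)[OF u] unfolding flux_def by (simp add: case_prod_unfold)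
    show "AE p in L2. norm (case p of (x, z) \<Rightarrow> Delta z f x * flux k u u x z) \<le> norm (case p of (x, z) \<Rightarrow> (4 * B * Ml u) * ((br x powr l * u x) * \<psi> z))"
    proof (rule AE_I2, clarify)
      fix x z
      have B: "0 \<le> B" using f(2)[of 0] by simp
      have M: "0 \<le> Ml u" using stateD(2)[OF u] by (intro mom_nonneg) auto
      have "gain k u x z \<le> (1 + z\<^sup>2) * gain k u x z"
        using gain_nonneg[OF u, of x z] by (simp add: distrib_right)
      also note gain_growth[OF u]
      finally have "\<bar>Delta z f x\<bar> * (gain k u x z * u x) \<le> (4 * B) * ((\<psi> z * br x powr l * Ml u) * u x)"
        using Delta_abs_le[of f B, OF f(2)] stateD(2)[OF u] gain_nonneg[OF u] B by (intro mult_mono mult_right_mono) auto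
      then show "norm (Delta z f x * flux k u u x z) \<le> norm ((4 * B * Ml u) * ((br x powr l * u x) * \<psi> z))"
        using gain_nonneg[OF u, of x z] stateD(2)[OF u, of x] psi_nonneg[of z] B M
        by (simp add: flux_def abs_mult mult_ac)
    qed
  qed
  show "integrable L2 (\<lambda>(x, z). Delta z f x * flux k u u x z)" by (rule i)
  have "coll u f = (LINT x|L. LINT q|L2. ?F (x, q))"
    unfolding coll_def using lborel3.integral_fst'[OF i3] by simp
  also have "\<dots> = (LINT x|L. LINT z|L. Delta z f x * flux k u u x z)"
  proof (rule integral_cong_AE)
    show "(\<lambda>x. LINT q|L2. ?F (x, q)) \<in> borel_measurable L"
      using lborel3.integrable_fst'[OF i3] by auto
    show "(\<lambda>x. LINT z|L. Delta z f x * flux k u u x z) \<in> borel_measurable L"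
      using lborel_pair.integrable_fst'[OF i] by auto
    show "AE x in L. (LINT q|L2. ?F (x, q)) = (LINT z|L. Delta z f x * flux k u u x z)"
      using lborel3.AE_integrable_fst'[OF i3]
    proof eventually_elim
      case (elim x)
      have "integrable L2 (\<lambda>(y, z). ?F (x, y, z))" using elim by (simp add: case_prod_unfold)
      from lborel_pair.integral_snd[OF this]
      have "(LINT q|L2. ?F (x, q)) = (LINT z|L. LINT y|L. ?F (x, y, z))" by (simp add: case_prod_unfold)
      then show ?case unfolding inner .
    qed
  qed
  also have "\<dots> = (LINT (x, z)|L2. Delta z f x * flux k u u x z)"
    using lborel_pair.integral_fst'[OF i] by simp
  finally show "coll u f = (LINT (x, z)|L2. Delta z f x * flux k u u x z)" .
qed

end

lemma (in bounded_kernel) step_weak: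
  assumes u: "state l \<alpha> u" and f: "f \<in> borel_measurable L" "\<And>x. \<bar>f x\<bar> \<le> B"
  shows "(LINT x|L. f x * step k \<tau> u u x) = (LINT x|L. f x * u x) + \<tau> * coll u f"
proof -
  note [measurable] = f(1)
  note i = flux_integrable[OF u stateD(3)[OF u]]
  have b: "integrable L2 (\<lambda>(x, z). F (x, z) * flux k u u x z)"
    if [measurable]: "F \<in> borel_measurable L2" and "\<And>p. \<bar>F p\<bar> \<le> B" for F
    using integrable_bounded_mult[OF that i] by (simp add: case_prod_unfold)
  have 1: "integrable L2 (\<lambda>(x, z). f x * flux k u u x z)"
    using b[of "\<lambda>(x, z). f x"] f(2) by auto
  have 2: "integrable L2 (\<lambda>(x, z). f (x + z) * flux k u u x z)"
    using b[of "\<lambda>(x, z). f (x + z)"] f(2) by auto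
  have 3: "integrable L2 (\<lambda>(x, z). f (x - z) * flux k u u x z)"
    using b[of "\<lambda>(x, z). f (x - z)"] f(2) by auto
  note w = dsec_weak[OF flux_meas[OF u stateD(1)[OF u]] f(1) 1 2 3]
  have fu: "integrable L (\<lambda>x. f x * u x)"
    by (rule integrable_bounded_mult[OF f stateD(3)[OF u]])
  have "(LINT x|L. f x * step k \<tau> u u x) = (LINT x|L. f x * u x + \<tau> * (f x * dsec (flux k u u) x))"
    by (intro Bochner_Integration.integral_cong) (auto simp: step_def algebra_simps)
  also have "\<dots> = (LINT x|L. f x * u x) + \<tau> * coll u f"
    using fu w(1) by (simp add: w(2) coll_eq_flux(2)[OF u f])
  finally show ?thesis .
qed

lemma (in euler_scheme) euler_weak:
  assumes f: "f \<in> borel_measurable L" "\<And>x. \<bar>f x\<bar> \<le> B"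
  shows "(LINT x|L. f x * c j x) - (LINT x|L. f x * c0 x) = \<tau> * (\<Sum>i<j. coll (c i) f)"
proof (induction j)
  case (Suc j)
  show ?case using step_weak[OF euler_state f, of \<tau> j] Suc by (simp add: distrib_left)
qed simp

text \<open>Turns the Riemann sum of \<open>euler_weak\<close> into the integral of a piecewise
  constant function of time, so that its limit becomes a matter of dominated convergence.\<close>

lemma step_function_integral:
  fixes g :: "nat \<Rightarrow> real"
  assumes tau: "0 < \<tau>"
  shows "integrable L (\<lambda>s. indicator {0..<\<tau> * real J} s * g (nat \<lfloor>s / \<tau>\<rfloor>))"
    and "(LINT s|L. indicator {0..<\<tau> * real J} s * g (nat \<lfloor>s / \<tau>\<rfloor>)) = \<tau> * (\<Sum>j<J. g j)"
proof -
  have eq: "(\<lambda>s. indicator {0..<\<tau> * real J} s * g (nat \<lfloor>s / \<tau>\<rfloor>)) = (\<lambda>s. \<Sum>j<J. indicator {\<tau> * real j..<\<tau> * real (Suc j)} s * g j)"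
  proof
    fix s
    show "indicator {0..<\<tau> * real J} s * g (nat \<lfloor>s / \<tau>\<rfloor>) = (\<Sum>j<J. indicator {\<tau> * real j..<\<tau> * real (Suc j)} s * g j)"
    proof (cases "s \<in> {0..<\<tau> * real J}")
      case True
      have iff: "s \<in> {\<tau> * real j..<\<tau> * real (Suc j)} \<longleftrightarrow> j = nat \<lfloor>s / \<tau>\<rfloor>" for j
      proof -
        have "s \<in> {\<tau> * real j..<\<tau> * real (Suc j)} \<longleftrightarrow> real j \<le> s / \<tau> \<and> s / \<tau> < real j + 1"
          using tau by (auto simp: field_simps)
        also have "\<dots> \<longleftrightarrow> \<lfloor>s / \<tau>\<rfloor> = int j" by (simp add: floor_eq_iff)
        also have "\<dots> \<longleftrightarrow> j = nat \<lfloor>s / \<tau>\<rfloor>" using True tau by auto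
        finally show ?thesis .
      qed
      have J: "nat \<lfloor>s / \<tau>\<rfloor> < J"
      proof -
        have "s / \<tau> < real J" using True tau by (auto simp: field_simps)
        then have "\<lfloor>s / \<tau>\<rfloor> < int J" by (simp add: floor_less_iff)
        then show ?thesis using True tau by (simp add: nat_less_iff)
      qed
      have "(\<Sum>j<J. indicator {\<tau> * real j..<\<tau> * real (Suc j)} s * g j) = (\<Sum>j<J. if j = nat \<lfloor>s / \<tau>\<rfloor> then g j else 0)"
        unfolding indicator_def iff by (intro sum.cong) auto
      also have "\<dots> = g (nat \<lfloor>s / \<tau>\<rfloor>)" using J by simp
      finally show ?thesis using True by simp
    next
      case False
      have "s \<notin> {\<tau> * real j..<\<tau> * real (Suc j)}" if "j < J" for j
      proof
        assume s: "s \<in> {\<tau> * real j..<\<tau> * real (Suc j)}"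
        have "\<tau> * real (Suc j) \<le> \<tau> * real J" using that tau by simp
        moreover have "0 \<le> \<tau> * real j" using tau by simp
        ultimately show False using s False by auto
      qed
      then have "(\<Sum>j<J. indicator {\<tau> * real j..<\<tau> * real (Suc j)} s * g j) = 0"
        by (intro sum.neutral ballI) (simp del: of_nat_Suc)
      then show ?thesis using False by simp
    qed
  qed
  have i: "integrable L (\<lambda>s. indicator {\<tau> * real j..<\<tau> * real (Suc j)} s * g j)" for j
    using tau by (intro integrable_mult_left integrable_real_indicator) auto
  show "integrable L (\<lambda>s. indicator {0..<\<tau> * real J} s * g (nat \<lfloor>s / \<tau>\<rfloor>))"
    unfolding eq by (intro Bochner_Integration.integrable_sum i)
  have "(LINT s|L. indicator {\<tau> * real j..<\<tau> * real (Suc j)} s * g j) = \<tau> * g j" for j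
    using tau by (simp add: algebra_simps)
  note val = this
  have "(LINT s|L. (\<Sum>j<J. indicator {\<tau> * real j..<\<tau> * real (Suc j)} s * g j))
      = (\<Sum>j<J. (LINT s|L. indicator {\<tau> * real j..<\<tau> * real (Suc j)} s * g j))"
    using i by (rule Bochner_Integration.integral_sum)
  also have "\<dots> = \<tau> * (\<Sum>j<J. g j)" by (simp only: val sum_distrib_left)
  finally show "(LINT s|L. indicator {0..<\<tau> * real J} s * g (nat \<lfloor>s / \<tau>\<rfloor>)) = \<tau> * (\<Sum>j<J. g j)"
    unfolding eq .
qed

context kernel begin

text \<open>Taking a minimum keeps the Lipschitz bound, and \<open>k\<close> is unchanged wherever
  \<open>br x powr l * br y powr l \<le> n\<close>.\<close>

definition ktrunc :: "nat \<Rightarrow> real \<Rightarrow> real \<Rightarrow> real \<Rightarrow> real" where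
  "ktrunc n x y z = min (k x y z) (real n * \<psi> z)"

lemma ktrunc_le: "ktrunc n x y z \<le> k x y z" and ktrunc_nonneg: "0 \<le> ktrunc n x y z"
  using k_nonneg psi_nonneg by (auto simp: ktrunc_def)

lemma truncation: "bounded_kernel (ktrunc n) \<psi> l \<alpha> (real n)"
proof
  have [measurable]: "(\<lambda>p. k (fst p) (fst (snd p)) (snd (snd p))) \<in> borel_measurable L3"
    using k_meas by (simp add: case_prod_unfold)
  show "(\<lambda>(x, y, z). ktrunc n x y z) \<in> borel_measurable L3"
    unfolding ktrunc_def case_prod_unfold by measurable
  show "ktrunc n x y z = 0" if "\<not> (0 < z \<and> z \<le> x \<and> z \<le> y)" for x y z
    using k_supp[OF that] psi_nonneg by (simp add: ktrunc_def)
  show "z\<^sup>2 * ktrunc n x y z * br x powr (l - 2) \<le> \<psi> z * (br x powr l * br y + br x * br y powr l)" for x y z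
    by (rule order_trans[OF _ k_bal]) (auto intro!: mult_right_mono mult_left_mono ktrunc_le)
  show "(1 + z\<^sup>2) * ktrunc n x y z \<le> \<psi> z * br x powr l * br y powr l" for x y z
    by (rule order_trans[OF _ k_growth]) (auto intro!: mult_left_mono ktrunc_le)
  show "hat (x - z) powr (- \<alpha>) * ktrunc n x y z \<le> \<psi> z * br x powr l * (hat y powr (- \<alpha>) + br y powr l)" for x y z
    by (rule order_trans[OF _ k_sing]) (auto intro!: mult_left_mono ktrunc_le)
  show "AE (x, y, z) in L3. \<bar>ktrunc n (x + h) y z - ktrunc n x y z\<bar> \<le> h * \<psi> z * br (x + h) * (hat y powr (- \<alpha>) + br y powr l)"
    if "0 \<le> h" "h \<le> 1" for h
    using k_lip[OF that]
  proof eventually_elim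
    case (elim p)
    obtain x y z where p: "p = (x, y, z)" by (cases p)
    have "\<bar>ktrunc n (x + h) y z - ktrunc n x y z\<bar> \<le> \<bar>k (x + h) y z - k x y z\<bar>" by (simp add: ktrunc_def)
    then show ?case using elim by (simp add: p)
  qed
  show "ktrunc n x y z \<le> real n * \<psi> z" for x y z by (simp add: ktrunc_def)
qed (use ktrunc_nonneg psi_int psi_nonneg l alpha in auto)

text \<open>Inside the box \<open>br x < R\<close>, \<open>br y < R\<close> the truncation is
  inactive and the rate is bounded by a multiple of \<open>\<psi> z\<close>, so the L1 distance
  suffices. Outside, no cancellation is sought: both rates are estimated separately, each with a
  tail in one variable.\<close>

lemma coll_diff:
  assumes w: "state l \<alpha> w" and u: "state l \<alpha> u" and f: "f \<in> borel_measurable L" "\<And>x. \<bar>f x\<bar> \<le> B"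
    and M: "Ml w \<le> A" "Ml u \<le> A"
    and n: "R powr l * R powr l \<le> real n" and R: "0 \<le> R"
    and tails: "(tail_mom l R w) \<le> e"
       "(tail_mom l R u) \<le> e"
  shows "\<bar>kernel.coll (ktrunc n) w f - coll u f\<bar>
     \<le> 4 * B * (S * (R powr l * R powr l * (((LINT x|L. w x) + (LINT x|L. u x)) * (dist1 w u)) + 4 * e * A))"
proof -
  interpret T: bounded_kernel "ktrunc n" \<psi> l \<alpha> "real n" by (rule truncation)
  note Dw = stateD[OF w] and Du = stateD[OF u]
  define P where "P = R powr l * R powr l"
  have P0: "0 \<le> P" by (simp add: P_def)
  define d where "d x = \<bar>w x - u x\<bar>" for x
  define hw where "hw x = br x powr l * w x" for x
  define hu where "hu x = br x powr l * u x" for x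
  define tw where "tw x = indicator {x. R \<le> br x} x * hw x" for x
  define tu where "tu x = indicator {x. R \<le> br x} x * hu x" for x
  have ints: "integrable L d" "integrable L hw" "integrable L hu" "integrable L w" "integrable L u"
    unfolding d_def hw_def hu_def using Dw Du by auto
  have intt: "integrable L tw" "integrable L tu"
    unfolding tw_def tu_def using integrable_mult_indicator[OF _ ints(2), of "{x. R \<le> br x}"] integrable_mult_indicator[OF _ ints(3), of "{x. R \<le> br x}"] by simp_all
  have pos: "0 \<le> d x" "0 \<le> hw x" "0 \<le> hu x" "0 \<le> tw x" "0 \<le> tu x" "0 \<le> w x" "0 \<le> u x" for x
    using Dw(2) Du(2) by (auto simp: d_def hw_def hu_def tw_def tu_def)
  let ?F = "\<lambda>(x, y, z). ktrunc n x y z * w x * w y - k x y z * u x * u y"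
  \<comment> \<open>The first two terms serve the box. The other four place the tail on
    \<open>x\<close> or on \<open>y\<close>, for \<open>w\<close> and for \<open>u\<close>; each
    integrates to at most \<open>S * e * A\<close>, whence \<open>4 * e * A\<close> in the
    conclusion.\<close>
  let ?G = "\<lambda>p. P * (case p of (x, y, z) \<Rightarrow> d x * w y * \<psi> z) + P * (case p of (x, y, z) \<Rightarrow> u x * d y * \<psi> z)
     + (case p of (x, y, z) \<Rightarrow> tw x * hw y * \<psi> z) + (case p of (x, y, z) \<Rightarrow> hw x * tw y * \<psi> z)
     + (case p of (x, y, z) \<Rightarrow> tu x * hu y * \<psi> z) + (case p of (x, y, z) \<Rightarrow> hu x * tu y * \<psi> z)"
  have iF: "integrable L3 ?F"
    using Bochner_Integration.integrable_diff[OF T.rate_integrable(1)[OF w] rate_integrable(1)[OF u]] by (simp add: case_prod_unfold)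
  note tp = triple_product[OF ints(1) ints(4) psi_int] triple_product[OF ints(5) ints(1) psi_int]
    triple_product[OF intt(1) ints(2) psi_int] triple_product[OF ints(2) intt(1) psi_int]
    triple_product[OF intt(2) ints(3) psi_int] triple_product[OF ints(3) intt(2) psi_int]
  have iG: "integrable L3 ?G"
    by (intro Bochner_Integration.integrable_add integrable_mult_right tp)
  have le: "\<bar>?F p\<bar> \<le> ?G p" for p
  proof -
    obtain x y z where p: "p = (x, y, z)" by (cases p)
    have nn: "0 \<le> P * (d x * w y * \<psi> z)" "0 \<le> P * (u x * d y * \<psi> z)" "0 \<le> tw x * hw y * \<psi> z" "0 \<le> hw x * tw y * \<psi> z"
      "0 \<le> tu x * hu y * \<psi> z" "0 \<le> hu x * tu y * \<psi> z"
      using pos P0 psi_nonneg by (auto intro!: mult_nonneg_nonneg)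
    show ?thesis
    proof (cases "br x < R \<and> br y < R")
      case True
      have "br x powr l * br y powr l \<le> P"
        unfolding P_def using True l by (intro mult_mono powr_mono2) auto
      then have kP: "k x y z \<le> \<psi> z * P"
        using k_le[of x y z] psi_nonneg[of z] mult_left_mono[of "br x powr l * br y powr l" P "\<psi> z"] by (simp add: mult.assoc)
      also have "\<psi> z * P \<le> real n * \<psi> z" using mult_right_mono[OF n psi_nonneg[of z]] by (simp add: P_def mult.commute)
      finally have kt: "ktrunc n x y z = k x y z" by (simp add: ktrunc_def)
      have "?F p = k x y z * ((w x - u x) * w y + u x * (w y - u y))" by (simp add: p kt algebra_simps)
      then have "\<bar>?F p\<bar> \<le> k x y z * (d x * w y + u x * d y)"
        using k_nonneg[of x y z] pos abs_triangle_ineq[of "(w x - u x) * w y" "u x * (w y - u y)"]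
        by (auto simp: abs_mult d_def intro!: mult_left_mono)
      also have "\<dots> \<le> (\<psi> z * P) * (d x * w y + u x * d y)"
        using kP pos by (intro mult_right_mono) auto
      also have "\<dots> = P * (d x * w y * \<psi> z) + P * (u x * d y * \<psi> z)" by (simp add: algebra_simps)
      finally show ?thesis using nn by (simp add: p)
    next
      case False
      have kw: "ktrunc n x y z * w x * w y \<le> hw x * hw y * \<psi> z"
        using T.rate_le[of w x y z, OF Dw(2)] by (simp add: hw_def)
      have ku: "k x y z * u x * u y \<le> hu x * hu y * \<psi> z"
        using rate_le[of u x y z, OF Du(2)] by (simp add: hu_def)
      have "tw x = hw x \<and> tu x = hu x \<or> tw y = hw y \<and> tu y = hu y" using False by (auto simp: tw_def tu_def)
      then have "hw x * hw y * \<psi> z + hu x * hu y * \<psi> z \<le> tw x * hw y * \<psi> z + hw x * tw y * \<psi> z + tu x * hu y * \<psi> z + hu x * tu y * \<psi> z"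
        using nn by auto
      moreover have "0 \<le> ktrunc n x y z * w x * w y" "0 \<le> k x y z * u x * u y"
        using ktrunc_nonneg k_nonneg pos by auto
      ultimately have "\<bar>ktrunc n x y z * w x * w y - k x y z * u x * u y\<bar> \<le> tw x * hw y * \<psi> z + hw x * tw y * \<psi> z + tu x * hu y * \<psi> z + hu x * tu y * \<psi> z"
        using kw ku by linarith
      then show ?thesis using nn by (simp add: p)
    qed
  qed
  have B: "0 \<le> B" using f(2)[of 0] by simp
  have "0 \<le> (LINT x|L. tw x)" using pos by auto
  also have "\<dots> \<le> e" using tails by (simp add: tw_def hw_def)
  finally have e0: "0 \<le> e" .
  have mF: "?F \<in> borel_measurable L3" using iF by auto
  have iDF: "integrable L3 (\<lambda>p. (case p of (x, y, z) \<Rightarrow> Delta z f x) * ?F p)"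
    using Delta_abs_le[of f B, OF f(2)]
    by (intro integrable_bounded_mult[OF Delta_meas(1)[OF f(1)], of "4 * B"] iF) (auto split: prod.split)
  have "T.coll w f - coll u f = (LINT p|L3. (case p of (x, y, z) \<Rightarrow> Delta z f x * (ktrunc n x y z * w x * w y)) - (case p of (x, y, z) \<Rightarrow> Delta z f x * (k x y z * u x * u y)))"
    unfolding T.coll_def coll_def
    by (rule Bochner_Integration.integral_diff[symmetric]) (rule T.coll_integrable[OF w f] coll_integrable[OF u f])+
  also have "\<dots> = (LINT p|L3. (case p of (x, y, z) \<Rightarrow> Delta z f x) * ?F p)"
    by (intro Bochner_Integration.integral_cong) (auto simp: algebra_simps)
  finally have eq: "T.coll w f - coll u f = (LINT p|L3. (case p of (x, y, z) \<Rightarrow> Delta z f x) * ?F p)" .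
  have "\<bar>T.coll w f - coll u f\<bar> \<le> (LINT p|L3. \<bar>(case p of (x, y, z) \<Rightarrow> Delta z f x) * ?F p\<bar>)"
    unfolding eq by (rule integral_abs_bound)
  also have "\<dots> \<le> (LINT p|L3. 4 * B * ?G p)"
  proof (rule integral_mono)
    show "integrable L3 (\<lambda>p. \<bar>(case p of (x, y, z) \<Rightarrow> Delta z f x) * ?F p\<bar>)" using iDF by simp
    show "integrable L3 (\<lambda>p. 4 * B * ?G p)" using iG by (rule integrable_mult_right)
    fix p :: "real \<times> real \<times> real"
    have "\<bar>case p of (x, y, z) \<Rightarrow> Delta z f x\<bar> * \<bar>?F p\<bar> \<le> 4 * B * ?G p"
      using Delta_abs_le[of f B, OF f(2)] le[of p] B by (intro mult_mono) (auto split: prod.split)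
    then show "\<bar>(case p of (x, y, z) \<Rightarrow> Delta z f x) * ?F p\<bar> \<le> 4 * B * ?G p" by (simp add: abs_mult)
  qed
  also have "\<dots> = 4 * B * (LINT p|L3. ?G p)" by (rule integral_mult_right_zero)
  also have "(LINT p|L3. ?G p) = P * ((LINT x|L. d x) * (LINT x|L. w x) * S) + P * ((LINT x|L. u x) * (LINT x|L. d x) * S)
      + (LINT x|L. tw x) * (LINT x|L. hw x) * S + (LINT x|L. hw x) * (LINT x|L. tw x) * S
      + (LINT x|L. tu x) * (LINT x|L. hu x) * S + (LINT x|L. hu x) * (LINT x|L. tu x) * S"
    by (intro has_bochner_integral_integral_eq has_bochner_integral_add has_bochner_integral_mult_right)
      (simp_all only: has_bochner_integral_iff tp simp_thms)
  also have "\<dots> = S * (P * (((LINT x|L. w x) + (LINT x|L. u x)) * (LINT x|L. d x)) + 2 * ((LINT x|L. tw x) * (LINT x|L. hw x) + (LINT x|L. tu x) * (LINT x|L. hu x)))"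
    by (simp add: algebra_simps)
  also have "4 * B * \<dots> \<le> 4 * B * (S * (P * (((LINT x|L. w x) + (LINT x|L. u x)) * (LINT x|L. d x)) + 2 * (e * A + e * A)))"
  proof (intro mult_left_mono add_left_mono add_mono mult_mono)
    show "(LINT x|L. tw x) \<le> e" "(LINT x|L. tu x) \<le> e" using tails by (simp_all add: tw_def tu_def hw_def hu_def)
    show "(LINT x|L. hw x) \<le> A" "(LINT x|L. hu x) \<le> A" using M by (simp_all add: mom_def hw_def hu_def)
    show "0 \<le> (LINT x|L. hw x)" "0 \<le> (LINT x|L. hu x)" using pos by auto
  qed (use B e0 in auto)
  finally show ?thesis by (simp add: P_def d_def mult_ac)
qed

end

section \<open>Approximate solutions with truncation level and step size tied together\<close>

locale initial_state = kernel +
  fixes c0 :: "real \<Rightarrow> real"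
  assumes c0: "state l \<alpha> c0"
begin

abbreviation "M0 \<equiv> \<lambda>c. LINT x|L. c x"
abbreviation "A \<equiv> growth_bound \<psi> l c0"
abbreviation "W \<equiv> weight_bound \<psi> l \<alpha> c0"

text \<open>The second factor enforces the step-size condition at truncation level \<open>n\<close>,
  and its summand 1 keeps it positive; the first forces convergence to 0 even if \<open>S\<close> or
  the mass vanishes.\<close>

definition dt :: "nat \<Rightarrow> real" where
  "dt n = 1 / ((real n + 1) * (1 + 2 * S * real n * M0 c0))"

lemma m0_nonneg: "0 \<le> M0 c0" using stateD(2)[OF c0] by simp

lemma dt_denominator_pos: "0 < (real n + 1) * (1 + 2 * S * real n * M0 c0)"
proof -
  have "0 \<le> 2 * S * real n * M0 c0" using m0_nonneg by simp
  then have "0 < 1 + 2 * S * real n * M0 c0" by linarith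
  then show ?thesis by (intro mult_pos_pos) auto
qed

lemma dt_pos: "0 < dt n"
  unfolding dt_def by (intro divide_pos_pos dt_denominator_pos) simp

lemma dt_le: "dt n \<le> 1 / (real n + 1)"
proof -
  have "real n + 1 \<le> (real n + 1) * (1 + 2 * S * real n * M0 c0)"
    using m0_nonneg by (simp add: distrib_left)
  then show ?thesis unfolding dt_def by (intro divide_left_mono mult_pos_pos dt_denominator_pos) auto
qed

lemma dt_tendsto: "dt \<longlonglongrightarrow> 0"
proof (rule tendsto_sandwich[of "\<lambda>_. 0" dt sequentially "\<lambda>n. inverse (real (Suc n))"])
  show "eventually (\<lambda>n. dt n \<le> inverse (real (Suc n))) sequentially"
    using dt_le by (intro always_eventually allI) (simp add: inverse_eq_divide add.commute)
  show "(\<lambda>n. inverse (real (Suc n))) \<longlonglongrightarrow> 0" by (rule LIMSEQ_inverse_real_of_nat)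
  show "eventually (\<lambda>n. 0 \<le> dt n) sequentially"
    by (intro always_eventually allI less_imp_le dt_pos)
qed simp

lemma scheme: "euler_scheme (ktrunc n) \<psi> l \<alpha> (real n) (dt n) c0"
proof (rule euler_scheme.intro[OF truncation], unfold_locales)
  define q where "q = S * (real n * M0 c0)"
  have q: "0 \<le> q" unfolding q_def using m0_nonneg by simp
  have "2 * q \<le> (real n + 1) * (1 + 2 * q)" using q by (simp add: distrib_left distrib_right add_nonneg_nonneg)
  moreover have "0 < (real n + 1) * (1 + 2 * q)"
    using dt_denominator_pos[of n] by (simp add: q_def mult_ac)
  moreover have "dt n = 1 / ((real n + 1) * (1 + 2 * q))" by (simp add: dt_def q_def mult_ac)
  ultimately show "2 * dt n * (S * (real n * M0 c0)) \<le> 1"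
    by (simp add: q_def[symmetric])
qed (use dt_pos c0 in auto)

definition approx :: "nat \<Rightarrow> real \<Rightarrow> real \<Rightarrow> real" where
  "approx n t = euler (ktrunc n) (dt n) c0 (nat \<lfloor>t / dt n\<rfloor>)"

lemma index_le: "0 \<le> t \<Longrightarrow> dt n * real (nat \<lfloor>t / dt n\<rfloor>) \<le> t"
  and index_ge: "t \<le> dt n * real (nat \<lfloor>t / dt n\<rfloor>) + dt n"
proof -
  have "real (nat \<lfloor>t / dt n\<rfloor>) \<le> t / dt n" if "0 \<le> t"
    using that dt_pos[of n] by (simp add: of_nat_nat)
  from mult_left_mono[OF this, of "dt n"] show "0 \<le> t \<Longrightarrow> dt n * real (nat \<lfloor>t / dt n\<rfloor>) \<le> t"
    using dt_pos[of n] by simp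
  have "t / dt n \<le> real (nat \<lfloor>t / dt n\<rfloor>) + 1" by linarith
  from mult_left_mono[OF this, of "dt n"] show "t \<le> dt n * real (nat \<lfloor>t / dt n\<rfloor>) + dt n"
    using dt_pos[of n] by (simp add: distrib_left)
qed

lemma approx_state: "state l \<alpha> (approx n t)"
  unfolding approx_def by (rule euler_scheme.euler_state[OF scheme])

lemmas approxD = stateD[OF approx_state]

lemma approx_M0: "M0 (approx n t) \<le> M0 c0" and approx_M1: "M1 (approx n t) \<le> M1 c0"
  unfolding approx_def using euler_scheme.euler_invariants[OF scheme] by auto

lemma approx_Ml: "0 \<le> t \<Longrightarrow> t \<le> T \<Longrightarrow> Ml (approx n t) \<le> A T"
  unfolding approx_def using index_le[of t n] by (intro euler_scheme.Ml_le[OF scheme]) linarith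

lemma approx_Mw: "0 \<le> t \<Longrightarrow> t \<le> T \<Longrightarrow> Mw (approx n t) \<le> W T"
  unfolding approx_def using index_le[of t n] by (intro euler_scheme.Mw_le[OF scheme]) linarith

lemma A_nonneg: "0 \<le> A T" by (rule euler_scheme.A_nonneg[OF scheme[of 0]])
lemma W_nonneg: "0 \<le> W T" by (rule euler_scheme.W_nonneg[OF scheme[of 0]])

text \<open>Rounding both times down to grid points can lengthen the interval by at most one step,
  hence the summand \<open>dt n\<close>.\<close>

lemma approx_time:
  assumes "0 \<le> s" "s \<le> t" "t \<le> T"
  shows "(LINT x|L. \<bar>approx n t x - approx n s x\<bar>) \<le> (t - s + dt n) * (4 * S * (A T)\<^sup>2)"
proof -
  let ?i = "nat \<lfloor>s / dt n\<rfloor>" and ?j = "nat \<lfloor>t / dt n\<rfloor>"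
  have ij: "?i \<le> ?j" using assms dt_pos[of n] by (intro nat_mono floor_mono divide_right_mono) auto
  have "(LINT x|L. \<bar>approx n t x - approx n s x\<bar>) \<le> dt n * real (?j - ?i) * (4 * S * (A T)\<^sup>2)"
    unfolding approx_def using index_le[of t n] assms by (intro euler_scheme.euler_time[OF scheme ij]) linarith
  also have "dt n * real (?j - ?i) = dt n * real ?j - dt n * real ?i" using ij by (simp add: of_nat_diff algebra_simps)
  also have "(dt n * real ?j - dt n * real ?i) * (4 * S * (A T)\<^sup>2) \<le> (t - s + dt n) * (4 * S * (A T)\<^sup>2)"
    using index_le[of t n] index_ge[of s n] assms by (intro mult_right_mono) auto
  finally show ?thesis .
qed

lemma approx_translation:
  assumes h: "0 \<le> h" "h \<le> 1" and t: "0 \<le> t"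
  shows "(LINT x|L. \<bar>approx n t (x + h) - approx n t x\<bar>) \<le> (osc c0 h) + t * (4 * h * S * M1 c0 * W t)"
proof -
  have "(LINT x|L. \<bar>approx n t (x + h) - approx n t x\<bar>) \<le> (osc c0 h)
      + dt n * real (nat \<lfloor>t / dt n\<rfloor>) * (4 * h * S * M1 c0 * W t)"
    unfolding approx_def using t by (intro euler_scheme.euler_translation[OF scheme h] index_le)
  also have "dt n * real (nat \<lfloor>t / dt n\<rfloor>) * (4 * h * S * M1 c0 * W t) \<le> t * (4 * h * S * M1 c0 * W t)"
  proof (rule mult_right_mono[OF index_le[OF t]])
    have "0 \<le> M1 c0" using stateD(2)[OF c0] by (intro mom_nonneg) auto
    then show "0 \<le> 4 * h * S * M1 c0 * W t" using h W_nonneg[of t] by simp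
  qed
  finally show ?thesis by simp
qed

lemma approx_tail:
  assumes T: "0 \<le> T" and e: "e > 0"
  shows "\<exists>R>0. \<forall>n t. 0 \<le> t \<longrightarrow> t \<le> T \<longrightarrow> (tail_mom l R (approx n t)) \<le> e"
proof -
  let ?v = "\<lambda>(m::nat) x. indicator (- {- real m..real m}) x * c0 x"
  define C1 where "C1 = exp (2 * S * l * A T * T)"
  note D = stateD[OF c0]
  have [measurable]: "c0 \<in> borel_measurable L" by (rule D(1))
  \<comment> \<open>The part of the moment outside \<open>{- real m..real m}\<close> tends to 0.
    This fixes \<open>m\<close>, before the constant \<open>C2\<close>, which depends on it.\<close>
  have "(\<lambda>m. Ml (?v m)) \<longlonglongrightarrow> (LINT x|L. 0)"
    unfolding mom_def
  proof (rule integral_dominated_convergence[where w="\<lambda>x. br x powr l * c0 x"])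
    show "AE x in L. (\<lambda>m. br x powr l * ?v m x) \<longlonglongrightarrow> 0"
    proof (rule AE_I2)
      fix x :: real
      obtain m0 :: nat where m0: "\<bar>x\<bar> \<le> real m0" using real_arch_simple by blast
      have "eventually (\<lambda>m. br x powr l * ?v m x = 0) sequentially"
        using eventually_ge_at_top[of m0]
      proof eventually_elim
        case (elim m)
        then have "real m0 \<le> real m" by simp
        then have "x \<in> {- real m..real m}" using m0 by auto
        then show ?case by simp
      qed
      then show "(\<lambda>m. br x powr l * ?v m x) \<longlonglongrightarrow> 0" by (rule tendsto_eventually)
    qed
    show "AE x in L. norm (br x powr l * ?v m x) \<le> br x powr l * c0 x" for m
      using D(2) by (intro AE_I2) (auto simp: indicator_def)
  qed (use D(5) in auto)
  then have "(\<lambda>m. C1 * Ml (?v m)) \<longlonglongrightarrow> 0" by (auto intro: tendsto_eq_intros)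
  from order_tendstoD(2)[OF this, of "e/2"] e obtain m where m: "C1 * Ml (?v m) < e/2"
    by (auto simp: eventually_sequentially)
  define C2 where "C2 = exp (6 * S * A T * T) * mom (\<lambda>x. br x powr 3) (\<lambda>x. indicator {- real m..real m} x * c0 x)"
  have C2: "0 \<le> C2" unfolding C2_def using D(2) by (intro mult_nonneg_nonneg mom_nonneg) auto
  \<comment> \<open>Gives \<open>C2 / R \<le> e/2\<close>; the summand 1 keeps \<open>R\<close>
    positive if \<open>C2 = 0\<close>.\<close>
  define R where "R = 2 * C2 / e + 1"
  have R: "R > 0" using C2 e by (simp add: R_def add_nonneg_pos)
  have half: "C2 / R \<le> e/2"
  proof -
    have "C2 \<le> e/2 * R" using e by (simp add: R_def field_simps)
    then show ?thesis using R by (simp add: pos_divide_le_eq)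
  qed
  have bound: "(tail_mom l R (approx n t)) \<le> C2 / R + C1 * Ml (?v m)"
    if "0 \<le> t" "t \<le> T" for n t
    unfolding approx_def C1_def C2_def using index_le[of t n] that R
    by (intro euler_scheme.euler_tail[OF scheme]) auto
  show ?thesis
  proof (intro exI[of _ R] conjI allI impI R)
    fix n t assume "0 \<le> t" "t \<le> T"
    from bound[OF this, of n] half m
    show "(tail_mom l R (approx n t)) \<le> e" by linarith
  qed
qed

text \<open>Cell endpoints and times are rational, so the index set is countable and one diagonal
  subsequence serves all cells and times.\<close>

definition rational_cells :: "nat \<Rightarrow> rat \<times> rat \<times> rat \<Rightarrow> real" where
  "rational_cells n = (\<lambda>(a, b, t). LINT x|L. indicator {of_rat a..<of_rat b} x * approx n (of_rat t) x)"

lemma approx_Cauchy_rational: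
  assumes conv: "\<And>i. convergent (\<lambda>n. rational_cells (r n) i)" and t: "0 \<le> t" "t \<in> \<rat>" and e: "(e::real) > 0"
  shows "\<exists>N. \<forall>i\<ge>N. \<forall>j\<ge>N. (dist1 (approx (r i) t) (approx (r j) t)) < e"
proof (rule Kolmogorov_Riesz_Cauchy[OF _ _ _ _ e])
  show "integrable L (approx (r n) t)" for n by (rule approxD(3))
next
  fix e :: real assume e: "e > 0"
  \<comment> \<open>Markov's inequality for the first moment, with
    \<open>(1 + R) * e = e + M1 c0\<close>.\<close>
  define R where "R = M1 c0 / e"
  have M1: "0 \<le> M1 c0" using stateD(2)[OF c0] by (intro mom_nonneg) auto
  then have R: "0 \<le> R" using e by (simp add: R_def)
  have "(LINT x|L. indicator {x. \<bar>x\<bar> \<ge> R} x * \<bar>approx (r n) t x\<bar>) \<le> e" for n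
  proof -
    have "(1 + R) * (LINT x|L. indicator {x. \<bar>x\<bar> \<ge> R} x * \<bar>approx (r n) t x\<bar>) = (LINT x|L. (1 + R) * (indicator {x. \<bar>x\<bar> \<ge> R} x * \<bar>approx (r n) t x\<bar>))"
      by (rule integral_mult_right_zero[symmetric])
    also have "\<dots> \<le> M1 (approx (r n) t)"
      unfolding mom_def
    proof (rule integral_mono)
      show "integrable L (\<lambda>x. (1 + R) * (indicator {x. \<bar>x\<bar> \<ge> R} x * \<bar>approx (r n) t x\<bar>))"
        using integrable_mult_indicator[OF _ integrable_abs[OF approxD(3)], of "{x. \<bar>x\<bar> \<ge> R}" "r n" t] by simp
      show "(1 + R) * (indicator {x. \<bar>x\<bar> \<ge> R} x * \<bar>approx (r n) t x\<bar>) \<le> br x * approx (r n) t x" for x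
        using approxD(2)[of "r n" t x] by (auto simp: indicator_def br_def intro!: mult_right_mono)
    qed (rule approxD(4))
    also have "\<dots> \<le> M1 c0" by (rule approx_M1)
    also have "\<dots> \<le> (1 + R) * e" using e by (simp add: R_def field_simps)
    finally show ?thesis using R by simp
  qed
  then show "\<exists>R. \<forall>n. (LINT x|L. indicator {x. \<bar>x\<bar> \<ge> R} x * \<bar>approx (r n) t x\<bar>) \<le> e" by blast
next
  fix e :: real assume e: "e > 0"
  let ?q = "\<lambda>h. (osc c0 h) + t * (4 * h * S * M1 c0 * W t)"
  have "((\<lambda>h. t * (4 * h * S * M1 c0 * W t)) \<longlongrightarrow> t * (4 * 0 * S * M1 c0 * W t)) (at 0)"
    by (intro tendsto_intros)
  from tendsto_add[OF translation_continuous[OF stateD(3)[OF c0]] this]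
  have "(?q \<longlongrightarrow> 0) (at 0)" by simp
  from order_tendstoD(2)[OF this e] have "eventually (\<lambda>h. ?q h < e) (at 0)" .
  then obtain d where d: "d > 0" "\<And>h. h \<noteq> 0 \<Longrightarrow> \<bar>h\<bar> < d \<Longrightarrow> ?q h < e"
    by (auto simp: eventually_at dist_real_def)
  show "\<exists>h>0. \<forall>n s. 0 < s \<longrightarrow> s \<le> h \<longrightarrow> (osc (approx (r n) t) s) \<le> e"
  proof (intro exI[of _ "min 1 (d/2)"] conjI allI impI)
    fix n and s :: real assume s: "0 < s" "s \<le> min 1 (d/2)"
    have "(osc (approx (r n) t) s) \<le> ?q s"
      using s t by (intro approx_translation) auto
    also have "\<dots> \<le> e" using d(2)[of s] s d(1) by auto
    finally show "(osc (approx (r n) t) s) \<le> e" .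
  qed (use d in auto)
next
  fix a b :: real assume "a \<in> \<rat>" "b \<in> \<rat>"
  then obtain a' b' t' where "a = of_rat a'" "b = of_rat b'" "t = of_rat t'"
    using t by (auto elim!: Rats_cases)
  then show "convergent (\<lambda>n. LINT x|L. indicator {a..<b} x * approx (r n) t x)"
    using conv[of "(a', b', t')"] by (simp add: rational_cells_def)
qed

text \<open>A rational time shortly after \<open>t\<close> replaces \<open>t\<close> at the cost
  given by \<open>approx_time\<close>; the \<open>dt\<close> in that cost becomes small along the
  subsequence.\<close>

lemma approx_Cauchy:
  assumes r: "strict_mono r" and conv: "\<And>i. convergent (\<lambda>n. rational_cells (r n) i)" and t: "0 \<le> t" and e: "(e::real) > 0"
  shows "\<exists>N. \<forall>i\<ge>N. \<forall>j\<ge>N. (dist1 (approx (r i) t) (approx (r j) t)) < e"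
proof -
  define K where "K = 4 * S * (A (t + 1))\<^sup>2"
  have K: "0 \<le> K" by (simp add: K_def)
  \<comment> \<open>Two replacements cost at most \<open>2 * d * K \<le> e/4\<close> each, and the
    comparison at the rational time less than \<open>e/2\<close>. The bound \<open>d \<le> 1\<close>
    keeps that time below \<open>t + 1\<close>, for which \<open>K\<close> is defined.\<close>
  define d where "d = min 1 (e / (8 * (K + 1)))"
  have d: "0 < d" "d \<le> 1" using e K by (auto simp: d_def)
  obtain q where q: "q \<in> \<rat>" "t < q" "q < t + d" using Rats_dense_in_real[of t "t + d"] d by auto
  have q0: "0 \<le> q" using q t by simp
  obtain N1 where N1: "\<And>i j. i \<ge> N1 \<Longrightarrow> j \<ge> N1 \<Longrightarrow> (dist1 (approx (r i) q) (approx (r j) q)) < e/2"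
    using approx_Cauchy_rational[OF conv q0 q(1) half_gt_zero[OF e]] by blast
  have "(\<lambda>n. dt (r n)) \<longlonglongrightarrow> 0" using LIMSEQ_subseq_LIMSEQ[OF dt_tendsto r] by (simp add: o_def)
  from order_tendstoD(2)[OF this d(1)] obtain N2 where N2: "\<And>n. n \<ge> N2 \<Longrightarrow> dt (r n) < d"
    by (auto simp: eventually_sequentially)
  have near: "(dist1 (approx (r i) q) (approx (r i) t)) \<le> e/4" if "i \<ge> N2" for i
  proof -
    have "(dist1 (approx (r i) q) (approx (r i) t)) \<le> (q - t + dt (r i)) * K"
      unfolding K_def using q t d by (intro approx_time) auto
    also have "\<dots> \<le> (2 * d) * K" using q N2[OF that] K by (intro mult_right_mono) auto
    also have "\<dots> \<le> (2 * (e / (8 * (K + 1)))) * K" using K by (intro mult_right_mono mult_left_mono) (auto simp: d_def)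
    also have "\<dots> \<le> e/4" using K e by (simp add: field_simps)
    finally show ?thesis .
  qed
  have "(dist1 (approx (r i) t) (approx (r j) t)) < e" if "i \<ge> max N1 N2" "j \<ge> max N1 N2" for i j
  proof -
    note ints = approxD(3)[of "r i" t] approxD(3)[of "r j" t] approxD(3)[of "r i" q] approxD(3)[of "r j" q]
    have "(dist1 (approx (r i) t) (approx (r j) t)) \<le> (LINT x|L. (\<bar>approx (r i) q x - approx (r i) t x\<bar> + \<bar>approx (r j) q x - approx (r j) t x\<bar>) + \<bar>approx (r i) q x - approx (r j) q x\<bar>)"
      using ints by (intro integral_mono L1_intros) auto
    also have "\<dots> = (dist1 (approx (r i) q) (approx (r i) t)) + (dist1 (approx (r j) q) (approx (r j) t)) + (dist1 (approx (r i) q) (approx (r j) q))"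
      using ints by simp
    also have "\<dots> < e" using near[of i] near[of j] N1[of i j] that by simp
    finally show ?thesis .
  qed
  then show ?thesis by blast
qed

text \<open>The subsequence is chosen before \<open>t\<close>, from rational data only. The
  Lipschitz bound in time then yields convergence at every real \<open>t\<close> along the same
  indices.\<close>

lemma converging_subsequence:
  obtains r c where "strict_mono (r :: nat \<Rightarrow> nat)"
    "\<And>t. 0 \<le> t \<Longrightarrow> integrable L (c t)" "\<And>t x. 0 \<le> t \<Longrightarrow> 0 \<le> c t x" 
    "\<And>t. 0 \<le> t \<Longrightarrow> c t \<in> borel_measurable L"
    "\<And>t. 0 \<le> t \<Longrightarrow> (\<lambda>n. LINT x|L. \<bar>approx (r n) t x - c t x\<bar>) \<longlonglongrightarrow> 0"
proof -
  have "\<bar>rational_cells n i\<bar> \<le> M0 c0" for n i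
  proof -
    obtain a b t where i: "i = (a, b, t)" by (cases i)
    have "rational_cells n i \<le> M0 (approx n (of_rat t))"
      unfolding rational_cells_def i prod.case
      using integrable_mult_indicator[OF _ approxD(3), of "{of_rat a..<of_rat b}" n "of_rat t"] approxD(2,3)[of n "of_rat t"]
      by (intro integral_mono) (auto simp: indicator_def)
    moreover have "0 \<le> rational_cells n i"
      unfolding rational_cells_def i prod.case using approxD(2) by (intro Bochner_Integration.integral_nonneg) simp
    ultimately show ?thesis using approx_M0[of n "of_rat t"] by simp
  qed
  from diagonal_convergent[of rational_cells, OF this]
  obtain r where r: "strict_mono r" "\<And>i. convergent (\<lambda>n. rational_cells (r n) i)" by blast
  have "\<exists>v. integrable L v \<and> (\<forall>x. 0 \<le> v x) \<and> (\<lambda>n. LINT x|L. \<bar>approx (r n) t x - v x\<bar>) \<longlonglongrightarrow> 0" if "0 \<le> t" for t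
    using L1_complete[of L "\<lambda>n. approx (r n) t", OF approxD(3) approxD(2) approx_Cauchy[OF r that]] by blast
  then have "\<forall>t. \<exists>v. 0 \<le> t \<longrightarrow> integrable L v \<and> (\<forall>x. 0 \<le> v x) \<and> (\<lambda>n. LINT x|L. \<bar>approx (r n) t x - v x\<bar>) \<longlonglongrightarrow> 0" by blast
  from choice[OF this] obtain c where c: "\<And>t. 0 \<le> t \<Longrightarrow> integrable L (c t) \<and> (\<forall>x. 0 \<le> c t x) \<and> (\<lambda>n. LINT x|L. \<bar>approx (r n) t x - c t x\<bar>) \<longlonglongrightarrow> 0" by blast
  have "c t \<in> borel_measurable L" if "0 \<le> t" for t using c[OF that] by (intro borel_measurable_integrable) simp
  then show thesis
    using r(1) c by (intro that[of r c]) auto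
qed

theorem limit_solution:
  "\<exists>c. (\<forall>t\<ge>0. state l \<alpha> (c t)) \<and> (AE x in L. c 0 x = c0 x) \<and>
     (\<forall>T t. 0 \<le> t \<longrightarrow> t \<le> T \<longrightarrow> Ml (c t) \<le> A T \<and> Ms (c t) \<le> W T) \<and>
     (\<forall>T s t. 0 \<le> s \<longrightarrow> s \<le> t \<longrightarrow> t \<le> T \<longrightarrow> (dist1 (c t) (c s)) \<le> (t - s) * (4 * S * (A T)\<^sup>2)) \<and>
     (\<forall>t f B. 0 \<le> t \<longrightarrow> f \<in> borel_measurable L \<longrightarrow> (\<forall>x. \<bar>f x\<bar> \<le> B) \<longrightarrow>
        (\<lambda>s. indicator {0..t} s * coll (c s) f) \<in> borel_measurable L \<and>
        (LINT x|L. f x * (c t x - c0 x)) = (LINT s|L. indicator {0..t} s * coll (c s) f))"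
proof -
  obtain r c where r: "strict_mono (r :: nat \<Rightarrow> nat)"
    and ci: "\<And>t. 0 \<le> t \<Longrightarrow> integrable L (c t)" and c_nonneg: "\<And>t x. 0 \<le> t \<Longrightarrow> 0 \<le> c t x"
    and cm: "\<And>t. 0 \<le> t \<Longrightarrow> c t \<in> borel_measurable L"
    and lim: "\<And>t. 0 \<le> t \<Longrightarrow> (\<lambda>n. LINT x|L. \<bar>approx (r n) t x - c t x\<bar>) \<longlonglongrightarrow> 0"
    using converging_subsequence by blast
  \<comment> \<open>Uniform bounds on weighted integrals pass to the limit by Fatou's lemma; the
    tails are treated in the same way, with a weight that is cut off.\<close>
  have wt: "integrable L (\<lambda>x. p x * c t x) \<and> mom p (c t) \<le> C"
    if "0 \<le> t" "p \<in> borel_measurable L" "\<And>x. 0 \<le> p x" "\<And>n. integrable L (\<lambda>x. p x * approx n t x)" "\<And>n. mom p (approx n t) \<le> C" for p t C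
    using L1_limit_weight[of L "\<lambda>n. approx (r n) t" "c t" p 0 C] that ci lim approxD by (auto simp: mom_def)
  have Ml_c: "integrable L (\<lambda>x. br x powr l * c t x) \<and> Ml (c t) \<le> A T" if "0 \<le> t" "t \<le> T" for t T
    using that approx_Ml by (intro wt approxD) auto
  have Ms_c: "integrable L (\<lambda>x. hat x powr (- \<alpha>) * c t x) \<and> Ms (c t) \<le> W T" if "0 \<le> t" "t \<le> T" for t T
  proof (intro wt approxD)
    fix n
    have "0 \<le> Ml (approx n t)" using approxD(2) by (intro mom_nonneg) auto
    then show "Ms (approx n t) \<le> W T" using approx_Mw[OF that, of n] by simp
  qed (use that in auto)
  have st: "state l \<alpha> (c t)" if "0 \<le> t" for t
    using cm[OF that] c_nonneg[OF that] Ml_c[OF that order_refl] Ms_c[OF that order_refl] by (simp add: state_def)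
  have tails: "(tail_mom l R (c t)) \<le> e"
    if "0 \<le> t" "\<And>n. (tail_mom l R (approx n t)) \<le> e" for R e t
  proof -
    have "mom (\<lambda>x. indicator {x. R \<le> br x} x * br x powr l) (c t) \<le> e"
    proof (rule wt[THEN conjunct2, OF that(1)])
      fix n
      show "integrable L (\<lambda>x. indicator {x. R \<le> br x} x * br x powr l * approx n t x)"
        using integrable_mult_indicator[OF _ approxD(5)[of n t], of "{x. R \<le> br x}"] by (simp add: mult.assoc)
      show "mom (\<lambda>x. indicator {x. R \<le> br x} x * br x powr l) (approx n t) \<le> e"
        using that(2)[of n] by (simp add: mom_def mult.assoc)
    qed auto
    then show ?thesis by (simp add: mom_def mult.assoc)
  qed
  have c_0: "AE x in L. c 0 x = c0 x"
  proof -
    have "approx n 0 = c0" for n by (simp add: approx_def)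
    then have "(\<lambda>n. LINT x|L. \<bar>c0 x - c 0 x\<bar>) \<longlonglongrightarrow> 0" using lim[of 0] by simp
    then have "(dist1 c0 (c 0)) = 0" by (simp add: LIMSEQ_const_iff)
    then have "AE x in L. \<bar>c0 x - c 0 x\<bar> = 0"
      using ci[of 0] stateD(3)[OF c0] by (subst (asm) integral_nonneg_eq_0_iff_AE) auto
    then show ?thesis by eventually_elim simp
  qed
  have time: "(dist1 (c t) (c s)) \<le> (t - s) * (4 * S * (A T)\<^sup>2)" if "0 \<le> s" "s \<le> t" "t \<le> T" for s t T
  proof (rule LIMSEQ_le_const)
    have t: "0 \<le> t" using that by simp
    have "(\<lambda>n. dt (r n)) \<longlonglongrightarrow> 0" using LIMSEQ_subseq_LIMSEQ[OF dt_tendsto r] by (simp add: o_def)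
    then have "(\<lambda>n. (dist1 (approx (r n) t) (c t)) + (dist1 (approx (r n) s) (c s)) + (t - s + dt (r n)) * (4 * S * (A T)\<^sup>2))
       \<longlonglongrightarrow> 0 + 0 + (t - s + 0) * (4 * S * (A T)\<^sup>2)"
      by (intro tendsto_intros lim t that)
    then show "(\<lambda>n. (dist1 (approx (r n) t) (c t)) + (dist1 (approx (r n) s) (c s)) + (t - s + dt (r n)) * (4 * S * (A T)\<^sup>2))
       \<longlonglongrightarrow> (t - s) * (4 * S * (A T)\<^sup>2)" by simp
    have "(dist1 (c t) (c s)) \<le> (dist1 (approx (r n) t) (c t)) + (dist1 (approx (r n) s) (c s)) + (t - s + dt (r n)) * (4 * S * (A T)\<^sup>2)" for n
    proof -
      note ints = approxD(3)[of "r n" t] approxD(3)[of "r n" s] ci[OF t] ci[OF that(1)]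
      have "(dist1 (c t) (c s)) \<le> (LINT x|L. (\<bar>approx (r n) t x - c t x\<bar> + \<bar>approx (r n) s x - c s x\<bar>) + \<bar>approx (r n) t x - approx (r n) s x\<bar>)"
        using ints by (intro integral_mono L1_intros) auto
      also have "\<dots> = (dist1 (approx (r n) t) (c t)) + (dist1 (approx (r n) s) (c s)) + (dist1 (approx (r n) t) (approx (r n) s))"
        using ints by simp
      finally show ?thesis using approx_time[OF that, of "r n"] by linarith
    qed
    then show "\<exists>N. \<forall>n\<ge>N. (dist1 (c t) (c s)) \<le> (dist1 (approx (r n) t) (c t)) + (dist1 (approx (r n) s) (c s)) + (t - s + dt (r n)) * (4 * S * (A T)\<^sup>2)"
      by blast
  qed
  have weak: "(\<lambda>s. indicator {0..t} s * coll (c s) f) \<in> borel_measurable L \<and>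
        (LINT x|L. f x * (c t x - c0 x)) = (LINT s|L. indicator {0..t} s * coll (c s) f)"
    if t: "0 \<le> t" and f: "f \<in> borel_measurable L" "\<And>x. \<bar>f x\<bar> \<le> B" for t f B
  proof -
    have B: "0 \<le> B" using f(2)[of 0] by simp
    define G where "G n s = kernel.coll (ktrunc (r n)) (approx (r n) s) f" for n s
    have G_conv: "(\<lambda>n. G n s) \<longlonglongrightarrow> coll (c s) f" if s: "0 \<le> s" "s \<le> t" for s
    proof (rule LIMSEQ_I)
      fix \<epsilon> :: real assume \<epsilon>: "0 < \<epsilon>"
      define C where "C = 16 * B * S * A t"
      have C: "0 \<le> C" using B A_nonneg by (simp add: C_def)
      define e where "e = \<epsilon> / (2 * (C + 1))"
      have e: "0 < e" using \<epsilon> C by (simp add: e_def)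
      obtain R where R: "R > 0" and Rt: "\<And>n s. 0 \<le> s \<Longrightarrow> s \<le> t \<Longrightarrow> (tail_mom l R (approx n s)) \<le> e"
        using approx_tail[OF t e] by blast
      define P where "P = R powr l * R powr l"
      define d where "d n = (dist1 (approx (r n) s) (c s))" for n
      have "(\<lambda>n. 4 * B * S * P * (M0 c0 + M0 (c s)) * d n) \<longlonglongrightarrow> 4 * B * S * P * (M0 c0 + M0 (c s)) * 0"
        unfolding d_def by (intro tendsto_intros lim s)
      then have "(\<lambda>n. 4 * B * S * P * (M0 c0 + M0 (c s)) * d n) \<longlonglongrightarrow> 0" by simp
      from order_tendstoD(2)[OF this, of "\<epsilon>/2"] \<epsilon> obtain N1 where
        N1: "\<And>n. n \<ge> N1 \<Longrightarrow> 4 * B * S * P * (M0 c0 + M0 (c s)) * d n < \<epsilon>/2"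
        by (auto simp: eventually_sequentially)
      obtain N2 where N2: "P \<le> real N2" using real_arch_simple by blast
      have "norm (G n s - coll (c s) f) < \<epsilon>" if n: "n \<ge> max N1 N2" for n
      proof -
        have "real N2 \<le> real (r n)" using n seq_suble[OF r, of n] by simp
        then have P: "R powr l * R powr l \<le> real (r n)" using N2 by (simp add: P_def)
        have d0: "0 \<le> d n" by (simp add: d_def)
        have mc: "0 \<le> M0 (c s)" using c_nonneg[OF s(1)] by simp
        have "\<bar>G n s - coll (c s) f\<bar> \<le> 4 * B * (S * (R powr l * R powr l * ((M0 (approx (r n) s) + M0 (c s)) * (dist1 (approx (r n) s) (c s))) + 4 * e * A t))"
          unfolding G_def using s R
          by (intro coll_diff approx_state st f approx_Ml P Rt tails) (use Ml_c in auto)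
        also have "\<dots> = 4 * B * (S * (P * ((M0 (approx (r n) s) + M0 (c s)) * d n) + 4 * e * A t))"
          by (simp add: P_def d_def)
        also have "\<dots> \<le> 4 * B * (S * (P * ((M0 c0 + M0 (c s)) * d n) + 4 * e * A t))"
          using approx_M0[of "r n" s] B d0 by (intro mult_left_mono add_right_mono mult_right_mono) (auto simp: P_def)
        also have "\<dots> = 4 * B * S * P * (M0 c0 + M0 (c s)) * d n + C * e" by (simp add: C_def algebra_simps)
        also have "\<dots> < \<epsilon>/2 + \<epsilon>/2"
        proof (rule add_less_le_mono)
          show "4 * B * S * P * (M0 c0 + M0 (c s)) * d n < \<epsilon>/2" using n by (intro N1) simp
          show "C * e \<le> \<epsilon>/2" using C \<epsilon> by (simp add: e_def field_simps)
        qed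
        finally show ?thesis by simp
      qed
      then show "\<exists>N. \<forall>n\<ge>N. norm (G n s - coll (c s) f) < \<epsilon>" by blast
    qed
    \<comment> \<open>The sum in \<open>euler_weak\<close> covers completed steps only, so
      \<open>H n\<close> is cut off at the last grid point not after \<open>t\<close>.\<close>
    define J where "J n = nat \<lfloor>t / dt (r n)\<rfloor>" for n
    define H where "H n s = indicator {0..<dt (r n) * real (J n)} s * G n s" for n s
    have G_eq: "G n s = (\<lambda>j. kernel.coll (ktrunc (r n)) (euler (ktrunc (r n)) (dt (r n)) c0 j) f) (nat \<lfloor>s / dt (r n)\<rfloor>)" for n s
      by (simp add: G_def approx_def)
    have Gm [measurable]: "G n \<in> borel_measurable L" for n
    proof -
      have "(\<lambda>s. nat \<lfloor>s / dt (r n)\<rfloor>) \<in> measurable L (count_space UNIV)" by measurable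
      from measurable_compose[OF this, of "\<lambda>j. kernel.coll (ktrunc (r n)) (euler (ktrunc (r n)) (dt (r n)) c0 j) f" borel]
      show ?thesis unfolding G_eq[abs_def] by simp
    qed
    have Jle: "dt (r n) * real (J n) \<le> t" "t \<le> dt (r n) * real (J n) + dt (r n)" for n
      unfolding J_def using index_le[OF t, of "r n"] index_ge[of t "r n"] by auto
    have Hint: "(LINT s|L. H n s) = (LINT x|L. f x * approx (r n) t x) - (LINT x|L. f x * c0 x)" for n
    proof -
      have "(LINT s|L. H n s) = dt (r n) * (\<Sum>j<J n. kernel.coll (ktrunc (r n)) (euler (ktrunc (r n)) (dt (r n)) c0 j) f)"
        unfolding H_def G_eq by (rule step_function_integral(2)[OF dt_pos])
      also have "\<dots> = (LINT x|L. f x * approx (r n) t x) - (LINT x|L. f x * c0 x)"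
        unfolding approx_def J_def by (rule euler_scheme.euler_weak[OF scheme f, symmetric])
      finally show ?thesis .
    qed
    \<comment> \<open>Measurability in time is inherited from the step functions
      \<open>G n\<close>.\<close>
    have m: "(\<lambda>s. indicator {0..t} s * coll (c s) f) \<in> borel_measurable L"
    proof (rule borel_measurable_LIMSEQ_real)
      show "(\<lambda>s. indicator {0..t} s * G n s) \<in> borel_measurable L" for n by measurable
      show "(\<lambda>n. indicator {0..t} s * G n s) \<longlonglongrightarrow> indicator {0..t} s * coll (c s) f" for s
        using G_conv[of s] by (cases "s \<in> {0..t}") auto
    qed
    have "(\<lambda>n. LINT s|L. H n s) \<longlonglongrightarrow> (LINT s|L. indicator {0..t} s * coll (c s) f)"
    proof (rule integral_dominated_convergence[where w="\<lambda>s. indicator {0..t} s * (4 * B * (S * (A t)\<^sup>2))"])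
      show "H n \<in> borel_measurable L" for n unfolding H_def by measurable
      show "integrable L (\<lambda>s. indicator {0..t} s * (4 * B * (S * (A t)\<^sup>2)))"
        using t by (intro integrable_mult_left integrable_real_indicator) auto
      show "AE s in L. norm (H n s) \<le> indicator {0..t} s * (4 * B * (S * (A t)\<^sup>2))" for n
      proof (rule AE_I2)
        fix s
        show "norm (H n s) \<le> indicator {0..t} s * (4 * B * (S * (A t)\<^sup>2))"
        proof (cases "s \<in> {0..<dt (r n) * real (J n)}")
          case True
          then have s: "0 \<le> s" "s \<le> t" using Jle[of n] by auto
          interpret bk: bounded_kernel "ktrunc (r n)" \<psi> l \<alpha> "real (r n)" by (rule truncation)
          have "\<bar>G n s\<bar> \<le> 4 * B * (S * (Ml (approx (r n) s))\<^sup>2)"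
            unfolding G_def by (rule bk.coll_abs_le[OF approx_state f])
          also have "\<dots> \<le> 4 * B * (S * (A t)\<^sup>2)"
          proof (intro mult_left_mono power_mono approx_Ml s)
            show "0 \<le> Ml (approx (r n) s)" using approxD(2) by (intro mom_nonneg) auto
          qed (use B in auto)
          finally show ?thesis using True s by (simp add: H_def)
        next
          case False
          then show ?thesis using B by (auto simp: H_def indicator_def)
        qed
      qed
      \<comment> \<open>For \<open>s < t\<close> the cut-off point eventually exceeds
        \<open>s\<close>. At \<open>s = t\<close> it never does, so this single time is
        discarded.\<close>
      have "AE s in L. s \<noteq> t" by (rule AE_lborel_singleton)
      then show "AE s in L. (\<lambda>n. H n s) \<longlonglongrightarrow> indicator {0..t} s * coll (c s) f"
      proof eventually_elim
        case (elim s)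
        show ?case
        proof (cases "s \<in> {0..t}")
          case True
          then have s: "0 \<le> s" "s < t" using elim by auto
          have "(\<lambda>n. dt (r n)) \<longlonglongrightarrow> 0" using LIMSEQ_subseq_LIMSEQ[OF dt_tendsto r] by (simp add: o_def)
          from order_tendstoD(2)[OF this, of "t - s"] s have "eventually (\<lambda>n. dt (r n) < t - s) sequentially" by simp
          then have ev: "eventually (\<lambda>n. G n s = H n s) sequentially"
          proof eventually_elim
            case (elim n)
            then show ?case using Jle(2)[of n] s by (simp add: H_def)
          qed
          have "(\<lambda>n. G n s) \<longlonglongrightarrow> coll (c s) f" using s by (intro G_conv) auto
          from Lim_transform_eventually[OF this ev] have "(\<lambda>n. H n s) \<longlonglongrightarrow> coll (c s) f" .
          then show ?thesis using True by simp
        next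
          case False
          then have "H n s = 0" for n using Jle(1)[of n] by (auto simp: H_def)
          then show ?thesis using False by simp
        qed
      qed
    qed (use m in simp)
    moreover have "(\<lambda>n. LINT s|L. H n s) \<longlonglongrightarrow> (LINT x|L. f x * c t x) - (LINT x|L. f x * c0 x)"
      unfolding Hint using t by (intro tendsto_intros L1_limit_integral[OF approxD(3) _ _ f] ci lim)
    ultimately have "(LINT s|L. indicator {0..t} s * coll (c s) f) = (LINT x|L. f x * c t x) - (LINT x|L. f x * c0 x)"
      by (rule LIMSEQ_unique)
    also have "\<dots> = (LINT x|L. f x * (c t x - c0 x))"
    proof -
      have "integrable L (\<lambda>x. f x * c t x)" "integrable L (\<lambda>x. f x * c0 x)"
        using integrable_bounded_mult[OF f ci[OF t]] integrable_bounded_mult[OF f stateD(3)[OF c0]] by auto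
      then show ?thesis by (simp add: right_diff_distrib)
    qed
    finally show ?thesis using m by simp
  qed
  show ?thesis
  proof (intro exI[of _ c] conjI allI impI)
    fix T t :: real assume t: "0 \<le> t" "t \<le> T"
    show "Ml (c t) \<le> A T" using Ml_c[OF t] by simp
    show "Ms (c t) \<le> W T" using Ms_c[OF t] by simp
  next
    fix t :: real and f :: "real \<Rightarrow> real" and B
    assume t: "0 \<le> t" and f: "f \<in> borel_measurable L" "\<forall>x. \<bar>f x\<bar> \<le> B"
    have fB: "\<bar>f x\<bar> \<le> B" for x using f(2) by simp
    show "(\<lambda>s. indicator {0..t} s * coll (c s) f) \<in> borel_measurable L"
      using weak[OF t f(1) fB] by simp
    show "(LINT x|L. f x * (c t x - c0 x)) = (LINT s|L. indicator {0..t} s * coll (c s) f)"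
      using weak[OF t f(1) fB] by simp
  qed (rule st c_0 time; assumption)+
qed

end

section \<open>Reduction to Borel data\<close>

text \<open>The bridge between \<open>lebesgue_on\<close> and Borel functions on the whole space.
  Measurability of \<open>f\<close> on \<open>S\<close> comes from that of \<open>g\<close>, because
  Lebesgue measure is complete.\<close>

lemma
  fixes f g :: "'a::euclidean_space \<Rightarrow> real"
  assumes S: "S \<in> sets borel" and g: "g \<in> borel_measurable lborel"
    and eq: "AE x in lborel. (if x \<in> S then f x else 0) = g x"
  shows lebesgue_on_integrable_iff: "integrable (lebesgue_on S) f \<longleftrightarrow> integrable lborel g"
    and lebesgue_on_integral_eq: "integral\<^sup>L (lebesgue_on S) f = integral\<^sup>L lborel g"
proof -
  have S': "S \<inter> space lebesgue \<in> sets lebesgue" using S by simp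
  have gl: "g \<in> borel_measurable lebesgue" using g by (rule measurable_completion)
  have ae: "AE x in lebesgue. g x = indicator S x *\<^sub>R f x"
    unfolding AE_completion_iff using eq by eventually_elim (auto simp: indicator_def split: if_splits)
  have m: "(\<lambda>x. indicator S x *\<^sub>R f x) \<in> borel_measurable lebesgue"
    by (rule borel_measurable_AE[OF gl ae])
  have "integrable (lebesgue_on S) f \<longleftrightarrow> integrable lebesgue g"
    unfolding integrable_restrict_space[OF S'] using ae m gl by (intro integrable_cong_AE) (auto elim: eventually_mono)
  then show "integrable (lebesgue_on S) f \<longleftrightarrow> integrable lborel g"
    using integrable_completion[OF g] by simp
  have "integral\<^sup>L (lebesgue_on S) f = integral\<^sup>L lebesgue g"
    unfolding integral_restrict_space[OF S'] using ae m gl by (intro integral_cong_AE) (auto elim: eventually_mono)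
  then show "integral\<^sup>L (lebesgue_on S) f = integral\<^sup>L lborel g"
    using integral_completion[OF g] by simp
qed

lemma lebesgue_on_nn_integral_eq:
  fixes f g :: "'a::euclidean_space \<Rightarrow> ennreal"
  assumes S: "S \<in> sets borel" and eq: "AE x in lborel. (if x \<in> S then f x else 0) = g x"
  shows "integral\<^sup>N (lebesgue_on S) f = integral\<^sup>N lborel g"
proof -
  have S': "S \<inter> space lebesgue \<in> sets lebesgue" using S by simp
  have "integral\<^sup>N (lebesgue_on S) f = (\<integral>\<^sup>+x. f x * indicator S x \<partial>lborel)"
    unfolding nn_integral_restrict_space[OF S'] nn_integral_completion ..
  also have "\<dots> = integral\<^sup>N lborel g"
  proof (rule nn_integral_cong_AE)
    show "AE x in lborel. f x * indicator S x = g x"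
      using eq by eventually_elim (auto simp: indicator_def split: if_splits)
  qed
  finally show ?thesis .
qed

lemma AE_lebesgue_on_iff:
  "S \<in> sets borel \<Longrightarrow> (AE x in lebesgue_on S. P x) \<longleftrightarrow> (AE x in lborel. x \<in> S \<longrightarrow> P x)"
  by (subst AE_restrict_space_iff) (auto simp: AE_completion_iff)

lemma Borel_version:
  fixes f :: "'a::euclidean_space \<Rightarrow> real"
  assumes S: "S \<in> sets borel" and f: "f \<in> borel_measurable (lebesgue_on S)"
  obtains g where "g \<in> borel_measurable lborel" "AE x in lborel. (if x \<in> S then f x else 0) = g x"
proof -
  have S': "S \<inter> space lebesgue \<in> sets lebesgue" using S by simp
  have "(\<lambda>x. indicator S x *\<^sub>R f x) \<in> borel_measurable lebesgue"
    using f by (subst (asm) borel_measurable_restrict_space_iff[OF S'])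
  from completion_ex_borel_measurable_real[OF this] obtain g where g: "g \<in> borel_measurable lborel"
    "AE x in lborel. indicator S x *\<^sub>R f x = g x" by auto
  have "AE x in lborel. (if x \<in> S then f x else 0) = g x"
    using g(2) by eventually_elim (auto simp: indicator_def)
  then show thesis using g(1) that by blast
qed

section \<open>Almost everywhere statements on the product space\<close>

lemma AE_triple:
  assumes "Measurable.pred L3 P" and "AE x in L. AE y in L. AE z in L. P (x, y, z)"
  shows "AE p in L3. P p"
proof -
  show ?thesis
  proof (rule lborel3.AE_pair_measure)
    show "{p \<in> space L3. P p} \<in> sets L3" using assms(1) by (simp add: pred_def)
    show "AE x in L. AE q in L2. P (x, q)"
      using assms(2)
    proof eventually_elim
      case (elim x)
      have "Measurable.pred L2 (\<lambda>q. P (x, q))"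
        by (rule measurable_compose[OF _ assms(1)]) simp
      then show ?case using elim by (intro lborel_pair.AE_pair_measure) (auto simp: pred_def)
    qed
  qed
qed

lemma AE_shift: "AE x in L. P x \<Longrightarrow> AE x in L. P (x + h)"
proof -
  assume ae: "AE x in L. P x"
  have "AE x in distr L borel ((+) h). P x" unfolding lborel_distr_plus by (rule ae)
  from AE_distrD[OF _ this] show ?thesis by (simp add: add.commute)
qed

text \<open>Lower bounds on the first derivative come from nonnegativity: a function that is decreasing
  too fast at \<open>x\<close> and whose second derivative is at most \<open>B\<close> would be negative at \<open>2 x\<close>.\<close>

lemma semiconcave_bounds:
  fixes f f' :: "real \<Rightarrow> real"
  assumes d1: "\<And>u. 0 \<le> u \<Longrightarrow> (f has_real_derivative f' u) (at u within Rplus)"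
    and d2: "\<And>u. 0 \<le> u \<Longrightarrow> \<exists>D\<le>B. (f' has_real_derivative D) (at u within Rplus)"
    and nonneg: "\<And>u. 0 \<le> u \<Longrightarrow> 0 \<le> f u" and zero: "\<And>u. 0 \<le> u \<Longrightarrow> u < z \<Longrightarrow> f u = 0" and z: "0 < z"
    and B: "0 \<le> B"
  shows semiconcave_growth: "0 \<le> x \<Longrightarrow> f x \<le> B * x * x"
    and semiconcave_Lipschitz: "0 \<le> x \<Longrightarrow> x \<le> y \<Longrightarrow> \<bar>f y - f x\<bar> \<le> 2 * B * y * (y - x)"
proof -
  have mvt: "\<exists>\<xi>. a < \<xi> \<and> \<xi> < b \<and> g b - g a = g' \<xi> * (b - a)"
    if ab: "0 \<le> a" "a < b" and g: "\<And>u. 0 \<le> u \<Longrightarrow> (g has_real_derivative g' u) (at u within Rplus)"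
    for a b :: real and g g' :: "real \<Rightarrow> real"
  proof -
    have "(g has_derivative (\<lambda>h. g' x * h)) (at x within {a..b})" if "a \<le> x" "x \<le> b" for x
    proof -
      have "(g has_real_derivative g' x) (at x within {a..b})"
        using ab that by (intro DERIV_subset[OF g]) auto
      then show ?thesis by (simp add: has_field_derivative_def)
    qed
    from mvt_simple[OF ab(2) this] show ?thesis by auto
  qed
  obtain D where D: "\<And>u. 0 \<le> u \<Longrightarrow> D u \<le> B \<and> (f' has_real_derivative D u) (at u within Rplus)"
    using d2 by metis
  have slope: "f' v - f' u \<le> B * (v - u)" if u: "0 \<le> u" "u \<le> v" for u v
  proof (cases "u = v")
    case False
    with u have uv: "u < v" by simp
    have dD: "0 \<le> w \<Longrightarrow> (f' has_real_derivative D w) (at w within Rplus)" for w using D by simp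
    obtain \<xi> where "u < \<xi>" "\<xi> < v" "f' v - f' u = D \<xi> * (v - u)"
      using mvt[of u v f' D, OF u(1) uv dD] by blast
    then show ?thesis using D[of \<xi>] u by (simp add: mult_right_mono)
  qed simp
  have upper: "f' x \<le> B * x" if "0 < x" for x
  proof -
    \<comment> \<open>As \<open>f\<close> vanishes below \<open>z\<close>, the derivative is 0 at
      some point in \<open>(0, b)\<close>; the bound on the second derivative from there to
      \<open>x\<close> gives \<open>B * x\<close>.\<close>
    define b where "b = min x z / 2"
    have b: "0 < b" "b < z" "b < x" using that z by (auto simp: b_def min_def)
    obtain \<xi> where xi: "0 < \<xi>" "\<xi> < b" "f b - f 0 = f' \<xi> * (b - 0)" using mvt[of 0 b f f'] b d1 by blast
    then have "f' \<xi> = 0" using zero[of b] zero[of 0] b z by simp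
    then have "f' x \<le> B * (x - \<xi>)" using slope[of \<xi> x] xi b by simp
    also have "\<dots> \<le> B * x" using xi B by (intro mult_left_mono) auto
    finally show ?thesis .
  qed
  have growth: "f x \<le> B * x * x" if x: "0 \<le> x" for x
  proof (cases "x = 0")
    case False
    with x have x: "0 < x" by simp
    obtain \<xi> where xi: "0 < \<xi>" "\<xi> < x" "f x - f 0 = f' \<xi> * (x - 0)" using mvt[of 0 x f f'] x d1 by blast
    have "f' \<xi> \<le> B * x" using upper[OF xi(1)] mult_left_mono[of \<xi> x B] xi B by linarith
    then have "f' \<xi> * x \<le> B * x * x" using x by (intro mult_right_mono) auto
    then show ?thesis using xi zero[of 0] z by simp
  qed (use zero[of 0] z in simp)
  then show "0 \<le> x \<Longrightarrow> f x \<le> B * x * x" .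
  have lower: "- (2 * B * x) \<le> f' x" if x: "0 < x" for x
  proof -
    \<comment> \<open>Since \<open>f (2 * x) \<ge> 0\<close> and \<open>f x \<le> B * x * x\<close>,
      the derivative at \<open>\<xi>\<close> is at least \<open>- B * x\<close>. Going back to
      \<open>x\<close> costs another \<open>B * x\<close>, whence the factor 2.\<close>
    obtain \<xi> where xi: "x < \<xi>" "\<xi> < 2 * x" "f (2 * x) - f x = f' \<xi> * (2 * x - x)" using mvt[of x "2 * x" f f'] x d1 by force
    have "f' \<xi> \<le> f' x + B * (\<xi> - x)" using slope[of x \<xi>] xi x by simp
    also have "\<dots> \<le> f' x + B * x" using xi B by (intro add_left_mono mult_left_mono) auto
    finally have "f' \<xi> * x \<le> (f' x + B * x) * x" using x by (intro mult_right_mono) auto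
    moreover have "- (B * x * x) \<le> f' \<xi> * x" using xi(3) growth[of x] nonneg[of "2 * x"] x by simp
    ultimately have "- (2 * B * x) * x \<le> f' x * x" by (simp add: algebra_simps)
    then show ?thesis using x by (simp only: mult_le_cancel_right_pos)
  qed
  show "\<bar>f y - f x\<bar> \<le> 2 * B * y * (y - x)" if x: "0 \<le> x" "x \<le> y"
  proof (cases "x = y")
    case False
    with x have xy: "x < y" by simp
    obtain \<xi> where xi: "x < \<xi>" "\<xi> < y" "f y - f x = f' \<xi> * (y - x)" using mvt[of x y f f'] x xy d1 by blast
    have "B * \<xi> \<le> B * y" using xi B by (intro mult_left_mono) auto
    moreover have "0 \<le> B * \<xi>" using xi B x by simp
    ultimately have "\<bar>f' \<xi>\<bar> \<le> 2 * B * y" using upper[of \<xi>] lower[of \<xi>] xi x by (simp add: abs_le_iff)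
    then have "\<bar>f' \<xi>\<bar> * (y - x) \<le> 2 * B * y * (y - x)" using x by (intro mult_right_mono) auto
    then show ?thesis using x xi(3) by (simp add: abs_mult)
  qed simp
qed

text \<open>\<open>has_second_derivative\<close> permits another first derivative for every point
  \<open>x\<close>. Uniqueness of derivatives within the half-line, one-sided at 0, shows that they
  all agree.\<close>

lemma has_second_derivative_common:
  assumes "\<And>x. 0 \<le> x \<Longrightarrow> \<exists>D. has_second_derivative f D x \<and> Q D"
  obtains f' where "\<And>u. 0 \<le> u \<Longrightarrow> (f has_real_derivative f' u) (at u within Rplus)"
    "\<And>u. 0 \<le> u \<Longrightarrow> \<exists>D. Q D \<and> (f' has_real_derivative D) (at u within Rplus)"
proof -
  obtain D0 where "has_second_derivative f D0 0" using assms[of 0] by auto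
  then obtain f' where f': "\<And>u. 0 \<le> u \<Longrightarrow> (f has_real_derivative f' u) (at u within Rplus)"
    by (auto simp: has_second_derivative_def)
  have "\<exists>D. Q D \<and> (f' has_real_derivative D) (at x within Rplus)" if x: "0 \<le> x" for x
  proof -
    obtain D g where D: "Q D" and g: "\<And>u. 0 \<le> u \<Longrightarrow> (f has_real_derivative g u) (at u within Rplus)"
      and gD: "(g has_real_derivative D) (at x within Rplus)"
      using assms[OF x] by (auto simp: has_second_derivative_def)
    have eq: "g u = f' u" if u: "0 \<le> u" for u
    proof (rule has_field_derivative_unique[OF g[OF u] f'[OF u]])
      have "at_right u \<le> at u within Rplus" using u by (intro at_le) auto
      then show "at u within Rplus \<noteq> bot"
        using trivial_limit_at_right_real[of u] bot.extremum_uniqueI by metis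
    qed
    have "(f' has_real_derivative D) (at x within Rplus)"
      by (rule has_field_derivative_transform_within[OF gD, of 1]) (use x eq in auto)
    then show ?thesis using D by blast
  qed
  with f' show thesis using that by blast
qed

text \<open>By symmetry let \<open>Y\<close> be the smaller base. If its exponent \<open>b\<close>
  exceeds 1, the excess \<open>b - 1\<close> may be moved to \<open>X\<close>, whose exponent
  becomes \<open>a + b - 1 \<le> l\<close>.\<close>

lemma powr_product_le:
  fixes X Y a b l :: real
  assumes XY: "1 \<le> X" "1 \<le> Y" and ab: "a \<le> l" "b \<le> l" "a + b \<le> l + 1"
  shows "X powr a * Y powr b \<le> X powr l * Y + X * Y powr l"
proof -
  have aux: "U powr p * V powr q \<le> U powr l * V"
    if UV: "1 \<le> V" "V \<le> U" and pq: "p \<le> l" "q \<le> l" "p + q \<le> l + 1" for U V p q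
  proof (cases "q \<le> 1")
    case True
    have "V powr q \<le> V powr 1" using True UV by (intro powr_mono) auto
    moreover have "U powr p \<le> U powr l" using UV pq by (intro powr_mono) auto
    ultimately show ?thesis using UV by (intro mult_mono) auto
  next
    case False
    have "V powr q = V powr (q - 1) * V" using UV by (simp add: powr_diff)
    also have "\<dots> \<le> U powr (q - 1) * V" using False UV by (intro mult_right_mono powr_mono2) auto
    finally have "U powr p * V powr q \<le> U powr p * (U powr (q - 1) * V)" by (intro mult_left_mono) auto
    also have "\<dots> = U powr (p + q - 1) * V" by (simp add: powr_add[symmetric] mult.assoc[symmetric] add_diff_eq)
    also have "\<dots> \<le> U powr l * V" using UV pq by (intro mult_right_mono powr_mono) auto
    finally show ?thesis .
  qed
  show ?thesis
  proof (cases "Y \<le> X")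
    case True
    have "X powr a * Y powr b \<le> X powr l * Y" using True XY ab by (intro aux) auto
    moreover have "0 \<le> X * Y powr l" using XY by simp
    ultimately show ?thesis by linarith
  next
    case False
    have "Y powr b * X powr a \<le> Y powr l * X" using False XY ab by (intro aux) auto
    moreover have "0 \<le> X powr l * Y" using XY by simp
    ultimately show ?thesis by (simp add: mult.commute)
  qed
qed

lemma L3_eq: "L3 = lborel" by (simp add: lborel_prod)

text \<open>The exceptional set of \<open>P\<close> is enclosed in a Borel null set
  \<open>N\<close>. Its preimage is measurable, which permits the passage from iterated to joint
  almost everywhere statements.\<close>

lemma AE_triple_comp:
  assumes P: "AE w in L. P w" and g [measurable]: "g \<in> measurable L3 L"
    and null: "\<And>N. AE w in L. w \<notin> N \<Longrightarrow> AE x in L. AE y in L. AE z in L. g (x, y, z) \<notin> N"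
  shows "AE p in L3. P (g p)"
proof -
  from P obtain N where N: "{w \<in> space L. \<not> P w} \<subseteq> N" "N \<in> null_sets L"
    unfolding eventually_ae_filter by blast
  then have nN: "AE w in L. w \<notin> N" by (intro AE_not_in)
  have [measurable]: "N \<in> sets L" using N(2) by auto
  have "Measurable.pred L3 (\<lambda>p. g p \<notin> N)" by measurable
  then have "AE p in L3. g p \<notin> N" using null[OF nN] by (rule AE_triple)
  then show ?thesis by eventually_elim (use N(1) in auto)
qed

lemma AE_triple_fst: "AE w in L. P w \<Longrightarrow> AE (x, y, z) in L3. P x"
proof -
  assume "AE w in L. P w"
  then have "AE p in L3. P ((\<lambda>p. fst p) p)"
    by (rule AE_triple_comp) (auto elim: eventually_mono)
  then show ?thesis by (simp add: case_prod_unfold)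
qed

lemma AE_triple_snd: "AE w in L. P w \<Longrightarrow> AE (x, y, z) in L3. P y"
proof -
  assume "AE w in L. P w"
  then have "AE p in L3. P ((\<lambda>p. fst (snd p)) p)"
  proof (rule AE_triple_comp)
    fix N assume "AE w in L. w \<notin> (N :: real set)"
    then have "AE y in L. AE z in L. y \<notin> N" by eventually_elim simp
    then show "AE x in L. AE y in L. AE z in L. fst (snd (x, y, z)) \<notin> N" by simp
  qed measurable
  then show ?thesis by (simp add: case_prod_unfold)
qed

lemma AE_triple_thd: "AE w in L. P w \<Longrightarrow> AE (x, y, z) in L3. P z"
proof -
  assume "AE w in L. P w"
  then have "AE p in L3. P ((\<lambda>p. snd (snd p)) p)"
    by (rule AE_triple_comp) (auto elim: eventually_mono)
  then show ?thesis by (simp add: case_prod_unfold)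
qed

text \<open>Needed because \<open>Delta\<close> evaluates test functions at \<open>x + z\<close>;
  for fixed \<open>x\<close> this is a translation in \<open>z\<close> and preserves null
  sets.\<close>

lemma AE_triple_add: "AE w in L. P w \<Longrightarrow> AE (x, y, z) in L3. P (x + z)"
proof -
  assume "AE w in L. P w"
  then have "AE p in L3. P ((\<lambda>p. fst p + snd (snd p)) p)"
  proof (rule AE_triple_comp)
    fix N assume "AE w in L. w \<notin> (N :: real set)"
    then have "AE z in L. x + z \<notin> N" for x using AE_shift[of "\<lambda>w. w \<notin> N" x] by (simp add: add.commute)
    then show "AE x in L. AE y in L. AE z in L. fst (x, y, z) + snd (snd (x, y, z)) \<notin> N" by simp
  qed measurable
  then show ?thesis by (simp add: case_prod_unfold)
qed

lemma AE_reflect: "AE w in L. P w \<Longrightarrow> AE w in L. P (x - w)"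
proof -
  assume ae: "AE w in L. P w"
  have "AE w in distr L borel uminus. P w" unfolding lborel_distr_uminus by (rule ae)
  from AE_distrD[OF _ this] have "AE w in L. P (- w)" by simp
  from AE_shift[OF this, of "- x"] show ?thesis by simp
qed

lemma AE_triple_diff: "AE w in L. P w \<Longrightarrow> AE (x, y, z) in L3. P (x - z)"
proof -
  assume "AE w in L. P w"
  then have "AE p in L3. P ((\<lambda>p. fst p - snd (snd p)) p)"
  proof (rule AE_triple_comp)
    fix N assume "AE w in L. w \<notin> (N :: real set)"
    then have "AE z in L. x - z \<notin> N" for x by (rule AE_reflect)
    then show "AE x in L. AE y in L. AE z in L. fst (x, y, z) - snd (snd (x, y, z)) \<notin> N" by simp
  qed measurable
  then show ?thesis by (simp add: case_prod_unfold)
qed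

lemma AE_triple_shift:
  assumes "AE (x, y, z) in L3. P x y z"
  shows "AE (x, y, z) in L3. P (x + h) y z"
proof -
  have d: "distr lborel borel ((+) (h, 0, 0)) = (lborel :: (real \<times> real \<times> real) measure)" by (rule lborel_distr_plus)
  have "AE p in distr lborel borel ((+) (h, 0, 0)). case p of (x, y, z) \<Rightarrow> P x y z"
    unfolding d using assms unfolding L3_eq .
  from AE_distrD[OF _ this] have "AE p in lborel. case (h, 0, 0) + p of (x, y, z) \<Rightarrow> P x y z" by simp
  then show ?thesis unfolding L3_eq by (simp add: case_prod_unfold add.commute)
qed

section \<open>Elementary bounds for the weights\<close>

lemma chk_le_br: "0 \<le> x \<Longrightarrow> chk x \<le> br x" and chk_ge_1: "1 \<le> chk x"
  by (auto simp: chk_def br_def)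

lemma hat_pos: "0 < x \<Longrightarrow> 0 < hat x" and hat_le_1: "hat x \<le> 1" and hat_mono: "x \<le> y \<Longrightarrow> hat x \<le> hat y"
  by (auto simp: hat_def)

lemma hat_powr_ge_1: "0 < x \<Longrightarrow> 0 \<le> a \<Longrightarrow> 1 \<le> hat x powr (- a)"
  using powr_mono2'[of "- a" "hat x" 1] hat_pos[of x] hat_le_1[of x] by simp

lemma hat_powr_mono: "0 < x \<Longrightarrow> x \<le> y \<Longrightarrow> 0 \<le> a \<Longrightarrow> hat y powr (- a) \<le> hat x powr (- a)"
  using powr_mono2'[of "- a" "hat x" "hat y"] hat_pos[of x] hat_mono[of x y] by simp

lemma hat_chk_powr_le:
  assumes "0 < y" "0 \<le> a" "0 \<le> l"
  shows "hat y powr (- a) * chk y powr l \<le> hat y powr (- a) + br y powr l"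
proof (cases "y \<le> 1")
  case True
  then show ?thesis by (simp add: chk_def)
next
  case False
  then have "chk y powr l \<le> br y powr l" using assms chk_le_br[of y] chk_ge_1[of y] by (intro powr_mono2) auto
  moreover have "hat y = 1" using False by (simp add: hat_def)
  ultimately show ?thesis by simp
qed

lemma Y_weight_measurable [measurable]: "Y_weight \<beta> r \<in> borel_measurable borel"
  unfolding Y_weight_def[abs_def] by measurable

text \<open>\<open>C\<close> is a parameter even for \<open>\<alpha> = 0\<close>, where every
  nonnegative value is admissible, so that \<open>mass\<close> has one form in both cases.\<close>

locale exchange_kernel =
  fixes K :: "real \<Rightarrow> real \<Rightarrow> real \<Rightarrow> real" and \<mu> \<nu> \<Lambda> \<alpha> C :: real and \<phi> :: "real \<Rightarrow> real"
  assumes K_meas: "(\<lambda>(x, y, z). K x y z) \<in> borel_measurable (lebesgue_on (Rplus \<times> Rplus \<times> Rplus))"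
    and K_nonneg: "\<And>x y z. x \<ge> 0 \<Longrightarrow> y \<ge> 0 \<Longrightarrow> z \<ge> 0 \<Longrightarrow> 0 \<le> K x y z"
    and K_sym: "\<And>x y z. x \<ge> 0 \<Longrightarrow> y \<ge> 0 \<Longrightarrow> z \<ge> 0 \<Longrightarrow> K x y z = K y x z"
    and K_supp: "\<And>x y z. x \<ge> 0 \<Longrightarrow> y \<ge> 0 \<Longrightarrow> z > x \<Longrightarrow> K x y z = 0"
    and mu: "0 \<le> \<mu>" "\<mu> \<le> 2"
    and nu: "0 \<le> \<nu>" "\<nu> \<le> 2"
    and mu_nu: "\<mu> + \<nu> \<le> 3"
    and Lambda: "\<Lambda> = max \<mu> \<nu>" "\<Lambda> > 1"
    and alpha: "\<alpha> \<ge> 0"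
    and phi: "\<phi> \<in> Y_plus (2 * \<alpha>) (2 * \<Lambda>)"
    and growth: "kernel_growth K \<mu> \<nu> \<alpha> \<phi>"
    and second_derivative: "kernel_second_derivative K \<alpha> \<Lambda> \<phi>"
    and C: "0 \<le> C"
    and singular: "\<alpha> > 0 \<Longrightarrow> kernel_singular K \<alpha> \<Lambda> C \<phi>"
begin

text \<open>The kernel lives on \<open>z \<le> min x y\<close>, where \<open>hat x powr (- \<alpha>) * hat y powr (- \<alpha>)\<close> and
  \<open>hat x powr (- 2 * \<alpha>)\<close> are at most \<open>hat z powr (- 2 * \<alpha>)\<close>; so the singularities can be moved to the
  integrable function of \<open>z\<close>. The factor \<open>1 + z\<^sup>2\<close> pays for second differences of moments.\<close>

definition mass :: "(real \<Rightarrow> real) \<Rightarrow> real \<Rightarrow> real" where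
  "mass f z = (if 0 < z then (2 + C) * ((1 + z\<^sup>2) * hat z powr (- 2 * \<alpha>)) * max 0 (f z) else 0)"

lemma mass_nonneg: "0 \<le> mass f z"
  using C by (simp add: mass_def)

text \<open>The prefactor \<open>(2 + C) * (1 + z\<^sup>2)\<close> dominates 1, 2,
  \<open>z\<^sup>2\<close>, \<open>1 + z\<^sup>2\<close> and \<open>C\<close>, so a single function
  of \<open>z\<close> serves the growth, Lipschitz and singular bounds.\<close>

lemma mass_ge:
  assumes "0 < z" "0 \<le> f z"
  shows "hat z powr (- 2 * \<alpha>) * f z \<le> mass f z" "2 * f z \<le> mass f z"
    and "z\<^sup>2 * (hat z powr (- 2 * \<alpha>) * f z) \<le> mass f z"
    and "(1 + z\<^sup>2) * (hat z powr (- 2 * \<alpha>) * f z) \<le> mass f z"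
    and "C * (hat z powr (- 2 * \<alpha>) * f z) \<le> mass f z"
proof -
  define q where "q = hat z powr (- 2 * \<alpha>) * f z"
  have q: "f z \<le> q" "0 \<le> q"
    unfolding q_def using assms hat_powr_ge_1[of z "2 * \<alpha>"] alpha mult_right_mono[of 1 "hat z powr (- (2 * \<alpha>))" "f z"] by auto
  have eq: "(2 + C) * ((1 + z\<^sup>2) * (hat z powr (- 2 * \<alpha>) * f z)) = mass f z"
    using assms by (simp add: mass_def mult.assoc)
  have m: "mass f z = (2 + C) * ((1 + z\<^sup>2) * q)" using eq by (simp add: q_def)
  have b: "a * q \<le> mass f z" if "a \<le> (2 + C) * (1 + z\<^sup>2)" for a
    using mult_right_mono[OF that q(2)] by (simp add: m mult.assoc)
  have z2: "0 \<le> C * z\<^sup>2" using C by simp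
  show "hat z powr (- 2 * \<alpha>) * f z \<le> mass f z" using b[of 1] z2 C unfolding q_def by (simp add: algebra_simps)
  have "2 * q \<le> mass f z" using z2 C by (intro b) (simp add: algebra_simps)
  then show "2 * f z \<le> mass f z" using q by linarith
  show "z\<^sup>2 * (hat z powr (- 2 * \<alpha>) * f z) \<le> mass f z" using z2 C unfolding q_def[symmetric] by (intro b) (simp add: algebra_simps)
  show "(1 + z\<^sup>2) * (hat z powr (- 2 * \<alpha>) * f z) \<le> mass f z" using z2 C unfolding q_def[symmetric] by (intro b) (simp add: algebra_simps)
  show "C * (hat z powr (- 2 * \<alpha>) * f z) \<le> mass f z" using z2 C unfolding q_def[symmetric] by (intro b) (simp add: algebra_simps)
qed

lemma lambda: "1 < \<Lambda>" "\<Lambda> \<le> 2" "\<mu> \<le> \<Lambda>" "\<nu> \<le> \<Lambda>"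
  using Lambda mu nu by auto

lemma K_basic:
  assumes z: "0 < z" "z \<le> x" "z \<le> y" and phi0: "0 \<le> \<phi> z"
  shows "K x y z \<le> (1/2 * (br x powr \<mu> * br y powr \<nu> + br x powr \<nu> * br y powr \<mu>)) * (hat z powr (- 2 * \<alpha>) * \<phi> z)"
proof -
  have xy: "0 < x" "0 < y" using z by auto
  have c: "chk x powr a * chk y powr b \<le> br x powr a * br y powr b" if "0 \<le> a" "0 \<le> b" for a b
    using that xy chk_le_br[of x] chk_le_br[of y] chk_ge_1[of x] chk_ge_1[of y] by (intro mult_mono powr_mono2) auto
  have "K x y z \<le> hat x powr (- \<alpha>) * hat y powr (- \<alpha>) * (1/2 * (chk x powr \<mu> * chk y powr \<nu> + chk x powr \<nu> * chk y powr \<mu>)) * \<phi> z"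
    using growth xy z by (simp add: kernel_growth_def)
  also have "\<dots> \<le> (hat z powr (- \<alpha>) * hat z powr (- \<alpha>)) * (1/2 * (br x powr \<mu> * br y powr \<nu> + br x powr \<nu> * br y powr \<mu>)) * \<phi> z"
  proof -
    have s: "1/2 * (chk x powr \<mu> * chk y powr \<nu> + chk x powr \<nu> * chk y powr \<mu>)
        \<le> 1/2 * (br x powr \<mu> * br y powr \<nu> + br x powr \<nu> * br y powr \<mu>)"
      using c[of \<mu> \<nu>] c[of \<nu> \<mu>] mu nu by simp
    have h: "hat x powr (- \<alpha>) * hat y powr (- \<alpha>) \<le> hat z powr (- \<alpha>) * hat z powr (- \<alpha>)"
      using z alpha by (intro mult_mono hat_powr_mono) auto
    show ?thesis by (intro mult_right_mono[OF mult_mono[OF h s]]) (use phi0 in auto)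
  qed
  also have "hat z powr (- \<alpha>) * hat z powr (- \<alpha>) = hat z powr (- 2 * \<alpha>)"
    by (simp add: powr_add[symmetric])
  finally show ?thesis by (simp add: mult_ac)
qed

lemma K_bounds:
  assumes z: "0 < z" "z \<le> x" "z \<le> y" and phi0: "0 \<le> \<phi> z"
  shows "z\<^sup>2 * K x y z * br x powr (\<Lambda> - 2) \<le> mass \<phi> z * (br x powr \<Lambda> * br y + br x * br y powr \<Lambda>)"
    and "(1 + z\<^sup>2) * K x y z \<le> mass \<phi> z * br x powr \<Lambda> * br y powr \<Lambda>"
    and "hat (x - z) powr (- \<alpha>) * K x y z \<le> mass \<phi> z * br x powr \<Lambda> * (hat y powr (- \<alpha>) + br y powr \<Lambda>)"
proof -
  define q where "q = hat z powr (- 2 * \<alpha>) * \<phi> z"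
  have q0: "0 \<le> q" using phi0 by (simp add: q_def)
  note mg = mass_ge[of z \<phi>, OF z(1) phi0, folded q_def]
  have xy: "0 < x" "0 < y" using z by auto
  have Kq: "K x y z \<le> (1/2 * (br x powr \<mu> * br y powr \<nu> + br x powr \<nu> * br y powr \<mu>)) * q"
    unfolding q_def by (rule K_basic[OF assms])
  have K0: "0 \<le> K x y z" using K_nonneg z by auto
  \<comment> \<open>The first exponent is at most \<open>\<Lambda>\<close> because
    \<open>a \<le> 2\<close>, and both together are at most \<open>\<Lambda> + 1\<close> because
    \<open>a + b \<le> 3\<close>; this is where \<open>\<mu> + \<nu> \<le> 3\<close> enters.\<close>
  have pp: "br x powr (a + \<Lambda> - 2) * br y powr b \<le> br x powr \<Lambda> * br y + br x * br y powr \<Lambda>"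
    if "a \<le> 2" "b \<le> \<Lambda>" "a + b \<le> 3" for a b
    using that br_ge_1 by (intro powr_product_le) auto
  have shift: "br x powr (\<Lambda> - 2) * br x powr a = br x powr (a + \<Lambda> - 2)" for a
    by (simp add: powr_add[symmetric] algebra_simps)
  have "br x powr (\<Lambda> - 2) * K x y z \<le> br x powr (\<Lambda> - 2) * ((1/2 * (br x powr \<mu> * br y powr \<nu> + br x powr \<nu> * br y powr \<mu>)) * q)"
    using Kq by (intro mult_left_mono) auto
  also have "\<dots> = (1/2 * (br x powr (\<mu> + \<Lambda> - 2) * br y powr \<nu> + br x powr (\<nu> + \<Lambda> - 2) * br y powr \<mu>)) * q"
    unfolding shift[symmetric] by (simp only: distrib_left distrib_right mult_ac)
  also have "\<dots> \<le> (br x powr \<Lambda> * br y + br x * br y powr \<Lambda>) * q"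
    using pp[of \<mu> \<nu>] pp[of \<nu> \<mu>] mu nu lambda mu_nu q0 by (intro mult_right_mono) auto
  finally have "z\<^sup>2 * (br x powr (\<Lambda> - 2) * K x y z) \<le> z\<^sup>2 * ((br x powr \<Lambda> * br y + br x * br y powr \<Lambda>) * q)"
    by (rule mult_left_mono) simp
  also have "\<dots> = (z\<^sup>2 * q) * (br x powr \<Lambda> * br y + br x * br y powr \<Lambda>)" by simp
  also have "\<dots> \<le> mass \<phi> z * (br x powr \<Lambda> * br y + br x * br y powr \<Lambda>)"
    using mg(3) by (intro mult_right_mono) auto
  finally show "z\<^sup>2 * K x y z * br x powr (\<Lambda> - 2) \<le> mass \<phi> z * (br x powr \<Lambda> * br y + br x * br y powr \<Lambda>)"
    by (simp add: mult_ac)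
  have pl: "br x powr a * br y powr b \<le> br x powr \<Lambda> * br y powr \<Lambda>" if "a \<le> \<Lambda>" "b \<le> \<Lambda>" for a b
    using that br_ge_1 by (intro mult_mono powr_mono) auto
  have Kl: "K x y z \<le> (br x powr \<Lambda> * br y powr \<Lambda>) * q"
  proof -
    have "(1/2 * (br x powr \<mu> * br y powr \<nu> + br x powr \<nu> * br y powr \<mu>)) * q \<le> (br x powr \<Lambda> * br y powr \<Lambda>) * q"
      using pl[of \<mu> \<nu>] pl[of \<nu> \<mu>] lambda q0 by (intro mult_right_mono) auto
    with Kq show ?thesis by linarith
  qed
  have "(1 + z\<^sup>2) * K x y z \<le> (1 + z\<^sup>2) * ((br x powr \<Lambda> * br y powr \<Lambda>) * q)"
    using Kl by (intro mult_left_mono) auto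
  also have "\<dots> = ((1 + z\<^sup>2) * q) * (br x powr \<Lambda> * br y powr \<Lambda>)" by simp
  also have "\<dots> \<le> mass \<phi> z * (br x powr \<Lambda> * br y powr \<Lambda>)"
    using mg(4) by (intro mult_right_mono) auto
  finally show "(1 + z\<^sup>2) * K x y z \<le> mass \<phi> z * br x powr \<Lambda> * br y powr \<Lambda>" by (simp add: mult_ac)
  show "hat (x - z) powr (- \<alpha>) * K x y z \<le> mass \<phi> z * br x powr \<Lambda> * (hat y powr (- \<alpha>) + br y powr \<Lambda>)"
  proof (cases "x = z")
    case True
    \<comment> \<open>On the diagonal the left-hand side is 0, by the convention that 0 to any power
      under \<open>powr\<close> is 0.\<close>
    then show ?thesis using mass_nonneg by (simp add: hat_def)
  next
    case False
    with z have xz: "z < x" by simp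
    show ?thesis
    proof (cases "\<alpha> > 0")
      case True
      have "hat (x - z) powr (- \<alpha>) * K x y z \<le> C * hat x powr (- 2 * \<alpha>) * hat y powr (- \<alpha>) * chk x powr \<Lambda> * chk y powr \<Lambda> * \<phi> z"
        using singular[OF True] xz z xy by (simp add: kernel_singular_def)
      also have "\<dots> = (C * hat x powr (- 2 * \<alpha>) * \<phi> z) * chk x powr \<Lambda> * (hat y powr (- \<alpha>) * chk y powr \<Lambda>)" by (simp only: mult_ac)
      also have "\<dots> \<le> mass \<phi> z * br x powr \<Lambda> * (hat y powr (- \<alpha>) + br y powr \<Lambda>)"
      proof (intro mult_mono)
        have "C * hat x powr (- 2 * \<alpha>) * \<phi> z \<le> C * hat z powr (- 2 * \<alpha>) * \<phi> z"
          using hat_powr_mono[of z x "2 * \<alpha>"] z alpha C phi0 by (intro mult_right_mono mult_left_mono) auto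
        also have "\<dots> \<le> mass \<phi> z" using mg(5) by (simp add: q_def mult_ac)
        finally show "C * hat x powr (- 2 * \<alpha>) * \<phi> z \<le> mass \<phi> z" .
        show "chk x powr \<Lambda> \<le> br x powr \<Lambda>" using xy lambda chk_le_br[of x] chk_ge_1[of x] by (intro powr_mono2) auto
        show "hat y powr (- \<alpha>) * chk y powr \<Lambda> \<le> hat y powr (- \<alpha>) + br y powr \<Lambda>"
          using xy alpha lambda by (intro hat_chk_powr_le) auto
      qed (use mass_nonneg in auto)
      finally show ?thesis .
    next
      case False
      with alpha have a: "\<alpha> = 0" by simp
      have h1: "hat (x - z) powr (- \<alpha>) \<le> 1" by (simp add: a)
      have "hat (x - z) powr (- \<alpha>) * K x y z \<le> 1 * K x y z" using h1 K0 by (rule mult_right_mono)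
      also have "\<dots> \<le> q * (br x powr \<Lambda> * br y powr \<Lambda>)" using Kl by (simp add: mult.commute)
      also have "\<dots> \<le> mass \<phi> z * (br x powr \<Lambda> * (hat y powr (- \<alpha>) + br y powr \<Lambda>))"
        using mg(1) mass_nonneg q0 by (intro mult_mono) auto
      finally show ?thesis by (simp add: mult.assoc)
    qed
  qed
qed

definition K0 :: "real \<Rightarrow> real \<Rightarrow> real \<Rightarrow> real" where
  "K0 x y z = (if 0 \<le> x \<and> 0 \<le> y \<and> 0 \<le> z then K x y z else 0)"

text \<open>As \<open>K0\<close> is an extension by zero, the bound must also hold across 0: if
  \<open>x < 0 \<le> x + h\<close>, then \<open>x + h \<le> h\<close>, and the quadratic growth of
  \<open>K\<close> from 0 supplies the factor \<open>h\<close>.\<close>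

lemma K0_Lipschitz:
  assumes z: "0 < z" and y: "y \<noteq> 0" and phi0: "0 \<le> \<phi> z" and h: "0 \<le> h" "h \<le> 1"
  shows "\<bar>K0 (x + h) y z - K0 x y z\<bar> \<le> h * mass \<phi> z * br (x + h) * (hat y powr (- \<alpha>) + br y powr \<Lambda>)"
proof (cases "0 < y \<and> 0 \<le> x + h")
  case False
  then have "K0 (x + h) y z = 0" "K0 x y z = 0" using y h by (auto simp: K0_def)
  then show ?thesis using h mass_nonneg by simp
next
  case True
  define B where "B = hat y powr (- \<alpha>) * chk y powr \<Lambda> * \<phi> z"
  have B0: "0 \<le> B" using phi0 by (simp add: B_def)
  have sd: "\<exists>D. has_second_derivative (\<lambda>u. K u y z) D u \<and> D \<le> B" if "0 \<le> u" for u
  proof -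
    have "\<exists>D. has_second_derivative (\<lambda>u. K u y z) D u \<and> (y > 0 \<longrightarrow> D \<le> B)"
      using second_derivative that True z unfolding kernel_second_derivative_def B_def by (meson less_imp_le)
    then show ?thesis using True by blast
  qed
  obtain f' where f': "\<And>u. 0 \<le> u \<Longrightarrow> ((\<lambda>u. K u y z) has_real_derivative f' u) (at u within Rplus)"
    "\<And>u. 0 \<le> u \<Longrightarrow> \<exists>D\<le>B. (f' has_real_derivative D) (at u within Rplus)"
    using has_second_derivative_common[of "\<lambda>u. K u y z" "\<lambda>D. D \<le> B", OF sd] by blast
  have nn: "0 \<le> K u y z" if "0 \<le> u" for u using that True z by (intro K_nonneg) auto
  have zr: "K u y z = 0" if "0 \<le> u" "u < z" for u using that True by (intro K_supp) auto
  note grow = semiconcave_growth[of "\<lambda>u. K u y z" f' B z, OF f' nn zr z B0]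
  note lip = semiconcave_Lipschitz[of "\<lambda>u. K u y z" f' B z, OF f' nn zr z B0]
  have main: "\<bar>K0 (x + h) y z - K0 x y z\<bar> \<le> 2 * B * (x + h) * h"
  proof (cases "0 \<le> x")
    case x: True
    then show ?thesis using lip[of x "x + h"] True h z by (simp add: K0_def)
  next
    case x: False
    have "K (x + h) y z \<le> B * (x + h) * (x + h)" using grow[of "x + h"] True by simp
    also have "\<dots> \<le> B * (x + h) * h" using x True B0 by (intro mult_left_mono) auto
    also have "\<dots> \<le> 2 * B * (x + h) * h" using B0 True h by (intro mult_right_mono) auto
    finally show ?thesis using nn[of "x + h"] True x z by (simp add: K0_def)
  qed
  have "2 * B * (x + h) * h = h * (2 * \<phi> z) * (x + h) * (hat y powr (- \<alpha>) * chk y powr \<Lambda>)"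
    by (simp add: B_def)
  also have "\<dots> \<le> h * mass \<phi> z * br (x + h) * (hat y powr (- \<alpha>) + br y powr \<Lambda>)"
    using h True alpha lambda phi0 mass_ge(2)[of z \<phi>, OF z phi0] mass_nonneg
    by (intro mult_mono mult_left_mono hat_chk_powr_le) (auto simp: br_def)
  finally show ?thesis using main by linarith
qed

end

lemma integrable_if_Rplus:
  fixes f :: "real \<Rightarrow> real"
  assumes "integrable L f"
  shows "integrable L (\<lambda>x. if x \<in> Rplus then f x else 0)"
proof -
  have "(\<lambda>x. if x \<in> Rplus then f x else 0) = (\<lambda>x. indicator Rplus x *\<^sub>R f x)"
    by (auto simp: indicator_def fun_eq_iff)
  then show ?thesis using integrable_mult_indicator[OF _ assms, of Rplus] by simp
qed

lemma kernel_bounds_measurable: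
  assumes [measurable]: "K' \<in> borel_measurable L3" "m \<in> borel_measurable L3"
  shows "Measurable.pred L3 (\<lambda>p. (snd (snd p))\<^sup>2 * K' p * br (fst p) powr (l - 2)
      \<le> m p * (br (fst p) powr l * br (fst (snd p)) + br (fst p) * br (fst (snd p)) powr l))"
    and "Measurable.pred L3 (\<lambda>p. (1 + (snd (snd p))\<^sup>2) * K' p \<le> m p * br (fst p) powr l * br (fst (snd p)) powr l)"
    and "Measurable.pred L3 (\<lambda>p. hat (fst p - snd (snd p)) powr (- a) * K' p
      \<le> m p * br (fst p) powr l * (hat (fst (snd p)) powr (- a) + br (fst (snd p)) powr l))"
    and "Measurable.pred L3 (\<lambda>p. 0 \<le> K' p \<and> (0 < snd (snd p) \<and> snd (snd p) \<le> fst p \<and> snd (snd p) \<le> fst (snd p)))"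
proof -
  have b: "(\<lambda>p. br (fst p) powr q) \<in> borel_measurable L3" "(\<lambda>p. br (fst (snd p)) powr q) \<in> borel_measurable L3"
    "(\<lambda>p. br (fst p)) \<in> borel_measurable L3" "(\<lambda>p. br (fst (snd p))) \<in> borel_measurable L3" for q by measurable
  have z: "(\<lambda>p. (snd (snd p))\<^sup>2) \<in> borel_measurable L3" by measurable
  have h: "(\<lambda>p. hat (fst p - snd (snd p)) powr (- a)) \<in> borel_measurable L3"
    "(\<lambda>p. hat (fst (snd p)) powr (- a)) \<in> borel_measurable L3" by measurable
  have le: "Measurable.pred L3 (\<lambda>p. f p \<le> g p)" if "f \<in> borel_measurable L3" "g \<in> borel_measurable L3" for f g :: "real \<times> real \<times> real \<Rightarrow> real"
    unfolding Measurable.pred_def using that by (rule borel_measurable_le)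
  note intros = le borel_measurable_times borel_measurable_add borel_measurable_const b z h assms
  show "Measurable.pred L3 (\<lambda>p. (snd (snd p))\<^sup>2 * K' p * br (fst p) powr (l - 2)
      \<le> m p * (br (fst p) powr l * br (fst (snd p)) + br (fst p) * br (fst (snd p)) powr l))"
    by (intro intros)
  show "Measurable.pred L3 (\<lambda>p. (1 + (snd (snd p))\<^sup>2) * K' p \<le> m p * br (fst p) powr l * br (fst (snd p)) powr l)"
    by (intro intros)
  show "Measurable.pred L3 (\<lambda>p. hat (fst p - snd (snd p)) powr (- a) * K' p
      \<le> m p * br (fst p) powr l * (hat (fst (snd p)) powr (- a) + br (fst (snd p)) powr l))"
    by (intro intros)
  show "Measurable.pred L3 (\<lambda>p. 0 \<le> K' p \<and> (0 < snd (snd p) \<and> snd (snd p) \<le> fst p \<and> snd (snd p) \<le> fst (snd p)))"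
    by measurable
qed

section \<open>Borel representatives of the data and the final assembly\<close>

context exchange_kernel begin

lemma mass_measurable:
  assumes [measurable]: "f \<in> borel_measurable L"
  shows "mass f \<in> borel_measurable L"
  unfolding mass_def[abs_def] by measurable

lemma Borel_phi:
  obtains \<phi>' where "\<phi>' \<in> borel_measurable L" "AE z in L. 0 \<le> z \<longrightarrow> \<phi> z = \<phi>' z \<and> 0 \<le> \<phi> z"
    "integrable L (mass \<phi>')"
proof -
  have phiD: "integrable (lebesgue_on Rplus) \<phi>" "integrable (lebesgue_on Rplus) (\<lambda>x. Y_weight (2 * \<alpha>) (2 * \<Lambda>) x * \<bar>\<phi> x\<bar>)"
    "AE x in lebesgue_on Rplus. 0 \<le> \<phi> x"
    using phi by (auto simp: Y_plus_def Y_space_def)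
  have R: "Rplus \<in> sets (borel :: real measure)" by simp
  obtain g where g [measurable]: "g \<in> borel_measurable L" and eq: "AE x in L. (if x \<in> Rplus then \<phi> x else 0) = g x"
    using Borel_version[OF R borel_measurable_integrable[OF phiD(1)]] by blast
  have pos: "AE x in L. x \<in> Rplus \<longrightarrow> 0 \<le> \<phi> x" using phiD(3) unfolding AE_lebesgue_on_iff[OF R] .
  have good: "AE z in L. 0 \<le> z \<longrightarrow> \<phi> z = g z \<and> 0 \<le> \<phi> z"
    using eq pos by eventually_elim auto
  have eqw: "AE x in L. (if x \<in> Rplus then Y_weight (2 * \<alpha>) (2 * \<Lambda>) x * \<bar>\<phi> x\<bar> else 0) = Y_weight (2 * \<alpha>) (2 * \<Lambda>) x * \<bar>g x\<bar>"
    using eq by eventually_elim (auto split: if_splits)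
  have iw: "integrable L (\<lambda>x. Y_weight (2 * \<alpha>) (2 * \<Lambda>) x * \<bar>g x\<bar>)"
    using lebesgue_on_integrable_iff[OF R _ eqw] phiD(2) by simp
  \<comment> \<open>The space of \<open>\<phi>\<close> is what makes \<open>mass\<close> integrable:
    near 0 the weight is of order \<open>z powr (- 2 * \<alpha>)\<close>, and
    \<open>1 + z\<^sup>2 \<le> 2 * z powr (2 * \<Lambda>)\<close> for \<open>z > 1\<close>.\<close>
  have w: "(1 + z\<^sup>2) * hat z powr (- 2 * \<alpha>) \<le> 2 * Y_weight (2 * \<alpha>) (2 * \<Lambda>) z" if "0 < z" for z
  proof (cases "z \<le> 1")
    case True
    have "(1 + z\<^sup>2) * hat z powr (- 2 * \<alpha>) \<le> 2 * z powr (- 2 * \<alpha>)"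
      using True that by (intro mult_mono) (auto simp: hat_def power_le_one)
    then show ?thesis by (simp add: Y_weight_def add_nonneg_nonneg add_increasing2)
  next
    case False
    then have h: "hat z = 1" and z1: "1 \<le> z\<^sup>2" by (auto simp: hat_def)
    have "z powr 2 \<le> z powr (2 * \<Lambda>)" using False lambda by (intro powr_mono) auto
    then have "z\<^sup>2 \<le> z powr (2 * \<Lambda>)" using False by simp
    with z1 have "1 + z\<^sup>2 \<le> 2 * z powr (2 * \<Lambda>)" by linarith
    also have "\<dots> \<le> 2 * Y_weight (2 * \<alpha>) (2 * \<Lambda>) z" by (simp add: Y_weight_def)
    finally show ?thesis by (simp add: h)
  qed
  have [measurable]: "mass g \<in> borel_measurable L" using g by (rule mass_measurable)
  have "integrable L (mass g)"
  proof (rule Bochner_Integration.integrable_bound)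
    show "integrable L (\<lambda>x. (2 + C) * 2 * (Y_weight (2 * \<alpha>) (2 * \<Lambda>) x * \<bar>g x\<bar>))" using iw by simp
    show "AE x in L. norm (mass g x) \<le> norm ((2 + C) * 2 * (Y_weight (2 * \<alpha>) (2 * \<Lambda>) x * \<bar>g x\<bar>))"
    proof (rule AE_I2)
      fix z
      have Y0: "0 \<le> Y_weight (2 * \<alpha>) (2 * \<Lambda>) z" by (simp add: Y_weight_def)
      have "mass g z \<le> (2 + C) * 2 * (Y_weight (2 * \<alpha>) (2 * \<Lambda>) z * \<bar>g z\<bar>)"
      proof (cases "0 < z")
        case True
        have "mass g z = (2 + C) * ((1 + z\<^sup>2) * hat z powr (- 2 * \<alpha>)) * max 0 (g z)" using True by (simp add: mass_def)
        also have "\<dots> \<le> (2 + C) * (2 * Y_weight (2 * \<alpha>) (2 * \<Lambda>) z) * \<bar>g z\<bar>"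
          using C Y0 by (intro mult_mono[OF mult_left_mono[OF w[OF True]]]) auto
        finally show ?thesis by (simp only: mult.assoc)
      next
        case False
        then show ?thesis using Y0 C by (simp add: mass_def)
      qed
      then show "norm (mass g z) \<le> norm ((2 + C) * 2 * (Y_weight (2 * \<alpha>) (2 * \<Lambda>) z * \<bar>g z\<bar>))"
        using mass_nonneg[of g z] by simp
    qed
  qed measurable
  with g good show thesis by (rule that)
qed

text \<open>A Borel version satisfies the bounds only almost everywhere; setting it to 0 wherever
  one of them fails makes them hold at every point. The Lipschitz bound compares two points, so such
  a cut could destroy it there; it stays an almost everywhere statement.\<close>

lemma Borel_kernel:
  obtains k \<phi>' where "kernel k (mass \<phi>') \<Lambda> \<alpha>" "AE (x, y, z) in L3. k x y z = K0 x y z"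
proof -
  obtain \<phi>' where g [measurable]: "\<phi>' \<in> borel_measurable L" and good: "AE z in L. 0 \<le> z \<longrightarrow> \<phi> z = \<phi>' z \<and> 0 \<le> \<phi> z"
    and im: "integrable L (mass \<phi>')" by (rule Borel_phi)
  have R3: "Rplus \<times> Rplus \<times> Rplus \<in> sets (borel :: (real \<times> real \<times> real) measure)"
    by (intro borel_closed closed_Times) auto
  obtain K' where K'm: "K' \<in> borel_measurable lborel"
    and K'eq: "AE p in lborel. (if p \<in> Rplus \<times> Rplus \<times> Rplus then (case p of (x, y, z) \<Rightarrow> K x y z) else 0) = K' p"
    using Borel_version[OF R3 K_meas] by blast
  have [measurable]: "K' \<in> borel_measurable L3" using K'm unfolding L3_eq .
  have eqK: "AE (x, y, z) in L3. K0 x y z = K' (x, y, z)"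
    using K'eq unfolding L3_eq
  proof eventually_elim
    case (elim p)
    obtain x y z where p: "p = (x, y, z)" by (cases p)
    have "K0 x y z = (if p \<in> Rplus \<times> Rplus \<times> Rplus then (case p of (x, y, z) \<Rightarrow> K x y z) else 0)"
      by (simp add: p K0_def)
    then show ?case using elim by (simp only: p prod.case)
  qed
  have [measurable]: "mass \<phi>' \<in> borel_measurable L" using g by (rule mass_measurable)
  define Q1 where "Q1 p \<longleftrightarrow> (case p of (x, y, z) \<Rightarrow> z\<^sup>2 * K' p * br x powr (\<Lambda> - 2) \<le> mass \<phi>' z * (br x powr \<Lambda> * br y + br x * br y powr \<Lambda>))" for p
  define Q2 where "Q2 p \<longleftrightarrow> (case p of (x, y, z) \<Rightarrow> (1 + z\<^sup>2) * K' p \<le> mass \<phi>' z * br x powr \<Lambda> * br y powr \<Lambda>)" for p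
  define Q3 where "Q3 p \<longleftrightarrow> (case p of (x, y, z) \<Rightarrow> hat (x - z) powr (- \<alpha>) * K' p \<le> mass \<phi>' z * br x powr \<Lambda> * (hat y powr (- \<alpha>) + br y powr \<Lambda>))" for p
  define Q4 where "Q4 p \<longleftrightarrow> 0 \<le> K' p \<and> (case p of (x, y, z) \<Rightarrow> 0 < z \<and> z \<le> x \<and> z \<le> y)" for p
  have mm: "(\<lambda>p. mass \<phi>' (snd (snd p))) \<in> borel_measurable L3"
    by (rule measurable_compose[OF _ mass_measurable[OF g]]) simp
  note Q = kernel_bounds_measurable[OF \<open>K' \<in> borel_measurable L3\<close> mm]
  have "Measurable.pred L3 Q1" unfolding Q1_def[abs_def] case_prod_unfold by (rule Q(1))
  moreover have "Measurable.pred L3 Q2" unfolding Q2_def[abs_def] case_prod_unfold by (rule Q(2))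
  moreover have "Measurable.pred L3 Q3" unfolding Q3_def[abs_def] case_prod_unfold by (rule Q(3))
  moreover have "Measurable.pred L3 Q4" unfolding Q4_def[abs_def] case_prod_unfold by (rule Q(4))
  moreover define Q where "Q p \<longleftrightarrow> Q4 p \<and> Q1 p \<and> Q2 p \<and> Q3 p" for p
  ultimately have [measurable]: "Measurable.pred L3 Q" unfolding Q_def[abs_def] by (intro pred_intros_logic)
  note Q_defs = Q_def Q1_def Q2_def Q3_def Q4_def
  define k where "k x y z = (if Q (x, y, z) then K' (x, y, z) else 0)" for x y z
  have goodz: "AE (x, y, z) in L3. 0 \<le> z \<longrightarrow> \<phi> z = \<phi>' z \<and> 0 \<le> \<phi> z" by (rule AE_triple_thd[OF good])
  have mass_eq: "mass \<phi>' z = mass \<phi> z" if "\<phi> z = \<phi>' z" for z using that by (simp add: mass_def)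
  have AEz: "AE (x, y, z) in L3. z \<noteq> 0" by (rule AE_triple_thd) (rule AE_lborel_singleton)
  have AEy: "AE (x, y, z) in L3. y \<noteq> 0" by (rule AE_triple_snd) (rule AE_lborel_singleton)
  have kK0: "AE (x, y, z) in L3. k x y z = K0 x y z"
    using eqK goodz AEz
  proof eventually_elim
    case (elim p)
    obtain x y z where p: "p = (x, y, z)" by (cases p)
    have e: "K0 x y z = K' (x, y, z)" and gz: "0 \<le> z \<Longrightarrow> \<phi> z = \<phi>' z \<and> 0 \<le> \<phi> z" and z0: "z \<noteq> 0"
      using elim unfolding p by auto
    show ?case
    proof (cases "0 < z \<and> z \<le> x \<and> z \<le> y")
      case True
      then have z: "0 < z" "z \<le> x" "z \<le> y" "0 \<le> \<phi> z" "\<phi> z = \<phi>' z" using gz by auto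
      have KK: "K' (x, y, z) = K x y z" using e z by (simp add: K0_def)
      have "Q (x, y, z)"
        unfolding Q_defs prod.case KK mass_eq[OF z(5)] using z K_bounds[OF z(1-4)] K_nonneg[of x y z] by auto
      then show ?thesis by (simp add: p k_def e)
    next
      case False
      then have "\<not> Q (x, y, z)" by (auto simp: Q_defs)
      moreover have "K0 x y z = 0"
      proof (cases "0 \<le> x \<and> 0 \<le> y \<and> 0 \<le> z")
        case True
        with False z0 have "z > x \<or> z > y" by auto
        then have "K x y z = 0" using K_supp[of x y z] K_supp[of y x z] K_sym[of x y z] True by auto
        then show ?thesis by (simp add: K0_def)
      qed (auto simp: K0_def)
      ultimately show ?thesis by (simp add: p k_def)
    qed
  qed
  have "kernel k (mass \<phi>') \<Lambda> \<alpha>"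
  proof
    show "(\<lambda>(x, y, z). k x y z) \<in> borel_measurable L3" unfolding k_def case_prod_unfold prod.collapse by measurable
    show "0 \<le> k x y z" for x y z by (auto simp: k_def Q_defs)
    show "k x y z = 0" if "\<not> (0 < z \<and> z \<le> x \<and> z \<le> y)" for x y z using that by (auto simp: k_def Q_defs)
    show "z\<^sup>2 * k x y z * br x powr (\<Lambda> - 2) \<le> mass \<phi>' z * (br x powr \<Lambda> * br y + br x * br y powr \<Lambda>)" for x y z
      using mass_nonneg[of \<phi>' z] by (auto simp: k_def Q_defs)
    show "(1 + z\<^sup>2) * k x y z \<le> mass \<phi>' z * br x powr \<Lambda> * br y powr \<Lambda>" for x y z
      using mass_nonneg[of \<phi>' z] by (auto simp: k_def Q_defs)
    show "hat (x - z) powr (- \<alpha>) * k x y z \<le> mass \<phi>' z * br x powr \<Lambda> * (hat y powr (- \<alpha>) + br y powr \<Lambda>)" for x y z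
      using mass_nonneg[of \<phi>' z] by (auto simp: k_def Q_defs)
    show "AE (x, y, z) in L3. \<bar>k (x + h) y z - k x y z\<bar> \<le> h * mass \<phi>' z * br (x + h) * (hat y powr (- \<alpha>) + br y powr \<Lambda>)"
      if h: "0 \<le> h" "h \<le> 1" for h
      using kK0 AE_triple_shift[OF kK0, of h] goodz AEz AEy
    proof eventually_elim
      case (elim p)
      obtain x y z where p: "p = (x, y, z)" by (cases p)
      have e: "k x y z = K0 x y z" "k (x + h) y z = K0 (x + h) y z" and gz: "0 \<le> z \<Longrightarrow> \<phi> z = \<phi>' z \<and> 0 \<le> \<phi> z" and z0: "z \<noteq> 0" "y \<noteq> 0"
        using elim unfolding p by auto
      show ?case
      proof (cases "0 < z")
        case True
        then have gz: "\<phi> z = \<phi>' z" "0 \<le> \<phi> z" using gz by auto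
        show ?thesis using K0_Lipschitz[OF True z0(2) gz(2) h, of x] by (simp add: p e mass_eq[OF gz(1)])
      next
        case False
        then show ?thesis using z0 h mass_nonneg[of \<phi>' z] by (simp add: p e K0_def)
      qed
    qed
  qed (use im mass_nonneg lambda alpha in auto)
  then show thesis using kK0 by (rule that)
qed

lemma Borel_state:
  assumes c: "c \<in> Y_plus \<alpha> \<Lambda>"
  obtains c' where "state \<Lambda> \<alpha> c'" "AE x in L. 0 \<le> x \<longrightarrow> c x = c' x"
proof -
  have cD: "integrable (lebesgue_on Rplus) c" "integrable (lebesgue_on Rplus) (\<lambda>x. Y_weight \<alpha> \<Lambda> x * \<bar>c x\<bar>)"
    "AE x in lebesgue_on Rplus. 0 \<le> c x"
    using c by (auto simp: Y_plus_def Y_space_def)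
  have R: "Rplus \<in> sets (borel :: real measure)" by simp
  obtain g where g [measurable]: "g \<in> borel_measurable L" and eq: "AE x in L. (if x \<in> Rplus then c x else 0) = g x"
    using Borel_version[OF R borel_measurable_integrable[OF cD(1)]] by blast
  have pos: "AE x in L. x \<in> Rplus \<longrightarrow> 0 \<le> c x" using cD(3) unfolding AE_lebesgue_on_iff[OF R] .
  have n0: "AE x in L. x \<noteq> (0::real)" by (rule AE_lborel_singleton)
  \<comment> \<open>Nonnegative everywhere and 0 off the positive axis, so that weights need to be
    compared for \<open>x > 0\<close> only.\<close>
  define c' where "c' x = (if 0 < x then max 0 (g x) else 0)" for x
  have [measurable]: "c' \<in> borel_measurable L" unfolding c'_def by measurable
  have e: "AE x in L. (if x \<in> Rplus then c x else 0) = c' x"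
    using eq pos n0 by eventually_elim (auto simp: c'_def split: if_splits)
  have ew: "AE x in L. (if x \<in> Rplus then Y_weight \<alpha> \<Lambda> x * \<bar>c x\<bar> else 0) = Y_weight \<alpha> \<Lambda> x * c' x"
    using e pos by eventually_elim (auto split: if_splits)
  have i: "integrable L c'" using lebesgue_on_integrable_iff[OF R _ e] cD(1) by simp
  have iw: "integrable L (\<lambda>x. Y_weight \<alpha> \<Lambda> x * c' x)" using lebesgue_on_integrable_iff[OF R _ ew] cD(2) by simp
  have c'0: "0 \<le> c' x" for x by (simp add: c'_def)
  have "integrable L (\<lambda>x. br x powr \<Lambda> * c' x)"
  proof (rule Bochner_Integration.integrable_bound)
    show "integrable L (\<lambda>x. 4 * c' x + 4 * (Y_weight \<alpha> \<Lambda> x * c' x))" using i iw by simp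
    show "AE x in L. norm (br x powr \<Lambda> * c' x) \<le> norm (4 * c' x + 4 * (Y_weight \<alpha> \<Lambda> x * c' x))"
    proof (rule AE_I2)
      fix x
      show "norm (br x powr \<Lambda> * c' x) \<le> norm (4 * c' x + 4 * (Y_weight \<alpha> \<Lambda> x * c' x))"
      proof (cases "0 < x")
        case True
        have "br x powr \<Lambda> \<le> (2 * max 1 x) powr \<Lambda>" using True lambda by (intro powr_mono2) (auto simp: br_def)
        also have "\<dots> = 2 powr \<Lambda> * max 1 x powr \<Lambda>" by (simp add: powr_mult)
        also have "\<dots> \<le> 2 powr 2 * (1 + x powr \<Lambda>)"
          using lambda True by (intro mult_mono powr_mono) (auto simp: max_def)
        also have "\<dots> \<le> 4 + 4 * Y_weight \<alpha> \<Lambda> x" by (simp add: Y_weight_def)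
        finally have "br x powr \<Lambda> * c' x \<le> (4 + 4 * Y_weight \<alpha> \<Lambda> x) * c' x" using c'0 by (rule mult_right_mono)
        then have "br x powr \<Lambda> * c' x \<le> 4 * c' x + 4 * (Y_weight \<alpha> \<Lambda> x * c' x)" by (simp add: algebra_simps)
        then show ?thesis using c'0[of x] by simp
      qed (simp add: c'_def)
    qed
  qed measurable
  moreover have "integrable L (\<lambda>x. hat x powr (- \<alpha>) * c' x)"
  proof (rule Bochner_Integration.integrable_bound)
    show "integrable L (\<lambda>x. c' x + Y_weight \<alpha> \<Lambda> x * c' x)" using i iw by simp
    show "AE x in L. norm (hat x powr (- \<alpha>) * c' x) \<le> norm (c' x + Y_weight \<alpha> \<Lambda> x * c' x)"
    proof (rule AE_I2)
      fix x
      show "norm (hat x powr (- \<alpha>) * c' x) \<le> norm (c' x + Y_weight \<alpha> \<Lambda> x * c' x)"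
      proof (cases "0 < x")
        case True
        have "hat x powr (- \<alpha>) \<le> 1 + Y_weight \<alpha> \<Lambda> x" using True by (auto simp: hat_def min_def Y_weight_def)
        then have "hat x powr (- \<alpha>) * c' x \<le> (1 + Y_weight \<alpha> \<Lambda> x) * c' x" using c'0 by (rule mult_right_mono)
        then show ?thesis using c'0[of x] by (simp add: distrib_right)
      qed (simp add: c'_def)
    qed
  qed measurable
  ultimately have "state \<Lambda> \<alpha> c'" using c'0 by (simp add: state_def)
  moreover have "AE x in L. 0 \<le> x \<longrightarrow> c x = c' x" using e by eventually_elim (auto split: if_splits)
  ultimately show thesis by (rule that)
qed

lemma weight_le: "0 \<le> x \<Longrightarrow> Y_weight \<alpha> \<Lambda> x \<le> hat x powr (- \<alpha>) + br x powr \<Lambda>"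
proof -
  assume x: "0 \<le> x"
  have "x powr (- \<alpha>) \<le> hat x powr (- \<alpha>)"
  proof (cases "x \<le> 1")
    case True then show ?thesis by (simp add: hat_def)
  next
    case False then show ?thesis using alpha powr_mono2'[of "- \<alpha>" 1 x] by (simp add: hat_def)
  qed
  moreover have "x powr \<Lambda> \<le> br x powr \<Lambda>" using x lambda by (intro powr_mono2) (auto simp: br_def)
  ultimately show ?thesis by (simp add: Y_weight_def)
qed

lemma state_Y_plus:
  assumes s: "state \<Lambda> \<alpha> u"
  shows "u \<in> Y_plus \<alpha> \<Lambda>"
    and "Y_norm \<alpha> \<Lambda> u \<le> mom (\<lambda>x. hat x powr (- \<alpha>)) u + mom (\<lambda>x. br x powr \<Lambda>) u"
proof -
  have [measurable]: "u \<in> borel_measurable L" and u0: "\<And>x. 0 \<le> u x"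
    and i: "integrable L (\<lambda>x. br x powr \<Lambda> * u x)" "integrable L (\<lambda>x. hat x powr (- \<alpha>) * u x)"
    using s by (auto simp: state_def)
  have R: "Rplus \<in> sets (borel :: real measure)" by simp
  have iu: "integrable L u"
  proof -
    have "integrable L (\<lambda>x. 1 * u x)"
      using br_ge_1 lambda by (intro integrable_lower_weight[OF i(1)]) (auto intro!: ge_one_powr_ge_zero)
    then show ?thesis by simp
  qed
  let ?g = "\<lambda>x. if x \<in> Rplus then u x else 0" and ?h = "\<lambda>x. if x \<in> Rplus then Y_weight \<alpha> \<Lambda> x * \<bar>u x\<bar> else 0"
  have ih: "integrable L ?h"
  proof (rule Bochner_Integration.integrable_bound)
    show "integrable L (\<lambda>x. hat x powr (- \<alpha>) * u x + br x powr \<Lambda> * u x)" using i by simp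
    show "AE x in L. norm (?h x) \<le> norm (hat x powr (- \<alpha>) * u x + br x powr \<Lambda> * u x)"
    proof (rule AE_I2)
      fix x
      have "0 \<le> Y_weight \<alpha> \<Lambda> x" by (simp add: Y_weight_def)
      then show "norm (?h x) \<le> norm (hat x powr (- \<alpha>) * u x + br x powr \<Lambda> * u x)"
        using mult_right_mono[OF weight_le u0, of x x] u0[of x] by (simp add: distrib_right)
    qed
  qed measurable
  have "integrable L ?g" by (rule integrable_if_Rplus[OF iu])
  then have 1: "integrable (lebesgue_on Rplus) u" by (subst lebesgue_on_integrable_iff[OF R, of ?g]) auto
  have 2: "integrable (lebesgue_on Rplus) (\<lambda>x. Y_weight \<alpha> \<Lambda> x * \<bar>u x\<bar>)"
    using ih by (subst lebesgue_on_integrable_iff[OF R, of ?h]) auto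
  show "u \<in> Y_plus \<alpha> \<Lambda>" using 1 2 u0 by (simp add: Y_plus_def Y_space_def)
  have "Y_norm \<alpha> \<Lambda> u = (LINT x|L. ?h x)"
    unfolding Y_norm_def by (rule lebesgue_on_integral_eq[OF R]) auto
  also have "\<dots> \<le> (LINT x|L. hat x powr (- \<alpha>) * u x + br x powr \<Lambda> * u x)"
  proof (rule integral_mono[OF ih])
    show "integrable L (\<lambda>x. hat x powr (- \<alpha>) * u x + br x powr \<Lambda> * u x)" using i by simp
    show "?h x \<le> hat x powr (- \<alpha>) * u x + br x powr \<Lambda> * u x" for x
      using mult_right_mono[OF weight_le u0, of x x] u0[of x] by (simp add: distrib_right)
  qed
  also have "\<dots> = mom (\<lambda>x. hat x powr (- \<alpha>)) u + mom (\<lambda>x. br x powr \<Lambda>) u" using i by (simp add: mom_def)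
  finally show "Y_norm \<alpha> \<Lambda> u \<le> mom (\<lambda>x. hat x powr (- \<alpha>)) u + mom (\<lambda>x. br x powr \<Lambda>) u" .
qed

lemma bounded_Borel_version:
  assumes f: "f \<in> Linfty"
  obtains f' B where "f' \<in> borel_measurable L" "\<And>x. \<bar>f' x\<bar> \<le> B" "\<And>x. x < 0 \<Longrightarrow> f' x = 0"
    "AE x in L. 0 \<le> x \<longrightarrow> f x = f' x"
proof -
  have R: "Rplus \<in> sets (borel :: real measure)" by simp
  obtain M where fm: "f \<in> borel_measurable (lebesgue_on Rplus)" and M: "AE x in lebesgue_on Rplus. \<bar>f x\<bar> \<le> M"
    using f by (auto simp: Linfty_def)
  obtain g where g [measurable]: "g \<in> borel_measurable L" and eq: "AE x in L. (if x \<in> Rplus then f x else 0) = g x"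
    using Borel_version[OF R fm] by blast
  have M': "AE x in L. x \<in> Rplus \<longrightarrow> \<bar>f x\<bar> \<le> M" using M unfolding AE_lebesgue_on_iff[OF R] .
  \<comment> \<open>Clipping turns the essential bound into a pointwise one. The zero values on the
    negative axis let integrals over \<open>Rplus\<close> become integrals over the line.\<close>
  define f' where "f' x = (if 0 \<le> x then max (- \<bar>M\<bar>) (min \<bar>M\<bar> (g x)) else 0)" for x
  have "f' \<in> borel_measurable L" unfolding f'_def by measurable
  moreover have "\<bar>f' x\<bar> \<le> \<bar>M\<bar>" for x by (auto simp: f'_def)
  moreover have "f' x = 0" if "x < 0" for x using that by (simp add: f'_def)
  moreover have "AE x in L. 0 \<le> x \<longrightarrow> f x = f' x" using eq M' by eventually_elim (auto simp: f'_def)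
  ultimately show thesis by (rule that)
qed

theorem global_weak_solution:
  assumes initial: "c\<^sub>0 \<in> Y_plus \<alpha> \<Lambda>"
  shows "\<exists>c. weak_solution K \<Lambda> \<alpha> \<infinity> c\<^sub>0 c"
proof -
  obtain k \<phi>' where kern: "kernel k (mass \<phi>') \<Lambda> \<alpha>" and kK: "AE (x, y, z) in L3. k x y z = K0 x y z"
    by (rule Borel_kernel)
  obtain c0 where st0: "state \<Lambda> \<alpha> c0" and eq0: "AE x in L. 0 \<le> x \<longrightarrow> c\<^sub>0 x = c0 x"
    by (rule Borel_state[OF initial])
  interpret k: kernel k "mass \<phi>'" \<Lambda> \<alpha> by (rule kern)
  interpret I: initial_state k "mass \<phi>'" \<Lambda> \<alpha> c0 by unfold_locales (rule st0)
  let ?A = "growth_bound (mass \<phi>') \<Lambda> c0" and ?W = "weight_bound (mass \<phi>') \<Lambda> \<alpha> c0" and ?S = "LINT z|L. mass \<phi>' z"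
  obtain c where st: "\<And>t. 0 \<le> t \<Longrightarrow> state \<Lambda> \<alpha> (c t)" and c_0: "AE x in L. c 0 x = c0 x"
    and Mb: "\<And>T t. 0 \<le> t \<Longrightarrow> t \<le> T \<Longrightarrow> mom (\<lambda>x. br x powr \<Lambda>) (c t) \<le> ?A T \<and> mom (\<lambda>x. hat x powr (- \<alpha>)) (c t) \<le> ?W T"
    and time: "\<And>T s t. 0 \<le> s \<Longrightarrow> s \<le> t \<Longrightarrow> t \<le> T \<Longrightarrow> (dist1 (c t) (c s)) \<le> (t - s) * (4 * ?S * (?A T)\<^sup>2)"
    and weak: "\<And>t f B. 0 \<le> t \<Longrightarrow> f \<in> borel_measurable L \<Longrightarrow> (\<And>x. \<bar>f x\<bar> \<le> B) \<Longrightarrow>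
        (\<lambda>s. indicator {0..t} s * k.coll (c s) f) \<in> borel_measurable L \<and>
        (LINT x|L. f x * (c t x - c0 x)) = (LINT s|L. indicator {0..t} s * k.coll (c s) f)"
    using I.limit_solution by blast
  note D = k.stateD[OF st]
  have R: "Rplus \<in> sets (borel :: real measure)" by simp
  have R3: "Rplus \<times> Rplus \<times> Rplus \<in> sets (borel :: (real \<times> real \<times> real) measure)"
    by (intro borel_closed closed_Times) auto
  have times: "times \<infinity> = {0..}" by (auto simp: times_def)
  have L1: "L1_dist (c s) (c t) \<le> (dist1 (c s) (c t))" if "0 \<le> s" "0 \<le> t" for s t
  proof -
    have [measurable]: "c s \<in> borel_measurable L" "c t \<in> borel_measurable L" using D(1) that by auto
    have i: "integrable L (\<lambda>x. \<bar>c s x - c t x\<bar>)" using D(3) that by auto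
    have "L1_dist (c s) (c t) = (LINT x|L. (if x \<in> Rplus then \<bar>c s x - c t x\<bar> else 0))"
      unfolding L1_dist_def by (rule lebesgue_on_integral_eq[OF R]) auto
    also have "\<dots> \<le> (dist1 (c s) (c t))"
    proof (rule integral_mono[OF _ i])
      show "integrable L (\<lambda>x. if x \<in> Rplus then \<bar>c s x - c t x\<bar> else 0)"
        by (rule integrable_if_Rplus[OF i])
    qed simp
    finally show ?thesis .
  qed
  have cont: "((\<lambda>s. L1_dist (c s) (c t)) \<longlongrightarrow> 0) (at t within {0..})" if t: "0 \<le> t" for t
  proof (rule Lim_null_comparison)
    define Q where "Q = 4 * ?S * (?A (t + 1))\<^sup>2"
    show "eventually (\<lambda>s. norm (L1_dist (c s) (c t)) \<le> \<bar>s - t\<bar> * Q) (at t within {0..})"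
      unfolding eventually_at
    proof (intro exI[of _ 1] conjI ballI impI)
      fix s :: real assume s: "s \<in> {0..}" "s \<noteq> t \<and> dist s t < 1"
      have le: "(dist1 (c s) (c t)) \<le> \<bar>s - t\<bar> * Q"
      proof (cases "s \<le> t")
        case True
        have "(dist1 (c s) (c t)) = (dist1 (c t) (c s))" by (simp add: abs_minus_commute)
        also have "\<dots> \<le> (t - s) * Q" unfolding Q_def using True s by (intro time) auto
        finally show ?thesis using True by (simp add: abs_if)
      next
        case False
        then have "(dist1 (c s) (c t)) \<le> (s - t) * Q"
          unfolding Q_def using s t by (intro time) (auto simp: dist_real_def)
        then show ?thesis using False by simp
      qed
      have "0 \<le> L1_dist (c s) (c t)" by (simp add: L1_dist_def)
      then show "norm (L1_dist (c s) (c t)) \<le> \<bar>s - t\<bar> * Q" using L1[of s t] le s t by simp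
    qed simp
    have "((\<lambda>s. \<bar>s - t\<bar> * Q) \<longlongrightarrow> \<bar>t - t\<bar> * Q) (at t within {0..})" by (intro tendsto_intros)
    then show "((\<lambda>s. \<bar>s - t\<bar> * Q) \<longlongrightarrow> 0) (at t within {0..})" by simp
  qed
  have fin: "(\<integral>\<^sup>+ s. (\<integral>\<^sup>+ (x, y, z). ennreal (kap K (c s) x y z) \<partial>lebesgue_on (Rplus \<times> Rplus \<times> Rplus)) \<partial>lebesgue_on {0..t}) < \<infinity>" if t: "0 \<le> t" for t
  proof -
    have inner: "(\<integral>\<^sup>+ (x, y, z). ennreal (kap K (c s) x y z) \<partial>lebesgue_on (Rplus \<times> Rplus \<times> Rplus)) \<le> ennreal (?S * (?A t)\<^sup>2)" if s: "0 \<le> s" "s \<le> t" for s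
    proof -
      have "AE p in lborel. (if p \<in> Rplus \<times> Rplus \<times> Rplus then (case p of (x, y, z) \<Rightarrow> ennreal (kap K (c s) x y z)) else 0)
          = (case p of (x, y, z) \<Rightarrow> ennreal (k x y z * c s x * c s y))"
        using kK unfolding L3_eq
      proof eventually_elim
        case (elim p)
        obtain x y z where p: "p = (x, y, z)" by (cases p)
        have "k x y z = K0 x y z" using elim by (simp add: p)
        then show ?case by (simp add: p K0_def kap_def)
      qed
      then have "(\<integral>\<^sup>+ (x, y, z). ennreal (kap K (c s) x y z) \<partial>lebesgue_on (Rplus \<times> Rplus \<times> Rplus))
          = (\<integral>\<^sup>+ (x, y, z). ennreal (k x y z * c s x * c s y) \<partial>L3)"
        unfolding L3_eq by (rule lebesgue_on_nn_integral_eq[OF R3])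
      also have "\<dots> = (\<integral>\<^sup>+ p. ennreal (case p of (x, y, z) \<Rightarrow> k x y z * c s x * c s y) \<partial>L3)"
        by (intro nn_integral_cong) auto
      also have "\<dots> = ennreal (LINT (x, y, z)|L3. k x y z * c s x * c s y)"
        using k.rate_integrable(1)[OF st[OF s(1)]] k.k_nonneg D(2)[OF s(1)] by (intro nn_integral_eq_integral) auto
      also have "\<dots> \<le> ennreal (?S * (mom (\<lambda>x. br x powr \<Lambda>) (c s))\<^sup>2)"
        by (intro ennreal_leI k.rate_integrable(2) st s)
      also have "\<dots> \<le> ennreal (?S * (?A t)\<^sup>2)"
      proof (intro ennreal_leI mult_left_mono power_mono)
        show "0 \<le> mom (\<lambda>x. br x powr \<Lambda>) (c s)" using D(2)[OF s(1)] by (intro k.mom_nonneg) auto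
      qed (use Mb[OF s] in auto)
      finally show ?thesis .
    qed
    have "(\<integral>\<^sup>+ s. (\<integral>\<^sup>+ (x, y, z). ennreal (kap K (c s) x y z) \<partial>lebesgue_on (Rplus \<times> Rplus \<times> Rplus)) \<partial>lebesgue_on {0..t})
       \<le> (\<integral>\<^sup>+ s. ennreal (?S * (?A t)\<^sup>2) \<partial>lebesgue_on {0..t})"
      using inner by (intro nn_integral_mono) auto
    also have "\<dots> = ennreal (?S * (?A t)\<^sup>2) * emeasure (lebesgue_on {0..t}) {0..t}"
      by simp
    also have "\<dots> = ennreal (?S * (?A t)\<^sup>2) * ennreal t" using t by (simp add: emeasure_restrict_space)
    also have "\<dots> < \<infinity>" by (simp add: ennreal_mult_less_top)
    finally show ?thesis .
  qed
  have eqn: "(LINT x|lebesgue_on Rplus. f x * (c t x - c\<^sub>0 x)) =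
      (LINT s|lebesgue_on {0..t}. LINT (x, y, z)|lebesgue_on Dset. Delta z f x * kap K (c s) x y z)"
    if t: "0 \<le> t" and f: "f \<in> Linfty" for t f
  proof -
    obtain f' B where f'm [measurable]: "f' \<in> borel_measurable L" and f'B: "\<And>x. \<bar>f' x\<bar> \<le> B" and f'neg: "\<And>x. x < 0 \<Longrightarrow> f' x = 0"
      and ff': "AE x in L. 0 \<le> x \<longrightarrow> f x = f' x"
      using bounded_Borel_version[OF f] by blast
    note wk = weak[OF t f'm f'B]
    have [measurable]: "c0 \<in> borel_measurable L" "c t \<in> borel_measurable L"
      using k.stateD(1)[OF st0] D(1)[OF t] by auto
    have "(LINT x|lebesgue_on Rplus. f x * (c t x - c\<^sub>0 x)) = (LINT x|L. f' x * (c t x - c0 x))"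
    proof (rule lebesgue_on_integral_eq[OF R])
      show "AE x in L. (if x \<in> Rplus then f x * (c t x - c\<^sub>0 x) else 0) = f' x * (c t x - c0 x)"
        using ff' eq0 by eventually_elim (auto simp: f'neg)
    qed measurable
    also have "\<dots> = (LINT s|L. indicator {0..t} s * k.coll (c s) f')" using wk by simp
    also have "\<dots> = (LINT s|lebesgue_on {0..t}. LINT (x, y, z)|lebesgue_on Dset. Delta z f x * kap K (c s) x y z)"
    proof (rule lebesgue_on_integral_eq[symmetric])
      have closedD: "Dset = {p. 0 \<le> fst p} \<inter> {p. 0 \<le> fst (snd p)} \<inter> {p. 0 \<le> snd (snd p)} \<inter> {p. snd (snd p) \<le> fst p} \<inter> {p. snd (snd p) \<le> fst (snd p)}"
        by (auto simp: Dset_def)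
      have "closed Dset" unfolding closedD
        by (intro closed_Int closed_Collect_le continuous_intros)
      then have DB: "Dset \<in> sets borel" by (rule borel_closed)
      have inner: "(LINT (x, y, z)|lebesgue_on Dset. Delta z f x * kap K (c s) x y z) = k.coll (c s) f'" if s: "0 \<le> s" for s
      proof -
        have "(LINT (x, y, z)|lebesgue_on Dset. Delta z f x * kap K (c s) x y z) = (LINT (x, y, z)|lborel. Delta z f' x * (k x y z * c s x * c s y))"
        proof (rule lebesgue_on_integral_eq[OF DB])
          show "(\<lambda>(x, y, z). Delta z f' x * (k x y z * c s x * c s y)) \<in> borel_measurable lborel"
            using borel_measurable_integrable[OF k.coll_integrable[OF st[OF s] f'm f'B]] unfolding L3_eq .
          show "AE p in lborel. (if p \<in> Dset then (case p of (x, y, z) \<Rightarrow> Delta z f x * kap K (c s) x y z) else 0) = (case p of (x, y, z) \<Rightarrow> Delta z f' x * (k x y z * c s x * c s y))"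
            \<comment> \<open>\<open>Delta z f x\<close> reads \<open>f\<close> at \<open>x\<close>,
              \<open>x + z\<close> and \<open>x - z\<close>, all nonnegative on \<open>Dset\<close>;
              for almost every triple \<open>f\<close> and \<open>f'\<close> agree at these three
              points.\<close>
            using kK AE_triple_fst[OF ff'] AE_triple_add[OF ff'] AE_triple_diff[OF ff'] unfolding L3_eq
          proof eventually_elim
            case (elim p)
            obtain x y z where p: "p = (x, y, z)" by (cases p)
            show ?case
            proof (cases "p \<in> Dset")
              case True
              then have "Delta z f x = Delta z f' x" "k x y z = K x y z"
                using elim by (auto simp: p Dset_def Delta_def K0_def)
              then show ?thesis using True by (simp add: p kap_def)
            next
              case False
              then have "k x y z = 0" by (intro k.k_supp) (auto simp: p Dset_def)
              then show ?thesis using False by (simp add: p)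
            qed
          qed
        qed
        then show ?thesis unfolding k.coll_def L3_eq .
      qed
      show "AE s in L. (if s \<in> {0..t} then (LINT (x, y, z)|lebesgue_on Dset. Delta z f x * kap K (c s) x y z) else 0) = indicator {0..t} s * k.coll (c s) f'"
        by (rule AE_I2) (auto simp: inner)
      show "(\<lambda>s. indicator {0..t} s * k.coll (c s) f') \<in> borel_measurable L" using wk by simp
    qed simp
    finally show ?thesis .
  qed
  have "weak_solution K \<Lambda> \<alpha> \<infinity> c\<^sub>0 c"
    unfolding weak_solution_def times
  proof (intro conjI ballI allI impI)
    show "c t \<in> Y_plus \<alpha> \<Lambda>" if "t \<in> {0..}" for t using that by (intro state_Y_plus(1) st) simp
    show "AE x in lebesgue_on Rplus. c 0 x = c\<^sub>0 x"
      unfolding AE_lebesgue_on_iff[OF R] using c_0 eq0 by eventually_elim simp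
    show "((\<lambda>s. L1_dist (c s) (c t)) \<longlongrightarrow> 0) (at t within {0..})" if "t \<in> {0..}" for t using that by (intro cont) simp
    show "\<exists>M. AE t in lebesgue_on {0..<T}. Y_norm \<alpha> \<Lambda> (c t) \<le> M" if "0 < T \<and> ereal T \<le> \<infinity>" for T
    proof (intro exI[of _ "?W T + ?A T"], rule AE_I2)
      fix t assume "t \<in> space (lebesgue_on {0..<T})"
      then have t: "0 \<le> t" "t \<le> T" by auto
      show "Y_norm \<alpha> \<Lambda> (c t) \<le> ?W T + ?A T" using state_Y_plus(2)[OF st[OF t(1)]] Mb[OF t] by linarith
    qed
  qed (use fin eqn in auto)
  then show ?thesis by blast
qed

end

theorem theorem1p9:
  fixes K :: "real \<Rightarrow> real \<Rightarrow> real \<Rightarrow> real"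
    and \<mu> \<nu> \<Lambda> \<alpha> :: real
    and \<phi> c\<^sub>0 :: "real \<Rightarrow> real"
  assumes K_meas: "(\<lambda>(x, y, z). K x y z) \<in> borel_measurable (lebesgue_on (Rplus \<times> Rplus \<times> Rplus))"
    and K_nonneg: "\<And>x y z. x \<ge> 0 \<Longrightarrow> y \<ge> 0 \<Longrightarrow> z \<ge> 0 \<Longrightarrow> 0 \<le> K x y z"
    and K_sym: "\<And>x y z. x \<ge> 0 \<Longrightarrow> y \<ge> 0 \<Longrightarrow> z \<ge> 0 \<Longrightarrow> K x y z = K y x z"
    and K_supp: "\<And>x y z. x \<ge> 0 \<Longrightarrow> y \<ge> 0 \<Longrightarrow> z > x \<Longrightarrow> K x y z = 0"
    and mu: "0 \<le> \<mu>" "\<mu> \<le> 2"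
    and nu: "0 \<le> \<nu>" "\<nu> \<le> 2"
    and mu_nu: "\<mu> + \<nu> \<le> 3"
    and Lambda: "\<Lambda> = max \<mu> \<nu>" "\<Lambda> > 1"
    and alpha: "\<alpha> \<ge> 0"
    and phi: "\<phi> \<in> Y_plus (2 * \<alpha>) (2 * \<Lambda>)"
    and growth: "kernel_growth K \<mu> \<nu> \<alpha> \<phi>"
    and second_derivative: "kernel_second_derivative K \<alpha> \<Lambda> \<phi>"
    and singular: "\<alpha> > 0 \<Longrightarrow> \<exists>C>0. kernel_singular K \<alpha> \<Lambda> C \<phi>"
    and initial: "c\<^sub>0 \<in> Y_plus \<alpha> \<Lambda>"
  shows "\<exists>c. weak_solution K \<Lambda> \<alpha> \<infinity> c\<^sub>0 c"
proof -
  \<comment> \<open>For \<open>\<alpha> = 0\<close> the second condition is vacuous and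
    \<open>C = 0\<close> will do.\<close>
  obtain C where C: "0 \<le> C" "\<alpha> > 0 \<Longrightarrow> kernel_singular K \<alpha> \<Lambda> C \<phi>"
    using singular by (meson less_imp_le order_refl)
  interpret exchange_kernel K \<mu> \<nu> \<Lambda> \<alpha> C \<phi>
    by unfold_locales fact+
  show ?thesis using initial by (rule global_weak_solution)
qed

end
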